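(* Let $G$ be a real Lie group acting continuously on a locally compact second countable metrizable space $X$, and let $E$ be a countable set with a coding map $E\to G$, $e\mapsto g_e$. Suppose a Markov chain on $E$ is irreducible and positive recurrent and denote by $\pi$ its stationary distribution. Let $x_0\in X$, $e\in E$, and let $m$ be a Borel probability measure on $X$ invariant under $g_w$ for every admissible word $w\in E^*$ starting with $e$. If the trajectory $(b_{n-1}\cdots b_0x_0)_n$ equidistributes towards $m$ for $\mu_e^{\otimes\mathbb{N}}$-a.e. $b=(b_k)_{k\ge0}\in G^{\mathbb{N}}$, then $(g_{\omega|_n}x_0,T^n\omega)_n$ equidistributes in $X\times\Omega$ towards $m\otimes\mathbb{P}_\pi$ for $\mathbb{P}_e$-a.e. $\omega\in\Omega$.
   Context: Markov chain notation: $p_{e',e}$ is the probability of going from state $e$ to state $e'$. $\Omega=E^{\mathbb{N}}$ (indices from $0$, product of discrete topologies), $T$ is the shift on $\Omega$. $\mathbb{P}_e$ is the Markov measure on $\Omega$ started at $\omega_0=e$, with expectation $\mathbb{E}_e$, and $\mathbb{P}_\lambda=\sum_e\lambda(\{e\})\mathbb{P}_e$ for a probability distribution $\lambda$ on $E$. $\tau_e(\omega)=\inf\{n\ge1:\omega_n=e\}$. Irreducible: $\mathbb{P}_e[\tau_{e'}<\infty]>0$ for all $e,e'$. Positive recurrent: $\mathbb{E}_e[\tau_e]<\infty$ for all $e$. $E^*$ is the set of finite words over $E$, written right to left: for $w=e_{n-1}\ldots e_0$, $g_w=g_{e_{n-1}}\cdots g_{e_0}$; $\omega|_n=\omega_{n-1}\ldots\omega_0$.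 A non-empty word $w=e_{n-1}\ldots e_0$ is admissible if $p_{e_k,e_{k-1}}>0$ for $1\le k\le n-1$; it starts with $e$ if $e_0=e$. Renewal measure: $\mu_e$ is the law on $G$ of $g_{\omega|_{\tau_e}}=g_{\omega_{\tau_e-1}}\cdots g_{\omega_0}$ under $\mathbb{P}_e$. A sequence $(y_n)_{n\ge 0}$ in a Polish space $Y$ equidistributes towards a probability measure $\eta$ if $\frac1n\sum_{k=0}^{n-1}f(y_k)\to\int f\,d\eta$ for every bounded continuous $f$ on $Y$. *)

theory Defs
  imports "HOL-Probability.Probability"
begin

section \<open>Real Lie groups\<close>

text \<open>
  \<open>ck_on k S f\<close> says that \<open>f\<close> is of class \<open>C\<^sup>k\<close> on the open set \<open>S\<close>. Differentiability of order
  \<open>k + 1\<close> is phrased with directional derivatives, so that the type of the function does not change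
  in the recursion; on finite-dimensional spaces this is the usual notion.
\<close>

primrec ck_on ::
  "nat \<Rightarrow> 'a::real_normed_vector set \<Rightarrow> ('a \<Rightarrow> 'b::real_normed_vector) \<Rightarrow> bool" where
  "ck_on 0 S f \<longleftrightarrow> continuous_on S f"
| "ck_on (Suc k) S f \<longleftrightarrow>
     (\<forall>x\<in>S. f differentiable (at x)) \<and> (\<forall>v. ck_on k S (\<lambda>x. frechet_derivative f (at x) v))"

definition smooth_on ::
  "'a::real_normed_vector set \<Rightarrow> ('a \<Rightarrow> 'b::real_normed_vector) \<Rightarrow> bool" where
  "smooth_on S f \<longleftrightarrow> (\<forall>k. ck_on k S f)"

text \<open>
  A chart is a triple consisting of an open set \<open>U\<close> of the group, a homeomorphism \<open>\<phi>\<close> of \<open>U\<close> onto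
  an open subset of the model space, and the inverse \<open>\<psi>\<close> of \<open>\<phi>\<close>. The model space is an arbitrary
  finite-dimensional real normed space and not a Euclidean space in the sense of the class
  \<^class>\<open>euclidean_space\<close>, because the latter has dimension at least one and would exclude discrete
  groups. The underlying manifold is Hausdorff; it need not be second countable.
\<close>

locale lie_group = group gmult gunit ginv
  for gmult :: "'g::t2_space \<Rightarrow> 'g \<Rightarrow> 'g" and gunit :: 'g and ginv :: "'g \<Rightarrow> 'g" +
  fixes charts :: "('g set \<times> ('g \<Rightarrow> 'v::real_normed_vector) \<times> ('v \<Rightarrow> 'g)) set"
  assumes finite_dimensional: "\<exists>B::'v set. finite B \<and> span B = UNIV"
    and chart: "(U, \<phi>, \<psi>) \<in> charts \<Longrightarrow> open U \<and> open (\<phi> ` U) \<and> homeomorphism U (\<phi> ` U) \<phi> \<psi>"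
    and charts_cover: "(\<Union>(U, \<phi>, \<psi>)\<in>charts. U) = UNIV"
    and charts_compatible: "(U, \<phi>, \<psi>) \<in> charts \<Longrightarrow> (U', \<phi>', \<psi>') \<in> charts \<Longrightarrow>
      smooth_on (\<phi> ` (U \<inter> U')) (\<phi>' \<circ> \<psi>)"
    and continuous_mult: "continuous_on UNIV (\<lambda>(g, h). gmult g h)"
    and smooth_mult: "(U, \<phi>, \<psi>) \<in> charts \<Longrightarrow> (U', \<phi>', \<psi>') \<in> charts \<Longrightarrow> (U'', \<phi>'', \<psi>'') \<in> charts \<Longrightarrow>
      smooth_on {(u, v). u \<in> \<phi> ` U \<and> v \<in> \<phi>' ` U' \<and> gmult (\<psi> u) (\<psi>' v) \<in> U''}
        (\<lambda>(u, v). \<phi>'' (gmult (\<psi> u) (\<psi>' v)))"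
    and continuous_inv: "continuous_on UNIV ginv"
    and smooth_inv: "(U, \<phi>, \<psi>) \<in> charts \<Longrightarrow> (U', \<phi>', \<psi>') \<in> charts \<Longrightarrow>
      smooth_on {u. u \<in> \<phi> ` U \<and> ginv (\<psi> u) \<in> U'} (\<lambda>u. \<phi>' (ginv (\<psi> u)))"

definition continuous_action ::
  "('g::topological_space \<Rightarrow> 'g \<Rightarrow> 'g) \<Rightarrow> 'g \<Rightarrow> ('g \<Rightarrow> 'x::topological_space \<Rightarrow> 'x) \<Rightarrow> bool" where
  "continuous_action gmult gunit act \<longleftrightarrow>
     (\<forall>x. act gunit x = x) \<and> (\<forall>g h x. act (gmult g h) x = act g (act h x)) \<and>
     continuous_on UNIV (\<lambda>(g, x). act g x)"

section \<open>Words\<close>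

text \<open>
  A word \<open>e\<^bsub>n-1\<^esub> \<dots> e\<^sub>0\<close>, written from right to left, is represented by the list \<open>w\<close> of length \<open>n\<close>
  with \<open>w ! k = e\<^sub>k\<close>. So its first letter \<open>e\<^sub>0\<close> is \<open>hd w\<close>, and \<open>\<omega>|\<^sub>n\<close> is \<open>map \<omega> [0..<n]\<close>.
  Accordingly \<open>rprod gmult gunit [h\<^sub>0, \<dots>, h\<^bsub>n-1\<^esub>]\<close> is the product \<open>h\<^bsub>n-1\<^esub> \<cdots> h\<^sub>0\<close>.
\<close>

definition rprod :: "('g \<Rightarrow> 'g \<Rightarrow> 'g) \<Rightarrow> 'g \<Rightarrow> 'g list \<Rightarrow> 'g" where
  "rprod gmult gunit hs = fold gmult hs gunit"

definition restr :: "(nat \<Rightarrow> 'a) \<Rightarrow> nat \<Rightarrow> 'a list" where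
  "restr \<omega> n = map \<omega> [0..<n]"

text \<open>
  Throughout, a Markov chain on \<open>E\<close> is given by its kernel \<open>K\<close>, where \<open>K e\<close> is the law of the
  state following \<open>e\<close>; that is, \<open>p\<^bsub>e',e\<^esub> = pmf (K e) e'\<close>.
\<close>

definition admissible :: "('e \<Rightarrow> 'e pmf) \<Rightarrow> 'e list \<Rightarrow> bool" where
  "admissible K w \<longleftrightarrow> w \<noteq> [] \<and> (\<forall>k. 1 \<le> k \<and> k < length w \<longrightarrow> pmf (K (w ! (k - 1))) (w ! k) > 0)"

section \<open>Markov measures\<close>

text \<open>
  The topology on \<^typ>\<open>nat \<Rightarrow> 'e\<close> is the product topology. The sort constraint
  \<^class>\<open>second_countable_topology\<close> on the state space is a consequence of the other two, but this is
  not known to the type class system.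
\<close>

definition is_markov_measure ::
  "('e::{countable, discrete_topology, second_countable_topology} \<Rightarrow> 'e pmf) \<Rightarrow> 'e
    \<Rightarrow> (nat \<Rightarrow> 'e) measure \<Rightarrow> bool" where
  "is_markov_measure K e P \<longleftrightarrow> prob_space P \<and> sets P = sets borel \<and>
     (\<forall>n w. emeasure P {\<omega>. \<forall>i\<le>n. \<omega> i = w i} =
        (if w 0 = e then \<Prod>i<n. ennreal (pmf (K (w i)) (w (Suc i))) else 0))"

definition markov_measure ::
  "('e::{countable, discrete_topology, second_countable_topology} \<Rightarrow> 'e pmf) \<Rightarrow> 'e
    \<Rightarrow> (nat \<Rightarrow> 'e) measure" where
  "markov_measure K e = (THE P. is_markov_measure K e P)"

text \<open>
  For existence, draw independently for each time \<open>n\<close> and state \<open>a\<close> a state \<open>F (n, a)\<close> with law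
  \<open>K a\<close>, and follow the arrows \<open>a \<mapsto> F (n, a)\<close>.
\<close>

primrec arrow_path :: "'e \<Rightarrow> (nat \<times> 'e \<Rightarrow> 'e) \<Rightarrow> nat \<Rightarrow> 'e" where
  "arrow_path e F 0 = e"
| "arrow_path e F (Suc n) = F (n, arrow_path e F n)"

lemma borel_discrete:
  "sets (borel :: 'e::{countable, discrete_topology} measure) = sets (count_space UNIV)"
proof -
  have "A \<in> sets borel" for A :: "'e set"
    by (rule borel_open[OF Topological_Spaces.open_discrete])
  then show ?thesis
    by auto
qed

lemma sets_path_space:
  "sets (borel :: (nat \<Rightarrow> 'e::{countable, discrete_topology, second_countable_topology}) measure) =
     sets (\<Pi>\<^sub>M i\<in>UNIV. count_space UNIV)"
proof -
  have "sets (\<Pi>\<^sub>M i\<in>(UNIV::nat set). (count_space UNIV :: 'e measure)) = sets (\<Pi>\<^sub>M i\<in>(UNIV::nat set). (borel :: 'e measure))"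
    by (intro sets_PiM_cong) (simp_all add: borel_discrete)
  then show ?thesis
    by (simp add: sets_PiM_equal_borel)
qed

lemma sets_cylinder:
  fixes w :: "nat \<Rightarrow> 'e::{countable, discrete_topology, second_countable_topology}"
  shows "{\<omega>. \<forall>i\<le>n. \<omega> i = w i} \<in> sets borel"
proof -
  let ?M = "\<Pi>\<^sub>M i\<in>(UNIV :: nat set). (count_space UNIV :: 'e measure)"
  have "{\<omega> \<in> space ?M. \<forall>i\<in>{..n}. \<omega> i = w i} \<in> sets ?M"
    by (intro sets.sets_Collect_finite_All sets_Collect_single) auto
  then show ?thesis
    unfolding sets_path_space by (simp add: space_PiM PiE_UNIV_domain Ball_def)
qed

lemma measurable_arrow_path:
  fixes K :: "'e::countable \<Rightarrow> 'e pmf"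
  shows "(\<lambda>F. arrow_path e F n) \<in>
    (\<Pi>\<^sub>M (i, a)\<in>(UNIV :: (nat \<times> 'e) set). measure_pmf (K a)) \<rightarrow>\<^sub>M count_space UNIV"
proof (induction n)
  case 0
  then show ?case by simp
next
  case (Suc n)
  let ?M = "\<Pi>\<^sub>M (i, a)\<in>(UNIV :: (nat \<times> 'e) set). measure_pmf (K a)"
  have "(\<lambda>F. F (n, a)) \<in> ?M \<rightarrow>\<^sub>M (case (n, a) of (i, a) \<Rightarrow> measure_pmf (K a))" for a
    by (rule measurable_component_singleton) simp
  then have "(\<lambda>F. F (n, a)) \<in> ?M \<rightarrow>\<^sub>M count_space UNIV" for a
    by simp
  from measurable_compose_countable[OF this Suc.IH] show ?case
    by simp
qed

lemma arrow_path_eq_iff: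
  "(\<forall>i\<le>n. arrow_path e F i = w i) \<longleftrightarrow> w 0 = e \<and> (\<forall>i<n. F (i, w i) = w (Suc i))"
proof (induction n)
  case 0
  then show ?case by auto
next
  case (Suc n)
  have "(\<forall>i\<le>Suc n. arrow_path e F i = w i) \<longleftrightarrow>
      (\<forall>i\<le>n. arrow_path e F i = w i) \<and> arrow_path e F (Suc n) = w (Suc n)"
    using le_Suc_eq by auto
  also have "\<dots> \<longleftrightarrow> (\<forall>i\<le>n. arrow_path e F i = w i) \<and> F (n, w n) = w (Suc n)"
    by auto
  finally show ?case
    unfolding Suc.IH by (auto simp: less_Suc_eq)
qed

lemma ex_is_markov_measure:
  fixes K :: "'e::{countable, discrete_topology, second_countable_topology} \<Rightarrow> 'e pmf"
  shows "\<exists>P. is_markov_measure K e P"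
proof -
  define M where "M = (\<lambda>(i::nat, a). measure_pmf (K a))"
  interpret product_prob_space M UNIV
    by (intro product_prob_spaceI) (auto simp: M_def measure_pmf.prob_space_axioms split: prod.split)
  have path: "arrow_path e \<in> PiM UNIV M \<rightarrow>\<^sub>M borel"
  proof -
    have "arrow_path e \<in> PiM UNIV M \<rightarrow>\<^sub>M (\<Pi>\<^sub>M i\<in>UNIV. count_space UNIV)"
      using measurable_arrow_path[of e _ K]
      by (intro measurable_PiM_single') (auto simp: M_def PiE_UNIV_domain)
    also have "\<dots> = (PiM UNIV M \<rightarrow>\<^sub>M borel)"
      by (intro measurable_cong_sets) (simp_all add: sets_path_space)
    finally show ?thesis .
  qed
  have sp: "space (PiM UNIV M) = UNIV"
    by (auto simp: space_PiM M_def PiE_UNIV_domain Pi_iff split: prod.splits)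
  let ?P = "distr (PiM UNIV M) borel (arrow_path e)"
  have "emeasure ?P {\<omega>. \<forall>i\<le>n. \<omega> i = w i} =
      (if w 0 = e then \<Prod>i<n. ennreal (pmf (K (w i)) (w (Suc i))) else 0)" for n w
  proof -
    have set: "{\<omega>. \<forall>i\<le>n. \<omega> i = w i} \<in> sets borel"
      by (rule sets_cylinder)
    then have "emeasure ?P {\<omega>. \<forall>i\<le>n. \<omega> i = w i} =
        emeasure (PiM UNIV M) {F \<in> space (PiM UNIV M). w 0 = e \<and> (\<forall>i<n. F (i, w i) = w (Suc i))}"
      by (subst emeasure_distr[OF path]) (auto simp: vimage_def sp arrow_path_eq_iff)
    also have "\<dots> = (if w 0 = e then \<Prod>i<n. ennreal (pmf (K (w i)) (w (Suc i))) else 0)"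
    proof (cases "w 0 = e")
      case True
      let ?J = "(\<lambda>i. (i, w i)) ` {..<n}"
      have inj: "inj_on (\<lambda>i. (i, w i)) {..<n}"
        by (auto intro: inj_onI)
      have "{F \<in> space (PiM UNIV M). w 0 = e \<and> (\<forall>i<n. F (i, w i) = w (Suc i))} =
          {F \<in> space (PiM UNIV M). \<forall>j\<in>?J. F j \<in> {w (Suc (fst j))}}"
        using True by auto
      also have "emeasure (PiM UNIV M) \<dots> = (\<Prod>j\<in>?J. emeasure (M j) {w (Suc (fst j))})"
        by (rule emeasure_PiM_Collect) (auto simp: M_def)
      also have "\<dots> = (\<Prod>i<n. ennreal (pmf (K (w i)) (w (Suc i))))"
        by (subst prod.reindex[OF inj]) (simp add: M_def emeasure_pmf_single)
      finally show ?thesis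
        using True by simp
    qed simp
    finally show ?thesis .
  qed
  moreover have "prob_space ?P"
    by (rule P.prob_space_distr[OF path])
  ultimately have "is_markov_measure K e ?P"
    by (simp add: is_markov_measure_def)
  then show ?thesis ..
qed

lemma is_markov_measure_unique:
  fixes K :: "'e::{countable, discrete_topology, second_countable_topology} \<Rightarrow> 'e pmf"
  assumes P: "is_markov_measure K e P" and Q: "is_markov_measure K e Q"
  shows "P = Q"
proof -
  define C where "C = (\<lambda>(n::nat, w::nat \<Rightarrow> 'e). {\<omega>. \<forall>i\<le>n. \<omega> i = w i})"
  let ?E = "insert {} (range C)"
  have "Int_stable ?E"
  proof (rule Int_stableI)
    fix A B assume AB: "A \<in> ?E" "B \<in> ?E"
    have "C (n, v) \<inter> C (m, w) = {} \<or> C (n, v) \<inter> C (m, w) = C (max n m, if n \<le> m then w else v)" for n v m w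
    proof (cases "C (n, v) \<inter> C (m, w) = {}")
      case False
      then obtain \<omega> where "\<forall>i\<le>n. \<omega> i = v i" "\<forall>i\<le>m. \<omega> i = w i"
        by (auto simp: C_def)
      then show ?thesis
        by (auto simp: C_def max_def)
    qed simp
    then have *: "C (n, v) \<inter> C (m, w) \<in> ?E" for n v m w
      by (metis insertCI rangeI)
    show "A \<inter> B \<in> ?E"
    proof (cases "A = {} \<or> B = {}")
      case False
      then obtain n v m w where "A = C (n, v)" "B = C (m, w)"
        using AB by (metis insertE rangeE surj_pair)
      then show ?thesis
        using * by simp
    qed auto
  qed
  moreover have gen: "sets (borel :: (nat \<Rightarrow> 'e) measure) = sigma_sets UNIV ?E"
  proof
    have "C (n, w) \<in> sets borel" for n w
      by (simp add: C_def sets_cylinder)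
    then have "?E \<subseteq> sets borel"
      by auto
    then show "sigma_sets UNIV ?E \<subseteq> sets borel"
      using sets.sigma_sets_subset[of ?E borel] by simp
  next
    have single: "{\<omega>. \<omega> j \<in> A} \<in> sigma_sets UNIV ?E" for j :: nat and A :: "'e set"
    proof -
      interpret sigma_algebra UNIV "sigma_sets UNIV ?E"
        by (rule sigma_algebra_sigma_sets) simp
      let ?ws = "{l. length l = Suc j \<and> l ! j \<in> A}"
      have "{\<omega>. \<omega> j \<in> A} = (\<Union>l\<in>?ws. C (j, \<lambda>i. l ! i))"
      proof (intro set_eqI iffI)
        fix \<omega> :: "nat \<Rightarrow> 'e" assume "\<omega> \<in> {\<omega>. \<omega> j \<in> A}"
        then have "map \<omega> [0..<Suc j] \<in> ?ws" "\<omega> \<in> C (j, \<lambda>i. map \<omega> [0..<Suc j] ! i)"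
          by (auto simp: C_def nth_append simp del: upt_Suc)
        then show "\<omega> \<in> (\<Union>l\<in>?ws. C (j, \<lambda>i. l ! i))"
          by blast
      qed (auto simp: C_def)
      also have "\<dots> \<in> sigma_sets UNIV ?E"
        by (rule countable_UN'') auto
      finally show ?thesis .
    qed
    show "sets borel \<subseteq> sigma_sets UNIV ?E"
      unfolding sets_path_space sets_PiM_single
      by (rule order_trans[OF _ order_refl]) (auto intro!: sigma_sets_mono simp: single)
  qed
  moreover have "emeasure P X = emeasure Q X" if "X \<in> ?E" for X
    using that P Q by (auto simp: C_def is_markov_measure_def)
  moreover have "sets P = sigma_sets UNIV ?E" "sets Q = sigma_sets UNIV ?E"
    using P Q gen by (auto simp: is_markov_measure_def)
  moreover have "countable (range (\<lambda>x::'e. C (0, \<lambda>_. x)))" "\<Union>(range (\<lambda>x::'e. C (0, \<lambda>_. x))) = UNIV"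
    by (auto simp: C_def)
  moreover have "emeasure P A \<noteq> \<infinity>" for A
    using P by (simp add: is_markov_measure_def prob_space_def finite_measure.emeasure_finite)
  moreover have "range (\<lambda>x::'e. C (0, \<lambda>_. x)) \<subseteq> ?E"
    by blast
  ultimately show ?thesis
    by (intro measure_eqI_generator_eq_countable[where E = ?E and \<Omega> = UNIV
          and A = "range (\<lambda>x::'e. C (0, \<lambda>_. x))"]) blast+
qed

lemma is_markov_measure_markov_measure: "is_markov_measure K e (markov_measure K e)"
  unfolding markov_measure_def
  by (rule theI') (blast intro: ex_is_markov_measure is_markov_measure_unique)

definition markov_measure_init ::
  "('e::{countable, discrete_topology, second_countable_topology} \<Rightarrow> 'e pmf) \<Rightarrow> 'e pmf
    \<Rightarrow> (nat \<Rightarrow> 'e) measure" where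
  "markov_measure_init K l = measure_pmf l \<bind> markov_measure K"

lemma emeasure_markov_measure_init:
  fixes K :: "'e::{countable, discrete_topology, second_countable_topology} \<Rightarrow> 'e pmf"
  assumes "A \<in> sets borel"
  shows "emeasure (markov_measure_init K l) A =
    (\<integral>\<^sup>+e. ennreal (pmf l e) * emeasure (markov_measure K e) A \<partial>count_space UNIV)"
proof -
  have "markov_measure K e \<in> space (subprob_algebra borel)" for e
    using is_markov_measure_markov_measure[of K e]
    by (auto simp: is_markov_measure_def space_subprob_algebra intro: prob_space_imp_subprob_space)
  then have "markov_measure K \<in> measure_pmf l \<rightarrow>\<^sub>M subprob_algebra borel"
    by simp
  then show ?thesis
    unfolding markov_measure_init_def
    using assms by (simp add: emeasure_bind[where N = borel] nn_integral_measure_pmf)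
qed

section \<open>Recurrence and the renewal measure\<close>

definition return_time :: "'e \<Rightarrow> (nat \<Rightarrow> 'e) \<Rightarrow> enat" where
  "return_time e \<omega> = (INF n\<in>{n. 1 \<le> n \<and> \<omega> n = e}. enat n)"

definition irreducible_chain ::
  "('e::{countable, discrete_topology, second_countable_topology} \<Rightarrow> 'e pmf) \<Rightarrow> bool" where
  "irreducible_chain K \<longleftrightarrow>
     (\<forall>e e'. measure (markov_measure K e) {\<omega>. return_time e' \<omega> < \<infinity>} > 0)"

definition positive_recurrent ::
  "('e::{countable, discrete_topology, second_countable_topology} \<Rightarrow> 'e pmf) \<Rightarrow> bool" where
  "positive_recurrent K \<longleftrightarrow>
     (\<forall>e. (\<integral>\<^sup>+\<omega>. ennreal_of_enat (return_time e \<omega>) \<partial>markov_measure K e) < \<infinity>)"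

definition stationary :: "('e \<Rightarrow> 'e pmf) \<Rightarrow> 'e pmf \<Rightarrow> bool" where
  "stationary K l \<longleftrightarrow> bind_pmf l K = l"

text \<open>
  The value on paths with \<^term>\<open>return_time e \<omega> = \<infinity>\<close> is irrelevant: these form a null set for
  recurrent chains.
\<close>

definition renewal_measure ::
  "('g::topological_space \<Rightarrow> 'g \<Rightarrow> 'g) \<Rightarrow> 'g \<Rightarrow>
    ('e::{countable, discrete_topology, second_countable_topology} \<Rightarrow> 'g) \<Rightarrow> ('e \<Rightarrow> 'e pmf) \<Rightarrow> 'e
    \<Rightarrow> 'g measure" where
  "renewal_measure gmult gunit g K e = distr (markov_measure K e) borel
     (\<lambda>\<omega>. rprod gmult gunit (map g (restr \<omega> (the_enat (return_time e \<omega>)))))"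

section \<open>Equidistribution\<close>

definition path_shift :: "(nat \<Rightarrow> 'a) \<Rightarrow> nat \<Rightarrow> 'a" where
  "path_shift \<omega> = (\<lambda>n. \<omega> (Suc n))"

definition equidistributes :: "(nat \<Rightarrow> 'y::topological_space) \<Rightarrow> 'y measure \<Rightarrow> bool" where
  "equidistributes y \<eta> \<longleftrightarrow>
     (\<forall>f \<in> (bcontfun :: ('y \<Rightarrow> real) set).
        (\<lambda>n. (\<Sum>k<n. f (y k)) / real n) \<longlonglongrightarrow> (\<integral>z. f z \<partial>\<eta>))"

end

theory Submission
  imports Defs "HOL-Library.Discrete_Functions"
begin

text \<open>
  Write \<open>x\<^sub>k\<close> for the image of \<open>x\<^sub>0\<close> under the word \<open>\<omega>|\<^sub>k\<close>. The increments of the walk between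
  successive visits to \<open>e\<close> are independent with law \<open>\<mu>\<^sub>e\<close>, so by hypothesis the points \<open>x\<^sub>k\<close> observed
  at the visits equidistribute towards \<open>m\<close>, and the visits have density at least \<open>1 / E\<^sub>e[\<tau>\<^sub>e] = \<pi>(e)\<close>.
  Fix a continuous \<open>\<phi>\<close> with values in \<open>[0, 1]\<close> and an event \<open>A\<close> that depends on finitely many
  coordinates. At time \<open>k\<close> look back to the last visit to \<open>e\<close> and let \<open>u\<close> be the word read since then.
  For each single \<open>u\<close>, a law of large numbers for bounded variables with finite-range correlations
  replaces the indicator of seeing \<open>u\<close> and then \<open>A\<close> by its conditional probability given the past, and
  invariance of \<open>m\<close> under \<open>u\<close> removes \<open>u\<close> from the integral of \<open>\<phi>\<close>. Summing over finitely many \<open>u\<close>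
  and using the decomposition of \<open>P\<^sub>\<pi>(A)\<close> according to the last visit to \<open>e\<close>, the lower limit of the
  averages of \<open>\<phi>(x\<^sub>k) 1\<^sub>A(T\<^sup>k \<omega>)\<close> is at least \<open>(\<integral>\<phi> dm) P\<^sub>\<pi>(A)\<close>. As the same bound holds for
  \<open>(1 - \<phi>) 1\<^sub>A\<close> and for the indicator of the complement of \<open>A\<close>, and the three limits add up to one, it
  is the limit. Countably many such products determine equidistribution.
\<close>

section \<open>Lower limits of averages and equidistribution\<close>

definition lower_mean :: "(nat \<Rightarrow> real) \<Rightarrow> real \<Rightarrow> bool" where
  "lower_mean a L \<longleftrightarrow> (\<forall>c<L. \<forall>\<^sub>F n in sequentially. c < (\<Sum>k<n. a k) / real n)"

lemma lower_meanI_tendsto: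
  assumes "(\<lambda>n. (\<Sum>k<n. a k) / real n) \<longlonglongrightarrow> L"
  shows "lower_mean a L"
  using assms by (auto simp: lower_mean_def intro: order_tendstoD)

lemma lower_mean_add:
  assumes "lower_mean a L" "lower_mean b M"
  shows "lower_mean (\<lambda>k. a k + b k) (L + M)"
  unfolding lower_mean_def
proof (intro allI impI)
  fix c assume c: "c < L + M"
  define d where "d = (L + M - c) / 2"
  have "L - d < L" "M - d < M" "L - d + (M - d) = c"
    using c by (auto simp: d_def field_simps)
  then have "\<forall>\<^sub>F n in sequentially. L - d < (\<Sum>k<n. a k) / real n"
    "\<forall>\<^sub>F n in sequentially. M - d < (\<Sum>k<n. b k) / real n"
    using assms by (auto simp: lower_mean_def)
  then show "\<forall>\<^sub>F n in sequentially. c < (\<Sum>k<n. a k + b k) / real n"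
  proof eventually_elim
    case (elim n)
    then show ?case
      using \<open>L - d + (M - d) = c\<close> unfolding sum.distrib add_divide_distrib by linarith
  qed
qed

lemma lower_mean_zero: "lower_mean (\<lambda>k. 0) 0"
  by (rule lower_meanI_tendsto) simp

lemma lower_mean_sum:
  assumes "finite I" "\<And>i. i \<in> I \<Longrightarrow> lower_mean (a i) (L i)"
  shows "lower_mean (\<lambda>k. \<Sum>i\<in>I. a i k) (\<Sum>i\<in>I. L i)"
  using assms by (induction I rule: finite_induct) (auto intro: lower_mean_add lower_mean_zero)

lemma lower_mean_cmult:
  assumes "lower_mean a L" "0 \<le> r"
  shows "lower_mean (\<lambda>k. r * a k) (r * L)"
proof (cases "r = 0")
  case True
  then show ?thesis by (simp add: lower_mean_zero)
next
  case False
  with assms have r: "0 < r" by simp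
  show ?thesis
    unfolding lower_mean_def
  proof (intro allI impI)
    fix c assume "c < r * L"
    then have "c / r < L"
      using r by (simp add: field_simps)
    then have "\<forall>\<^sub>F n in sequentially. c / r < (\<Sum>k<n. a k) / real n"
      using assms by (simp add: lower_mean_def)
    then show "\<forall>\<^sub>F n in sequentially. c < (\<Sum>k<n. r * a k) / real n"
    proof eventually_elim
      case (elim n)
      then have "r * (c / r) < r * ((\<Sum>k<n. a k) / real n)"
        using r by (intro mult_strict_left_mono)
      then show ?case
        using r by (simp add: sum_distrib_left)
    qed
  qed
qed

lemma lower_mean_mono:
  assumes "lower_mean a L" "\<And>k. a k \<le> b k" "M \<le> L"
  shows "lower_mean b M"
  unfolding lower_mean_def
proof (intro allI impI)
  fix c assume "c < M"
  then have "\<forall>\<^sub>F n in sequentially. c < (\<Sum>k<n. a k) / real n"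
    using assms by (simp add: lower_mean_def)
  then show "\<forall>\<^sub>F n in sequentially. c < (\<Sum>k<n. b k) / real n"
  proof eventually_elim
    case (elim n)
    have "(\<Sum>k<n. a k) / real n \<le> (\<Sum>k<n. b k) / real n"
      using assms(2) by (intro divide_right_mono sum_mono) auto
    with elim show ?case by simp
  qed
qed

lemma lower_mean_dense:
  assumes "\<And>c. c < L \<Longrightarrow> lower_mean a c"
  shows "lower_mean a L"
  unfolding lower_mean_def
proof (intro allI impI)
  fix c assume "c < L"
  then obtain d where "c < d" "d < L" using dense by blast
  then show "\<forall>\<^sub>F n in sequentially. c < (\<Sum>k<n. a k) / real n"
    using assms[of d] by (simp add: lower_mean_def)
qed

lemma lower_mean_closed:
  assumes "l \<longlonglongrightarrow> L" "\<And>n. lower_mean a (l n)"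
  shows "lower_mean a L"
proof (rule lower_mean_dense)
  fix c assume "c < L"
  then have "\<forall>\<^sub>F n in sequentially. c < l n"
    using assms(1) by (simp add: order_tendstoD)
  then obtain n where "c < l n" by (auto simp: eventually_sequentially)
  then show "lower_mean a c"
    using assms(2)[of n] by (auto intro: lower_mean_mono)
qed

lemma lower_mean_imp_tendsto:
  assumes "lower_mean a L" "lower_mean (\<lambda>k. 1 - a k) (1 - L)"
  shows "(\<lambda>n. (\<Sum>k<n. a k) / real n) \<longlonglongrightarrow> L"
proof (rule order_tendstoI)
  fix c assume "c < L"
  then show "\<forall>\<^sub>F n in sequentially. c < (\<Sum>k<n. a k) / real n"
    using assms(1) by (simp add: lower_mean_def)
next
  fix c assume "L < c"
  then have "\<forall>\<^sub>F n in sequentially. 1 - c < (\<Sum>k<n. 1 - a k) / real n"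
    using assms(2) by (simp add: lower_mean_def)
  then show "\<forall>\<^sub>F n in sequentially. (\<Sum>k<n. a k) / real n < c"
    using eventually_gt_at_top[of 0]
  proof eventually_elim
    case (elim n)
    then show ?case
      by (simp add: sum_subtractf diff_divide_distrib)
  qed
qed

lemma layer_cake_bounds:
  fixes t :: real
  assumes "0 \<le> t" "t \<le> 1" "0 < N"
  defines "s \<equiv> (\<Sum>i\<in>{1..N}. indicator {i. real i / real N < t} i) / real N"
  shows "s \<le> t" "t \<le> s + 1 / real N"
proof -
  define q where "q = nat \<lceil>real N * t\<rceil>"
  have iff: "real i / real N < t \<longleftrightarrow> i < q" for i
  proof -
    have "real i / real N < t \<longleftrightarrow> real i < real N * t"
      using assms by (simp add: field_simps)
    also have "\<dots> \<longleftrightarrow> int i < \<lceil>real N * t\<rceil>"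
      by (simp add: less_ceiling_iff)
    finally show ?thesis by (auto simp: q_def)
  qed
  have qN: "q \<le> N"
    using assms by (simp add: q_def ceiling_le_iff mult_left_le)
  have "(\<Sum>i\<in>{1..N}. indicator {i. real i / real N < t} i :: real) = (\<Sum>i\<in>{1..N}. if i \<in> {i. i < q} then 1 else 0)"
    by (intro sum.cong) (auto simp: indicator_def iff)
  also have "\<dots> = (\<Sum>i\<in>{1..N} \<inter> {i. i < q}. 1)"
    by (rule sum.inter_restrict[symmetric]) simp
  finally have "s = real (card ({1..N} \<inter> {i. i < q})) / real N"
    by (simp add: s_def)
  also have "{1..N} \<inter> {i. i < q} = {1..<q}"
    using qN by auto
  finally have s: "s = real (q - 1) / real N" by simp
  have "real N * t \<le> real q" "real (q - 1) \<le> real N * t"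
    using assms(1) \<open>0 < N\<close> unfolding q_def
    by (simp_all add: of_nat_diff_if real_nat_ceiling_ge)
  moreover have "real q \<le> real (q - 1) + 1" by simp
  ultimately show "s \<le> t" "t \<le> s + 1 / real N"
    unfolding s using \<open>0 < N\<close> by (auto simp: field_simps)
qed

lemma lower_mean_continuous:
  fixes y :: "nat \<Rightarrow> 'y::topological_space"
  assumes \<eta>: "prob_space \<eta>" "sets \<eta> = sets borel"
    and U: "\<And>U. open U \<Longrightarrow> lower_mean (\<lambda>k. indicator U (y k)) (measure \<eta> U)"
    and f: "continuous_on UNIV f" "\<And>z. 0 \<le> f z" "\<And>z. f z \<le> (1 :: real)"
  shows "lower_mean (\<lambda>k. f (y k)) (\<integral>z. f z \<partial>\<eta>)"
proof -
  interpret prob_space \<eta> by fact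
  have fm: "f \<in> borel_measurable \<eta>"
    using borel_measurable_continuous_onI[OF f(1)] measurable_cong_sets[OF \<eta>(2) refl] by blast
  have op: "open {z. a < f z}" for a
    using f(1) open_Collect_less[OF continuous_on_const] by blast
  have *: "lower_mean (\<lambda>k. f (y k)) ((\<integral>z. f z \<partial>\<eta>) - 1 / real N)" if N: "0 < N" for N
  proof -
    define s where "s z = (\<Sum>i\<in>{1..N}. indicator {z. real i / real N < f z} z) / real N" for z
    have s: "s z = (\<Sum>i\<in>{1..N}. indicator {i. real i / real N < f z} i) / real N" for z
      unfolding s_def by (intro arg_cong2[where f = "(/)"] sum.cong) (auto simp: indicator_def)
    have m: "{z. real i / real N < f z} \<in> sets \<eta>" for i
      using op \<eta>(2) by auto
    have "(\<integral>z. f z \<partial>\<eta>) \<le> (\<integral>z. s z + 1 / real N \<partial>\<eta>)"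
    proof (rule integral_mono)
      show "integrable \<eta> f"
        by (rule integrable_const_bound[of _ 1]) (use f fm in auto)
      show "integrable \<eta> (\<lambda>z. s z + 1 / real N)"
        unfolding s_def using m by (intro Bochner_Integration.integrable_add integrable_divide integrable_sum integrable_real_indicator) (auto simp: less_top[symmetric])
      show "f z \<le> s z + 1 / real N" for z
        unfolding s using layer_cake_bounds f N by blast
    qed
    also have "\<dots> = (\<Sum>i\<in>{1..N}. measure \<eta> {z. real i / real N < f z}) / real N + 1 / real N"
      unfolding s_def using m
      by (subst Bochner_Integration.integral_add) (auto simp: prob_space less_top[symmetric] intro!: integrable_divide integrable_sum integrable_real_indicator)
    finally have le: "(\<integral>z. f z \<partial>\<eta>) - 1 / real N \<le> (1 / real N) * (\<Sum>i\<in>{1..N}. measure \<eta> {z. real i / real N < f z})"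
      by simp
    have "lower_mean (\<lambda>k. (1 / real N) * (\<Sum>i\<in>{1..N}. indicator {z. real i / real N < f z} (y k)))
      ((1 / real N) * (\<Sum>i\<in>{1..N}. measure \<eta> {z. real i / real N < f z}))"
      by (intro lower_mean_cmult lower_mean_sum U op) auto
    then show ?thesis
    proof (rule lower_mean_mono[OF _ _ le])
      show "1 / real N * (\<Sum>i\<in>{1..N}. indicator {z. real i / real N < f z} (y k)) \<le> f (y k)" for k
        using layer_cake_bounds(1)[OF f(2) f(3) N, of "y k"] unfolding s[symmetric] by (simp add: s_def)
    qed
  qed
  have "(\<lambda>N. (\<integral>z. f z \<partial>\<eta>) - 1 / real (Suc N)) \<longlonglongrightarrow> (\<integral>z. f z \<partial>\<eta>) - 0"
    by (intro tendsto_diff tendsto_const LIMSEQ_Suc lim_1_over_n)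
  then have "(\<lambda>N. (\<integral>z. f z \<partial>\<eta>) - 1 / real (Suc N)) \<longlonglongrightarrow> (\<integral>z. f z \<partial>\<eta>)"
    unfolding diff_0_right .
  then show ?thesis
    by (rule lower_mean_closed) (rule *, rule zero_less_Suc)
qed

lemma equidistributesI_open:
  fixes y :: "nat \<Rightarrow> 'y::topological_space"
  assumes \<eta>: "prob_space \<eta>" "sets \<eta> = sets borel"
    and U: "\<And>U. open U \<Longrightarrow> lower_mean (\<lambda>k. indicator U (y k)) (measure \<eta> U)"
  shows "equidistributes y \<eta>"
  unfolding equidistributes_def
proof
  interpret prob_space \<eta> by fact
  fix f :: "'y \<Rightarrow> real" assume "f \<in> bcontfun"
  then obtain B0 where f: "continuous_on UNIV f" "\<And>z. \<bar>f z\<bar> \<le> B0"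
    by (auto simp: bcontfun_def bounded_iff)
  define B where "B = max B0 1"
  have B: "\<bar>f z\<bar> \<le> B" "B > 0" for z
    using f(2)[of z] by (auto simp: B_def)
  define h where "h z = (f z + B) / (2 * B)" for z
  have fm: "f \<in> borel_measurable \<eta>"
    using borel_measurable_continuous_onI[OF f(1)] measurable_cong_sets[OF \<eta>(2) refl] by blast
  have fi: "integrable \<eta> f"
    by (rule integrable_const_bound[of _ B]) (use B fm in auto)
  then have hi: "integrable \<eta> h" and int_h: "(\<integral>z. h z \<partial>\<eta>) = ((\<integral>z. f z \<partial>\<eta>) + B) / (2 * B)"
    unfolding h_def by (simp_all add: prob_space)
  have hc: "continuous_on UNIV h"
    unfolding h_def by (intro continuous_intros f(1)) (use B in auto)
  have h01: "0 \<le> h z" "h z \<le> 1" for z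
    using B(1)[of z] B(2) by (auto simp: h_def field_simps)
  have "(\<lambda>n. (\<Sum>k<n. h (y k)) / real n) \<longlonglongrightarrow> (\<integral>z. h z \<partial>\<eta>)"
  proof (rule lower_mean_imp_tendsto)
    show "lower_mean (\<lambda>k. h (y k)) (\<integral>z. h z \<partial>\<eta>)"
      using h01 hc by (intro lower_mean_continuous \<eta> U)
    have "lower_mean (\<lambda>k. 1 - h (y k)) (\<integral>z. 1 - h z \<partial>\<eta>)"
      using h01 hc by (intro lower_mean_continuous \<eta> U continuous_intros) auto
    then show "lower_mean (\<lambda>k. 1 - h (y k)) (1 - (\<integral>z. h z \<partial>\<eta>))"
      using hi by (simp add: prob_space)
  qed
  then have "(\<lambda>n. 2 * B * ((\<Sum>k<n. h (y k)) / real n) - B) \<longlonglongrightarrow> 2 * B * (\<integral>z. h z \<partial>\<eta>) - B"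
    by (intro tendsto_intros)
  also have "2 * B * (\<integral>z. h z \<partial>\<eta>) - B = (\<integral>z. f z \<partial>\<eta>)"
    using B(2) by (simp add: int_h)
  finally show "(\<lambda>n. (\<Sum>k<n. f (y k)) / real n) \<longlonglongrightarrow> (\<integral>z. f z \<partial>\<eta>)"
  proof (rule Lim_transform_eventually)
    show "\<forall>\<^sub>F n in sequentially. 2 * B * ((\<Sum>k<n. h (y k)) / real n) - B = (\<Sum>k<n. f (y k)) / real n"
      using eventually_gt_at_top[of 0]
    proof eventually_elim
      case (elim n)
      have "(\<Sum>k<n. h (y k)) = ((\<Sum>k<n. f (y k)) + real n * B) / (2 * B)"
        unfolding h_def by (simp add: sum_divide_distrib[symmetric] sum.distrib)
      then show ?case
        using B(2) elim by (simp add: field_simps)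
    qed
  qed
qed

lemma equidistributesI_family:
  fixes y :: "nat \<Rightarrow> 'y::topological_space" and h :: "'i::countable \<Rightarrow> 'y \<Rightarrow> real"
  assumes \<eta>: "prob_space \<eta>" "sets \<eta> = sets borel"
    and h: "\<And>i. h i \<in> borel_measurable borel" "\<And>i z. 0 \<le> h i z" "\<And>i z. h i z \<le> 1"
    and conv: "\<And>F. finite F \<Longrightarrow>
      (\<lambda>n. (\<Sum>k<n. \<Prod>i\<in>F. h i (y k)) / real n) \<longlonglongrightarrow> (\<integral>z. (\<Prod>i\<in>F. h i z) \<partial>\<eta>)"
    and sep: "\<And>U z. open U \<Longrightarrow> z \<in> U \<Longrightarrow> \<exists>i. h i z = 1 \<and> (\<forall>z'. z' \<notin> U \<longrightarrow> h i z' = 0)"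
  shows "equidistributes y \<eta>"
proof (rule equidistributesI_open[OF \<eta>])
  interpret prob_space \<eta> by fact
  have hm[measurable]: "h i \<in> borel_measurable \<eta>" for i
    using h(1) measurable_cong_sets[OF \<eta>(2) refl] by blast
  have bd: "0 \<le> (\<Prod>i\<in>F. h i z) * (\<Prod>i\<in>G. 1 - h i z)" "(\<Prod>i\<in>F. h i z) * (\<Prod>i\<in>G. 1 - h i z) \<le> 1" for F G z
    using h by (auto intro!: mult_le_one mult_nonneg_nonneg prod_nonneg prod_le_1)
  have int: "integrable \<eta> (\<lambda>z. (\<Prod>i\<in>F. h i z) * (\<Prod>i\<in>G. 1 - h i z))" for F G
    by (rule integrable_const_bound[of _ 1]) (use bd in auto)
  have conv2: "(\<lambda>n. (\<Sum>k<n. (\<Prod>i\<in>F. h i (y k)) * (\<Prod>i\<in>G. 1 - h i (y k))) / real n) \<longlonglongrightarrow>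
      (\<integral>z. (\<Prod>i\<in>F. h i z) * (\<Prod>i\<in>G. 1 - h i z) \<partial>\<eta>)" if "finite G" "finite F" "F \<inter> G = {}" for F G
    using that
  proof (induction G arbitrary: F rule: finite_induct)
    case empty
    then show ?case using conv by simp
  next
    case (insert j G)
    have eq: "(\<Prod>i\<in>F. h i z) * (\<Prod>i\<in>insert j G. 1 - h i z) =
      (\<Prod>i\<in>F. h i z) * (\<Prod>i\<in>G. 1 - h i z) - (\<Prod>i\<in>insert j F. h i z) * (\<Prod>i\<in>G. 1 - h i z)" for z
      using insert by (simp add: algebra_simps)
    show ?case
      unfolding eq sum_subtractf diff_divide_distrib Bochner_Integration.integral_diff[OF int int]
      using insert by (intro tendsto_diff insert.IH) auto
  qed
  fix U :: "'y set" assume U: "open U"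
  have Um: "U \<in> sets \<eta>" using U \<eta>(2) by auto
  define G where "G N = {i. to_nat i < N \<and> (\<forall>z'. z' \<notin> U \<longrightarrow> h i z' = 0)}" for N
  have G: "finite (G N)" for N
    by (rule finite_subset[of _ "to_nat -` {..<N}"]) (auto simp: G_def intro: finite_vimageI)
  define p where "p N z = 1 - (\<Prod>i\<in>G N. 1 - h i z)" for N z
  have p01: "0 \<le> p N z" "p N z \<le> 1" for N z
    using bd[of z "{}" "G N"] by (auto simp: p_def)
  have pm[measurable]: "p N \<in> borel_measurable \<eta>" for N unfolding p_def by measurable
  have out: "p N z = 0" if "z \<notin> U" for N z
    using that by (simp add: p_def G_def)
  have lim: "(\<lambda>N. p N z) \<longlonglongrightarrow> indicator U z" for z
  proof (cases "z \<in> U")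
    case True
    then obtain i where i: "h i z = 1" "\<forall>z'. z' \<notin> U \<longrightarrow> h i z' = 0" using sep U by blast
    have "p N z = 1" if "N > to_nat i" for N
    proof -
      have "i \<in> G N" using that i by (auto simp: G_def)
      then have "(\<Prod>i\<in>G N. 1 - h i z) = 0" using G i(1) by (intro prod_zero) auto
      then show ?thesis by (simp add: p_def)
    qed
    then have "\<forall>\<^sub>F N in sequentially. p N z = 1"
      using eventually_gt_at_top[of "to_nat i"] by (rule eventually_mono[rotated])
    then show ?thesis using True by (simp add: tendsto_eventually)
  qed (simp add: out)
  have "(\<lambda>N. \<integral>z. p N z \<partial>\<eta>) \<longlonglongrightarrow> (\<integral>z. indicator U z \<partial>\<eta>)"
    by (rule integral_dominated_convergence[where w = "\<lambda>_. 1"]) (use lim p01 Um in auto)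
  then have "(\<lambda>N. \<integral>z. p N z \<partial>\<eta>) \<longlonglongrightarrow> measure \<eta> U" using Um by simp
  then show "lower_mean (\<lambda>k. indicator U (y k)) (measure \<eta> U)"
  proof (rule lower_mean_closed)
    fix N
    have c0: "(\<lambda>n. (\<Sum>k<n. 1 :: real) / real n) \<longlonglongrightarrow> 1"
      using conv[of "{}"] by (simp add: prob_space)
    have c1: "(\<lambda>n. (\<Sum>k<n. \<Prod>i\<in>G N. 1 - h i (y k)) / real n) \<longlonglongrightarrow> (\<integral>z. (\<Prod>i\<in>G N. 1 - h i z) \<partial>\<eta>)"
      using conv2[of "G N" "{}"] G by simp
    have "(\<integral>z. p N z \<partial>\<eta>) = 1 - (\<integral>z. (\<Prod>i\<in>G N. 1 - h i z) \<partial>\<eta>)"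
      unfolding p_def using int[of "{}" "G N"] by (simp add: prob_space)
    moreover have "(\<Sum>k<n. p N (y k)) / real n =
        (\<Sum>k<n. 1 :: real) / real n - (\<Sum>k<n. \<Prod>i\<in>G N. 1 - h i (y k)) / real n" for n
      unfolding p_def sum_subtractf diff_divide_distrib ..
    ultimately have "(\<lambda>n. (\<Sum>k<n. p N (y k)) / real n) \<longlonglongrightarrow> (\<integral>z. p N z \<partial>\<eta>)"
      using tendsto_diff[OF c0 c1] by simp
    then show "lower_mean (\<lambda>k. indicator U (y k)) (\<integral>z. p N z \<partial>\<eta>)"
    proof (rule lower_mean_mono[OF lower_meanI_tendsto])
      show "p N (y k) \<le> indicator U (y k)" for k
        using p01(2)[of N "y k"] out[of "y k" N] by (cases "y k \<in> U") auto
    qed simp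
  qed
qed

lemma separating_continuous_functions:
  assumes "metrizable_space (euclidean :: 'x::second_countable_topology topology)"
  obtains \<phi> :: "nat \<Rightarrow> 'x::second_countable_topology \<Rightarrow> real"
  where "\<And>n. continuous_on UNIV (\<phi> n)" "\<And>n x. 0 \<le> \<phi> n x" "\<And>n x. \<phi> n x \<le> 1"
    "\<And>U x. open U \<Longrightarrow> x \<in> U \<Longrightarrow> \<exists>n. \<phi> n x = 1 \<and> (\<forall>z. z \<notin> U \<longrightarrow> \<phi> n z = 0)"
proof -
  have normal: "normal_space (euclidean :: 'x topology)" and reg: "regular_space (euclidean :: 'x topology)"
    using assms by (simp_all add: metrizable_imp_normal_space metrizable_imp_regular_space)
  obtain \<B> :: "'x set set" where B: "countable \<B>" "topological_basis \<B>"
    using ex_countable_basis by blast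
  define Q where "Q V W f \<longleftrightarrow> continuous_on UNIV f \<and> (\<forall>z. 0 \<le> f z \<and> f z \<le> (1::real)) \<and>
      (closure V \<subseteq> W \<longrightarrow> (\<forall>z\<in>V. f z = 1) \<and> (\<forall>z. z \<notin> W \<longrightarrow> f z = 0))" for V W :: "'x set" and f
  have ex: "\<exists>f. Q V W f" if W: "open W" for V W
  proof (cases "closure V \<subseteq> W")
    case True
    then have "disjnt (- W) (closure V)" by (auto simp: disjnt_def)
    then obtain f where "continuous_map (euclidean :: 'x topology) (top_of_set {0..1::real}) f"
      "f ` (- W) \<subseteq> {0}" "f ` closure V \<subseteq> {1}"
      using Urysohn_lemma[OF normal, of "- W" "closure V" 0 1] W by (auto simp: closed_closedin[symmetric])
    then have "continuous_on UNIV f" "\<And>z. f z \<in> {0..1}" "\<And>z. z \<notin> W \<Longrightarrow> f z = 0" "\<And>z. z \<in> V \<Longrightarrow> f z = 1"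
      using closure_subset[of V] by (auto simp: continuous_map_in_subtopology image_subset_iff)
    then show ?thesis by (intro exI[of _ f]) (auto simp: Q_def)
  next
    case False
    then show ?thesis by (intro exI[of _ "\<lambda>_. 0"]) (auto simp: Q_def)
  qed
  define f where "f V W = (SOME f. Q V W f)" for V W
  have Qf: "Q V W (f V W)" if "open W" for V W
    unfolding f_def using ex[OF that] by (rule someI_ex)
  have f: "continuous_on UNIV (f V W)" "0 \<le> f V W z" "f V W z \<le> 1"
    "closure V \<subseteq> W \<Longrightarrow> z \<in> V \<Longrightarrow> f V W z = 1" "closure V \<subseteq> W \<Longrightarrow> z \<notin> W \<Longrightarrow> f V W z = 0"
    if "open W" for V W z
    using Qf[OF that, of V] by (auto simp: Q_def)
  define F where "F = insert (\<lambda>_. 0) ((\<lambda>(V, W). f V W) ` (\<B> \<times> \<B>))"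
  have F: "countable F" "F \<noteq> {}" using B(1) by (auto simp: F_def)
  have cont: "continuous_on UNIV \<phi> \<and> (\<forall>z. 0 \<le> \<phi> z \<and> \<phi> z \<le> 1)" if "\<phi> \<in> F" for \<phi>
    using that f(1-3) topological_basis_open[OF B(2)] by (auto simp: F_def)
  have sep: "\<exists>\<phi>\<in>F. \<phi> x = 1 \<and> (\<forall>z. z \<notin> U \<longrightarrow> \<phi> z = 0)" if U: "open U" "x \<in> U" for U x
  proof -
    obtain W where W: "W \<in> \<B>" "x \<in> W" "W \<subseteq> U"
      using topological_basisE[OF B(2) U] by metis
    then have oW: "open W" using topological_basis_open[OF B(2)] by blast
    have "\<exists>V0 C. openin euclidean V0 \<and> closedin euclidean C \<and> x \<in> V0 \<and> V0 \<subseteq> C \<and> C \<subseteq> W"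
      by (rule reg[folded neighbourhood_base_of_closedin, unfolded neighbourhood_base_of, rule_format])
        (use oW W(2) in \<open>simp only: open_openin simp_thms\<close>)
    then obtain V0 C where V0: "openin euclidean V0" "closedin euclidean C" "x \<in> V0" "V0 \<subseteq> C" "C \<subseteq> W"
      by (elim exE conjE)
    then have op: "open V0" "closed C"
      by (simp_all only: open_openin closed_closedin)
    obtain V where V: "V \<in> \<B>" "x \<in> V" "V \<subseteq> V0"
      using topological_basisE[OF B(2) op(1) V0(3)] by metis
    have "closure V \<subseteq> W"
      using V(3) V0(4,5) closure_minimal[OF _ op(2), of V] by (meson subset_trans)
    then show ?thesis
      using f(4)[OF oW _ V(2)] f(5)[OF oW, of V] V W by (intro bexI[of _ "f V W"]) (auto simp: F_def)
  qed
  have rng: "from_nat_into F n \<in> F" for n using F(2) by (rule from_nat_into)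
  show ?thesis
  proof (rule that[of "from_nat_into F"])
    fix U :: "'x set" and x assume "open U" "x \<in> U"
    then obtain \<phi> where "\<phi> \<in> F" "\<phi> x = 1" "\<forall>z. z \<notin> U \<longrightarrow> \<phi> z = 0" using sep by blast
    then show "\<exists>n. from_nat_into F n x = 1 \<and> (\<forall>z. z \<notin> U \<longrightarrow> from_nat_into F n z = 0)"
      using from_nat_into_surj[OF F(1)] by metis
  qed (use cont rng in auto)
qed

section \<open>Two laws of large numbers\<close>

lemma mean_tendsto_zero_if_square_means:
  fixes z :: "nat \<Rightarrow> real"
  assumes z: "\<And>k. \<bar>z k\<bar> \<le> 1" and sq: "(\<lambda>n. \<bar>\<Sum>k<n\<^sup>2. z k\<bar> / (real n)\<^sup>2) \<longlonglongrightarrow> 0"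
  shows "(\<lambda>n. (\<Sum>k<n. z k) / real n) \<longlonglongrightarrow> 0"
proof -
  have fl: "filterlim floor_sqrt sequentially sequentially"
    unfolding filterlim_at_top
  proof
    fix Z :: nat
    show "\<forall>\<^sub>F n in sequentially. Z \<le> floor_sqrt n"
      using eventually_ge_at_top[of "Z\<^sup>2"] by eventually_elim (simp add: le_floor_sqrt_iff)
  qed
  have "(\<lambda>n. 2 / real n) \<longlonglongrightarrow> 0"
    by (rule lim_const_over_n)
  with sq have "(\<lambda>n. \<bar>\<Sum>k<n\<^sup>2. z k\<bar> / (real n)\<^sup>2 + 2 / real n) \<longlonglongrightarrow> 0 + 0"
    by (rule tendsto_add)
  from filterlim_compose[OF this fl]
  have lim: "(\<lambda>n. \<bar>\<Sum>k<(floor_sqrt n)\<^sup>2. z k\<bar> / (real (floor_sqrt n))\<^sup>2 + 2 / real (floor_sqrt n)) \<longlonglongrightarrow> 0"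
    by simp
  show ?thesis
  proof (rule Lim_null_comparison[OF _ lim])
    show "\<forall>\<^sub>F n in sequentially. norm ((\<Sum>k<n. z k) / real n) \<le>
        \<bar>\<Sum>k<(floor_sqrt n)\<^sup>2. z k\<bar> / (real (floor_sqrt n))\<^sup>2 + 2 / real (floor_sqrt n)"
      using eventually_gt_at_top[of 0]
    proof eventually_elim
      case (elim n)
      define r where "r = floor_sqrt n"
      have r: "r\<^sup>2 \<le> n" "n < (Suc r)\<^sup>2" "0 < r"
        using elim by (simp_all add: r_def Suc_floor_sqrt_power2_gt)
      have "n \<le> r\<^sup>2 + 2 * r"
        using r(2) by (simp add: power2_eq_square)
      then have rr: "real n - (real r)\<^sup>2 \<le> 2 * real r" "(real r)\<^sup>2 \<le> real n"
        using r(1) by (simp_all flip: of_nat_power of_nat_add of_nat_mult add: algebra_simps)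
      have "(\<Sum>k<n. z k) = (\<Sum>k<r\<^sup>2. z k) + (\<Sum>k\<in>{r\<^sup>2..<n}. z k)"
        using r(1) by (metis atLeast0LessThan sum.atLeastLessThan_concat zero_le)
      moreover have "\<bar>\<Sum>k\<in>{r\<^sup>2..<n}. z k\<bar> \<le> (\<Sum>k\<in>{r\<^sup>2..<n}. 1)"
        using z by (intro order_trans[OF sum_abs] sum_mono)
      moreover have "(\<Sum>k\<in>{r\<^sup>2..<n}. 1 :: real) = real n - (real r)\<^sup>2"
        using r(1) by (simp add: of_nat_diff)
      ultimately have "\<bar>\<Sum>k<n. z k\<bar> \<le> \<bar>\<Sum>k<r\<^sup>2. z k\<bar> + 2 * real r"
        using rr(1) by linarith
      then have "\<bar>\<Sum>k<n. z k\<bar> / real n \<le> (\<bar>\<Sum>k<r\<^sup>2. z k\<bar> + 2 * real r) / (real r)\<^sup>2"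
        using rr(2) r(3) by (intro frac_le) auto
      also have "\<dots> = \<bar>\<Sum>k<r\<^sup>2. z k\<bar> / (real r)\<^sup>2 + 2 / real r"
        using r(3) by (simp add: add_divide_distrib power2_eq_square)
      finally show ?case
        by (simp add: r_def)
    qed
  qed
qed


context prob_space
begin

lemma second_moment_finite_range:
  fixes Z :: "nat \<Rightarrow> 'a \<Rightarrow> real"
  assumes Z: "\<And>k. Z k \<in> borel_measurable M" "\<And>k x. \<bar>Z k x\<bar> \<le> 1"
    and orth: "\<And>i k. i + l < k \<Longrightarrow> expectation (\<lambda>x. Z i x * Z k x) = 0"
  shows "expectation (\<lambda>x. (\<Sum>k<n. Z k x)\<^sup>2) \<le> real (2 * l + 1) * real n"
proof -
  have int: "integrable M (\<lambda>x. Z i x * Z k x)" for i k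
    by (rule integrable_const_bound[of _ 1])
      (use Z in \<open>auto simp: abs_mult intro!: mult_le_one\<close>)
  have le: "expectation (\<lambda>x. Z i x * Z k x) \<le> indicator {i - l..i + l} k" for i k
  proof (cases "k \<in> {i - l..i + l}")
    case True
    have "expectation (\<lambda>x. Z i x * Z k x) \<le> expectation (\<lambda>x. 1)"
    proof (intro integral_mono int)
      show "Z i x * Z k x \<le> 1" for x
        using mult_le_one[OF Z(2) _ Z(2), of i x k x] by (simp add: abs_mult[symmetric] abs_le_iff mult.commute)
    qed simp
    then show ?thesis using True by (simp add: prob_space)
  next
    case False
    then have "i + l < k \<or> k + l < i" by auto
    then show ?thesis using orth[of i k] orth[of k i] False by (auto simp: mult.commute)
  qed
  have "expectation (\<lambda>x. (\<Sum>k<n. Z k x)\<^sup>2) = (\<Sum>i<n. \<Sum>k<n. expectation (\<lambda>x. Z i x * Z k x))"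
    by (simp add: power2_eq_square sum_product Bochner_Integration.integral_sum int)
  also have "\<dots> \<le> (\<Sum>i<n. \<Sum>k<n. indicator {i - l..i + l} k)"
    by (intro sum_mono le)
  also have "\<dots> \<le> (\<Sum>i<n. real (2 * l + 1))"
  proof (rule sum_mono)
    fix i
    have "(\<Sum>k<n. indicator {i - l..i + l} k :: real) = (\<Sum>k\<in>{..<n}. if k \<in> {i - l..i + l} then 1 else 0)"
      by (intro sum.cong) (auto simp: indicator_def)
    also have "\<dots> = (\<Sum>k\<in>{..<n} \<inter> {i - l..i + l}. 1)"
      by (rule sum.inter_restrict[symmetric]) simp
    also have "\<dots> = real (card ({..<n} \<inter> {i - l..i + l}))"
      by simp
    also have "\<dots> \<le> real (card {i - l..i + l})"
      by (intro of_nat_mono card_mono) auto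
    also have "\<dots> \<le> real (2 * l + 1)" by auto
    finally show "(\<Sum>k<n. indicator {i - l..i + l} k :: real) \<le> real (2 * l + 1)" .
  qed
  finally show ?thesis by (simp add: mult.commute)
qed

text \<open>Along the squares the second moments are summable; bounded increments fill the gaps.\<close>

lemma finite_range_strong_law:
  fixes Z :: "nat \<Rightarrow> 'a \<Rightarrow> real"
  assumes Z: "\<And>k. Z k \<in> borel_measurable M" "\<And>k x. \<bar>Z k x\<bar> \<le> 1"
    and orth: "\<And>i k. i + l < k \<Longrightarrow> expectation (\<lambda>x. Z i x * Z k x) = 0"
  shows "AE x in M. (\<lambda>n. (\<Sum>k<n. Z k x) / real n) \<longlonglongrightarrow> 0"
proof -
  define S where "S n x = (\<Sum>k<n. Z k x)" for n x
  have Sm[measurable]: "S n \<in> borel_measurable M" for n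
    unfolding S_def using Z(1) by measurable
  have Sb: "\<bar>S n x\<bar> \<le> real n" for n x
    unfolding S_def using sum_abs[of "\<lambda>k. Z k x" "{..<n}"] sum_mono[of "{..<n}" "\<lambda>k. \<bar>Z k x\<bar>" "\<lambda>_. 1"] Z(2)
    by (auto intro: order_trans)
  define Q where "Q n x = (S (n\<^sup>2) x / (real n)\<^sup>2)\<^sup>2" for n x
  have Qm[measurable]: "Q n \<in> borel_measurable M" for n unfolding Q_def by measurable
  have Qb: "0 \<le> Q n x" "Q n x \<le> 1" for n x
  proof -
    have "\<bar>S (n\<^sup>2) x / (real n)\<^sup>2\<bar> \<le> 1"
      using Sb[of "n\<^sup>2" x] by (cases "n = 0") (auto simp: field_simps)
    then show "Q n x \<le> 1" unfolding Q_def by (simp add: abs_square_le_1)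
  qed (simp add: Q_def)
  have Qi: "integrable M (Q n)" for n
    by (rule integrable_const_bound[of _ 1]) (use Qb in auto)
  have EQ: "expectation (Q n) \<le> real (2 * l + 1) * (1 / (real n)\<^sup>2)" for n
  proof (cases "n = 0")
    case False
    have "expectation (Q n) = expectation (\<lambda>x. (S (n\<^sup>2) x)\<^sup>2) / ((real n)\<^sup>2)\<^sup>2"
      unfolding Q_def power_divide by (rule integral_divide_zero)
    also have "\<dots> \<le> (real (2 * l + 1) * real (n\<^sup>2)) / ((real n)\<^sup>2)\<^sup>2"
      unfolding S_def by (intro divide_right_mono second_moment_finite_range assms) auto
    also have "\<dots> = real (2 * l + 1) * (1 / (real n)\<^sup>2)"
      using False by (simp add: field_simps power2_eq_square)
    finally show ?thesis .
  qed (simp add: Q_def[abs_def])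
  have "(\<Sum>n. ennreal (expectation (Q n))) < \<infinity>"
  proof -
    have "summable (\<lambda>n. expectation (Q n))"
    proof (rule summable_comparison_test')
      show "summable (\<lambda>n. real (2 * l + 1) * (1 / (real n)\<^sup>2))"
        using inverse_power_summable[of 2, where 'a = real]
        by (intro summable_mult) (simp add: field_simps)
      show "norm (expectation (Q n)) \<le> real (2 * l + 1) * (1 / (real n)\<^sup>2)" if "0 \<le> n" for n
        using EQ[of n] Qb by (simp add: integral_nonneg)
    qed
    then show ?thesis
      using Qb by (simp add: suminf_ennreal2 integral_nonneg)
  qed
  also have "(\<Sum>n. ennreal (expectation (Q n))) = (\<Sum>n. \<integral>\<^sup>+x. ennreal (Q n x) \<partial>M)"
    using Qb by (simp add: nn_integral_eq_integral[OF Qi])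
  also have "\<dots> = (\<integral>\<^sup>+x. (\<Sum>n. ennreal (Q n x)) \<partial>M)"
    by (simp add: nn_integral_suminf)
  finally have "AE x in M. (\<Sum>n. ennreal (Q n x)) \<noteq> \<infinity>"
    by (intro nn_integral_PInf_AE) auto
  then show ?thesis
  proof eventually_elim
    case (elim x)
    then have "summable (\<lambda>n. Q n x)"
      using Qb by (intro summable_suminf_not_top) auto
    then have "(\<lambda>n. sqrt (Q n x)) \<longlonglongrightarrow> sqrt 0"
      by (intro tendsto_real_sqrt summable_LIMSEQ_zero)
    then have sq: "(\<lambda>n. \<bar>S (n\<^sup>2) x\<bar> / (real n)\<^sup>2) \<longlonglongrightarrow> 0"
      by (simp add: Q_def)
    show ?case
      by (rule mean_tendsto_zero_if_square_means) (use Z(2) sq in \<open>auto simp: S_def\<close>)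
  qed
qed

text \<open>
  This is the maximal ergodic lemma: if \<open>Y = X - c'\<close> has negative mean, then the maxima
  \<open>Mx n\<close> of its partial sums satisfy \<open>Mx (n + 1) - Mx n \<circ> S \<longlonglongrightarrow> Y\<close> on the invariant set \<open>A\<close> on which
  they are unbounded, whereas \<open>E[(Mx (n + 1) - Mx n \<circ> S) 1\<^sub>A] \<ge> 0\<close>.
\<close>

lemma eventually_sums_le_if_indep:
  fixes X :: "'a \<Rightarrow> real"
  assumes S[measurable]: "S \<in> M \<rightarrow>\<^sub>M M" and pres: "distr M M S = M"
    and X: "integrable M X"
    and indep: "\<And>A. A \<in> sets M \<Longrightarrow> expectation (\<lambda>x. X x * indicator A (S x)) = expectation X * prob A"
    and c: "expectation X < c"
  shows "AE x in M. \<forall>\<^sub>F n in sequentially. (\<Sum>k<n. X ((S ^^ k) x)) \<le> c * real n"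
proof -
  define c' where "c' = (expectation X + c) / 2"
  have c': "expectation X < c'" "c' < c" using c by (auto simp: c'_def)
  define Y where "Y x = X x - c'" for x
  have Yi[simp]: "integrable M Y" using X by (simp add: Y_def[abs_def])
  have Ym[measurable]: "Y \<in> borel_measurable M" using Yi by (rule borel_measurable_integrable)
  have EY: "expectation Y = expectation X - c'" using X by (simp add: Y_def[abs_def] prob_space)
  define Mx where "Mx = rec_nat (\<lambda>x. 0 :: real) (\<lambda>n F x. max 0 (Y x + F (S x)))"
  have Mx: "Mx 0 x = 0" "Mx (Suc n) x = max 0 (Y x + Mx n (S x))" for n x
    by (simp_all add: Mx_def)
  have Mx_nonneg: "0 \<le> Mx n x" for n x by (cases n) (auto simp: Mx)
  have Mx_mono: "Mx n x \<le> Mx (Suc n) x" for n x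
  proof (induction n arbitrary: x)
    case (Suc n)
    show ?case
      using Suc.IH[of "S x"] by (subst (1 2) Mx(2)) (auto simp: max_def)
  qed (simp add: Mx)
  have Mx_mono': "Mx m x \<le> Mx n x" if "m \<le> n" for m n x
    by (rule lift_Suc_mono_le[of "\<lambda>n. Mx n x", OF Mx_mono that])
  have sum_Suc: "(\<Sum>k<Suc n. Y ((S ^^ k) x)) = Y x + (\<Sum>k<n. Y ((S ^^ k) (S x)))" for n x
    by (subst sum.lessThan_Suc_shift) (simp add: funpow_swap1)
  have sum_le: "(\<Sum>k<n. Y ((S ^^ k) x)) \<le> Mx n x" for n x
  proof (induction n arbitrary: x)
    case (Suc n)
    show ?case unfolding sum_Suc Mx(2) using Suc.IH[of "S x"] by linarith
  qed (simp add: Mx)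
  have Mxm[measurable]: "Mx n \<in> borel_measurable M" for n
  proof (induction n)
    case (Suc n)
    note Suc.IH[measurable]
    show ?case unfolding Mx(2)[abs_def] by measurable
  qed (simp add: Mx_def)
  have Mxi[simp]: "integrable M (Mx n)" for n
  proof (induction n)
    case (Suc n)
    have "integrable (distr M M S) (Mx n)" using Suc.IH by (simp add: pres)
    then have "integrable M (\<lambda>x. Mx n (S x))" by (subst (asm) integrable_distr_eq) auto
    then show ?case unfolding Mx(2)[abs_def] by (intro integrable_max) auto
  qed (simp add: Mx_def)
  define A where "A = {x \<in> space M. \<forall>r::nat. \<exists>n. real r < Mx n x}"
  have Am[measurable]: "A \<in> sets M" unfolding A_def by measurable
  have A_S: "S x \<in> A \<longleftrightarrow> x \<in> A" if x: "x \<in> space M" for x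
  proof -
    have Sx: "S x \<in> space M" using measurable_space[OF S x] .
    obtain N :: nat where N: "\<bar>Y x\<bar> \<le> real N" using real_arch_simple by blast
    show ?thesis
    proof
      assume "S x \<in> A"
      show "x \<in> A"
        unfolding A_def
      proof (intro CollectI conjI x allI)
        fix r :: nat
        obtain n where "real (r + N) < Mx n (S x)" using \<open>S x \<in> A\<close> unfolding A_def by blast
        then have "real r < Mx (Suc n) x" using N unfolding Mx(2) by auto
        then show "\<exists>n. real r < Mx n x" by blast
      qed
    next
      assume "x \<in> A"
      show "S x \<in> A"
        unfolding A_def
      proof (intro CollectI conjI Sx allI)
        fix r :: nat
        obtain n where "real (r + N) < Mx n x" using \<open>x \<in> A\<close> unfolding A_def by blast
        then have "real (r + N) < Mx (Suc n) x" using Mx_mono[of n x] by simp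
        then have "real r < Mx n (S x)" using N unfolding Mx(2) by auto
        then show "\<exists>n. real r < Mx n (S x)" by blast
      qed
    qed
  qed
  have ind_S: "indicator A (S x) = (indicator A x :: real)" if "x \<in> space M" for x
    using A_S[OF that] by (simp add: indicator_def)
  have prS: "expectation (\<lambda>x. f (S x)) = expectation f" if "f \<in> borel_measurable M" for f :: "'a \<Rightarrow> real"
    using integral_distr[OF S that] by (simp add: pres)
  define D where "D n x = Mx (Suc n) x - Mx n (S x)" for n x
  have D: "D n x = max (- Mx n (S x)) (Y x)" for n x
    unfolding D_def Mx(2) by (simp add: max_def)
  have MSi: "integrable M (\<lambda>x. Mx n (S x) * indicator A x)" for n
  proof -
    have "integrable (distr M M S) (Mx n)" by (simp add: pres)
    then have "integrable M (\<lambda>x. Mx n (S x))" by (subst (asm) integrable_distr_eq) auto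
    then show ?thesis by (intro integrable_real_mult_indicator) auto
  qed
  have D_nonneg: "0 \<le> expectation (\<lambda>x. D n x * indicator A x)" for n
  proof -
    have "expectation (\<lambda>x. Mx n x * indicator A x) \<le> expectation (\<lambda>x. Mx (Suc n) x * indicator A x)"
      by (intro integral_mono integrable_real_mult_indicator mult_right_mono Mx_mono) auto
    moreover have "expectation (\<lambda>x. Mx n x * indicator A x) = expectation (\<lambda>x. Mx n (S x) * indicator A (S x))"
      by (rule prS[symmetric]) simp
    moreover have "\<dots> = expectation (\<lambda>x. Mx n (S x) * indicator A x)"
      by (intro Bochner_Integration.integral_cong) (simp_all add: ind_S)
    moreover have "expectation (\<lambda>x. D n x * indicator A x) =
        expectation (\<lambda>x. Mx (Suc n) x * indicator A x) - expectation (\<lambda>x. Mx n (S x) * indicator A x)"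
      unfolding D_def left_diff_distrib
      by (intro Bochner_Integration.integral_diff MSi integrable_real_mult_indicator) auto
    ultimately show ?thesis by simp
  qed
  have "(\<lambda>n. expectation (\<lambda>x. D n x * indicator A x)) \<longlonglongrightarrow> expectation (\<lambda>x. Y x * indicator A x)"
  proof (rule integral_dominated_convergence[where w = "\<lambda>x. \<bar>Y x\<bar>"])
    show "(\<lambda>x. D n x * indicator A x) \<in> borel_measurable M" for n
      unfolding D_def by measurable
    show "AE x in M. (\<lambda>n. D n x * indicator A x) \<longlonglongrightarrow> Y x * indicator A x"
    proof (rule AE_I2)
      fix x assume x: "x \<in> space M"
      show "(\<lambda>n. D n x * indicator A x) \<longlonglongrightarrow> Y x * indicator A x"
      proof (cases "x \<in> A")
        case True
        then have SA: "S x \<in> A" using A_S[OF x] by simp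
        obtain N :: nat where N: "\<bar>Y x\<bar> \<le> real N" using real_arch_simple by blast
        obtain n0 where n0: "real N < Mx n0 (S x)" using SA by (auto simp: A_def)
        have "\<forall>\<^sub>F n in sequentially. D n x = Y x"
          using eventually_ge_at_top[of n0]
        proof eventually_elim
          case (elim n)
          then show ?case using Mx_mono'[OF elim, of "S x"] n0 N unfolding D by auto
        qed
        then show ?thesis by (intro tendsto_mult tendsto_const tendsto_eventually)
      qed simp
    qed
    show "AE x in M. norm (D n x * indicator A x) \<le> \<bar>Y x\<bar>" for n
    proof (rule AE_I2)
      fix x
      have "\<bar>D n x\<bar> \<le> \<bar>Y x\<bar>" using Mx_nonneg[of n "S x"] unfolding D by linarith
      then show "norm (D n x * indicator A x) \<le> \<bar>Y x\<bar>" by (simp add: indicator_def)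
    qed
  qed auto
  then have "0 \<le> expectation (\<lambda>x. Y x * indicator A x)"
    using D_nonneg by (intro LIMSEQ_le_const) auto
  also have "\<dots> = expectation (\<lambda>x. Y x * indicator A (S x))"
    by (intro Bochner_Integration.integral_cong) (simp_all add: ind_S)
  also have "\<dots> = expectation (\<lambda>x. X x * indicator A (S x)) - c' * expectation (\<lambda>x. indicator A (S x))"
  proof -
    have "(\<lambda>x. indicator A (S x) :: real) \<in> borel_measurable M" by measurable
    then have i: "integrable M (\<lambda>x. indicator A (S x) :: real)"
      by (intro integrable_const_bound[of _ 1]) auto
    have "integrable M (\<lambda>x. X x * indicator (S -` A \<inter> space M) x)"
      using X by (intro integrable_real_mult_indicator) auto
    also have "?this \<longleftrightarrow> integrable M (\<lambda>x. X x * indicator A (S x))"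
      by (intro Bochner_Integration.integrable_cong) (auto simp: indicator_def)
    finally show ?thesis using i
      unfolding Y_def left_diff_distrib by (simp add: Bochner_Integration.integral_diff)
  qed
  also have "\<dots> = expectation Y * prob A"
    using prS[of "indicator A"] by (simp add: indep EY left_diff_distrib)
  finally have "prob A = 0"
    using EY c'(1) measure_nonneg[of M A] by (simp add: zero_le_mult_iff order.antisym)
  then have "AE x in M. x \<notin> A"
    using AE_iff_measurable[OF Am, of "\<lambda>x. x \<notin> A"] by (auto simp: emeasure_eq_measure A_def)
  then show ?thesis
    using AE_space
  proof eventually_elim
    case (elim x)
    then obtain r :: nat where r: "\<And>n. Mx n x \<le> real r" by (auto simp: A_def not_less)
    show ?case
    proof (rule eventually_mono[OF eventually_ge_at_top])
      fix n :: nat assume n: "nat \<lceil>real r / (c - c')\<rceil> \<le> n"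
      then have "real r / (c - c') \<le> real n"
        using c' by linarith
      then have "real r \<le> (c - c') * real n"
        using c'(2) by (simp add: field_simps)
      have "(\<Sum>k<n. Y ((S ^^ k) x)) \<le> real r"
        using order_trans[OF sum_le r] .
      then have "(\<Sum>k<n. X ((S ^^ k) x)) - c' * real n \<le> real r"
        by (simp add: Y_def sum_subtractf mult.commute)
      with \<open>real r \<le> (c - c') * real n\<close> show "(\<Sum>k<n. X ((S ^^ k) x)) \<le> c * real n"
        by (simp add: algebra_simps)
    qed
  qed
qed

end

section \<open>The Markov property\<close>

lemma nn_integral_countable_partition:
  fixes g :: "'a \<Rightarrow> 'c::countable"
  assumes [measurable]: "g \<in> M \<rightarrow>\<^sub>M count_space UNIV" "f \<in> borel_measurable M"
  shows "(\<integral>\<^sup>+x. f x \<partial>M) = (\<integral>\<^sup>+v. (\<integral>\<^sup>+x. f x * indicator {v} (g x) \<partial>M) \<partial>count_space UNIV)"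
proof -
  have "(\<integral>\<^sup>+v. f x * indicator {v} (g x) \<partial>count_space UNIV) = f x" for x
  proof -
    have "(\<integral>\<^sup>+v. f x * indicator {v} (g x) \<partial>count_space UNIV) = (\<integral>\<^sup>+v. f x * indicator {g x} v \<partial>count_space UNIV)"
      by (intro nn_integral_cong) (auto simp: indicator_def)
    then show ?thesis by (simp add: nn_integral_cmult_indicator)
  qed
  then have "(\<integral>\<^sup>+x. f x \<partial>M) = (\<integral>\<^sup>+x. (\<integral>\<^sup>+v. f x * indicator {v} (g x) \<partial>count_space UNIV) \<partial>M)"
    by simp
  also have "\<dots> = (\<integral>\<^sup>+v. (\<integral>\<^sup>+x. f x * indicator {v} (g x) \<partial>M) \<partial>count_space UNIV)"
    by (intro nn_integral_count_space_nn_integral) auto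
  finally show ?thesis .
qed

lemma less_nn_integral_count_space_finite:
  fixes f :: "'c::countable \<Rightarrow> ennreal"
  assumes "c < (\<integral>\<^sup>+v. f v \<partial>count_space UNIV)"
  shows "\<exists>F. finite F \<and> c < (\<Sum>v\<in>F. f v)"
proof -
  define G where "G n = {v :: 'c. to_nat v < n}" for n
  have fin: "finite (G n)" for n
    by (rule finite_subset[of _ "to_nat -` {..<n}"]) (auto simp: G_def intro: finite_vimageI)
  have "(\<integral>\<^sup>+v. f v \<partial>count_space UNIV) = (\<integral>\<^sup>+v. (SUP n. f v * indicator (G n) v) \<partial>count_space UNIV)"
  proof (rule nn_integral_cong)
    fix v :: 'c
    have "f v \<le> (SUP n. f v * indicator (G n) v)"
      by (rule SUP_upper2[of "Suc (to_nat v)"]) (auto simp: G_def)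
    moreover have "(SUP n. f v * indicator (G n) v) \<le> f v"
      by (rule SUP_least) (auto simp: indicator_def)
    ultimately show "f v = (SUP n. f v * indicator (G n) v)" by (rule antisym)
  qed
  also have "\<dots> = (SUP n. (\<integral>\<^sup>+v. f v * indicator (G n) v \<partial>count_space UNIV))"
  proof (rule nn_integral_monotone_convergence_SUP)
    show "incseq (\<lambda>n v. f v * indicator (G n) v)"
      by (auto simp: incseq_def le_fun_def G_def indicator_def)
  qed auto
  also have "(\<lambda>n. (\<integral>\<^sup>+v. f v * indicator (G n) v \<partial>count_space UNIV)) = (\<lambda>n. \<Sum>v\<in>G n. f v)"
    using fin by (simp add: nn_integral_count_space_indicator[symmetric] nn_integral_count_space_finite fun_eq_iff)
  finally show ?thesis
    using assms fin by (auto simp: less_SUP_iff)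
qed

lemma funpow_path_shift: "(path_shift ^^ n) \<omega> = (\<lambda>i. \<omega> (n + i))"
  by (induction n arbitrary: \<omega>) (auto simp: path_shift_def funpow_Suc_right simp del: funpow.simps)

lemma length_restr[simp]: "length (restr \<omega> n) = n"
  by (simp add: restr_def)

lemma nth_restr[simp]: "i < n \<Longrightarrow> restr \<omega> n ! i = \<omega> i"
  by (simp add: restr_def)

lemma restr_eq_iff: "restr \<omega> n = w \<longleftrightarrow> length w = n \<and> (\<forall>i<n. \<omega> i = w ! i)"
  by (auto simp: list_eq_iff_nth_eq)

lemma measurable_coordinate[measurable]:
  "(\<lambda>\<omega>. \<omega> i) \<in> (borel :: (nat \<Rightarrow> 'e::{countable, discrete_topology, second_countable_topology}) measure) \<rightarrow>\<^sub>M count_space UNIV"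
proof -
  have "(\<lambda>\<omega>. \<omega> i) \<in> (\<Pi>\<^sub>M i\<in>(UNIV::nat set). (count_space UNIV :: 'e measure)) \<rightarrow>\<^sub>M count_space UNIV"
    by measurable
  then show ?thesis
    using measurable_cong_sets[OF sets_path_space[where 'e = 'e] refl] by blast
qed

lemma measurable_path_shift[measurable]:
  "path_shift \<in> (borel :: (nat \<Rightarrow> 'e::{countable, discrete_topology, second_countable_topology}) measure) \<rightarrow>\<^sub>M borel"
proof -
  have "path_shift \<in> (borel :: (nat \<Rightarrow> 'e) measure) \<rightarrow>\<^sub>M (\<Pi>\<^sub>M i\<in>UNIV. count_space UNIV)"
    unfolding path_shift_def by (intro measurable_PiM_single') (auto simp: PiE_UNIV_domain)
  also have "\<dots> = (borel :: (nat \<Rightarrow> 'e) measure) \<rightarrow>\<^sub>M borel"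
    by (intro measurable_cong_sets refl) (simp add: sets_path_space)
  finally show ?thesis .
qed

lemma measurable_funpow_path_shift[measurable]:
  "path_shift ^^ n \<in> (borel :: (nat \<Rightarrow> 'e::{countable, discrete_topology, second_countable_topology}) measure) \<rightarrow>\<^sub>M borel"
  by (rule measurable_compose_n) measurable

lemma measurable_restr[measurable]:
  "(\<lambda>\<omega>. restr \<omega> n) \<in> (borel :: (nat \<Rightarrow> 'e::{countable, discrete_topology, second_countable_topology}) measure) \<rightarrow>\<^sub>M count_space UNIV"
proof (subst measurable_count_space_eq2_countable)
  show "(\<lambda>\<omega>. restr \<omega> n) \<in> space borel \<rightarrow> UNIV \<and>
    (\<forall>a\<in>UNIV. (\<lambda>\<omega>. restr \<omega> n) -` {a} \<inter> space (borel :: (nat \<Rightarrow> 'e) measure) \<in> sets borel)"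
  proof safe
    fix w :: "'e list"
    have "{\<omega> \<in> space (borel :: (nat \<Rightarrow> 'e) measure). length w = n \<and> (\<forall>i\<in>{..<n}. \<omega> i = w ! i)} \<in> sets borel"
      by measurable
    also have "{\<omega> \<in> space (borel :: (nat \<Rightarrow> 'e) measure). length w = n \<and> (\<forall>i\<in>{..<n}. \<omega> i = w ! i)} =
        (\<lambda>\<omega>. restr \<omega> n) -` {w} \<inter> space (borel :: (nat \<Rightarrow> 'e) measure)"
      by (auto simp: restr_eq_iff)
    finally show "(\<lambda>\<omega>. restr \<omega> n) -` {w} \<inter> space (borel :: (nat \<Rightarrow> 'e) measure) \<in> sets borel" .
  qed auto
qed

lemma borel_measurable_if_finitely_determined:
  fixes f :: "(nat \<Rightarrow> 'e::{countable, discrete_topology, second_countable_topology}) \<Rightarrow> 'b"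
  assumes "\<And>\<omega> \<omega>'. (\<forall>i<n. \<omega> i = \<omega>' i) \<Longrightarrow> f \<omega> = f \<omega>'" "range f \<subseteq> space N"
  shows "f \<in> borel \<rightarrow>\<^sub>M N"
proof -
  have "(\<lambda>v. f (nth v)) \<in> count_space UNIV \<rightarrow>\<^sub>M N"
    using assms(2) by auto
  then have "(\<lambda>\<omega>. f (nth (restr \<omega> n))) \<in> borel \<rightarrow>\<^sub>M N"
    by (rule measurable_compose[OF measurable_restr])
  also have "(\<lambda>\<omega>. f (nth (restr \<omega> n))) = f"
    by (intro ext assms(1)) simp
  finally show ?thesis .
qed

lemma finitely_determined_in_sets:
  fixes A :: "(nat \<Rightarrow> 'e::{countable, discrete_topology, second_countable_topology}) set"
  assumes "\<And>\<omega> \<omega>'. (\<forall>i<n. \<omega> i = \<omega>' i) \<Longrightarrow> \<omega> \<in> A \<longleftrightarrow> \<omega>' \<in> A"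
  shows "A \<in> sets borel"
proof -
  have "(\<lambda>\<omega>. \<omega> \<in> A) \<in> borel \<rightarrow>\<^sub>M count_space UNIV"
    by (rule borel_measurable_if_finitely_determined[of n]) (use assms in auto)
  then have "{\<omega> \<in> space borel. \<omega> \<in> A} \<in> sets borel"
    by (rule predE)
  then show ?thesis by simp
qed

context
  fixes K :: "'e::{countable, discrete_topology, second_countable_topology} \<Rightarrow> 'e pmf"
begin

lemma prob_space_markov: "prob_space (markov_measure K a)"
  using is_markov_measure_markov_measure[of K a] by (simp add: is_markov_measure_def)

lemma sets_markov[measurable_cong, simp]: "sets (markov_measure K a) = sets borel"
  using is_markov_measure_markov_measure[of K a] by (simp add: is_markov_measure_def)

lemma space_markov[simp]: "space (markov_measure K a) = UNIV"
  using sets_eq_imp_space_eq[OF sets_markov] by simp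

lemma emeasure_markov_cylinder:
  "emeasure (markov_measure K a) {\<omega>. \<forall>i\<le>n. \<omega> i = w i} =
    (if w 0 = a then \<Prod>i<n. ennreal (pmf (K (w i)) (w (Suc i))) else 0)"
  using is_markov_measure_markov_measure[of K a] by (simp add: is_markov_measure_def)

lemma AE_markov_start: "AE \<omega> in markov_measure K a. \<omega> 0 = a"
proof -
  interpret prob_space "markov_measure K a" by (rule prob_space_markov)
  have "emeasure (markov_measure K a) {\<omega>. \<omega> 0 = a} = 1"
    using emeasure_markov_cylinder[of a 0 "\<lambda>_. a"] by simp
  then have "prob {\<omega>. \<omega> 0 = a} = 1"
    by (simp add: emeasure_eq_measure)
  then show ?thesis
    using AE_prob_1 by fastforce
qed

lemma measurable_coordinate_compose:
  fixes h :: "'e \<Rightarrow> 'b::topological_space"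
  shows "(\<lambda>\<omega>. h (\<omega> n)) \<in> borel_measurable (markov_measure K a)"
proof -
  have "(\<lambda>\<omega>. \<omega> n) \<in> markov_measure K a \<rightarrow>\<^sub>M count_space UNIV" by measurable
  then show ?thesis by (rule measurable_compose) simp
qed

lemma emeasure_markov_next:
  "emeasure (markov_measure K a) {\<omega>. \<omega> 1 = b} = pmf (K a) b"
proof -
  have "emeasure (markov_measure K a) {\<omega>. \<omega> 1 = b} =
      emeasure (markov_measure K a) {\<omega>. \<forall>i\<le>1. \<omega> i = (case i of 0 \<Rightarrow> a | _ \<Rightarrow> b)}"
  proof (rule emeasure_eq_AE)
    show "AE \<omega> in markov_measure K a.
      \<omega> \<in> {\<omega>. \<omega> 1 = b} \<longleftrightarrow> \<omega> \<in> {\<omega>. \<forall>i\<le>1. \<omega> i = (case i of 0 \<Rightarrow> a | _ \<Rightarrow> b)}"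
      using AE_markov_start
    proof eventually_elim
      case (elim \<omega>)
      then show ?case by (auto simp: le_Suc_eq)
    qed
    show "{\<omega>. \<forall>i\<le>1. \<omega> i = (case i of 0 \<Rightarrow> a | _ \<Rightarrow> b)} \<in> sets (markov_measure K a)"
      by (simp add: sets_cylinder del: One_nat_def)
    have "{\<omega> \<in> space (markov_measure K a). \<omega> 1 = b} \<in> sets (markov_measure K a)"
      by measurable
    then show "{\<omega>. \<omega> 1 = b} \<in> sets (markov_measure K a)" by simp
  qed
  then show ?thesis
    by (simp add: emeasure_markov_cylinder del: One_nat_def)
qed

lemma emeasure_markov_cylinder_shift:
  assumes [measurable]: "A \<in> sets borel"
  shows "emeasure (markov_measure K a) {\<omega>. (\<forall>i\<le>n. \<omega> i = w i) \<and> (path_shift ^^ n) \<omega> \<in> A} =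
    emeasure (markov_measure K a) {\<omega>. \<forall>i\<le>n. \<omega> i = w i} * emeasure (markov_measure K (w n)) A"
proof -
  interpret prob_space "markov_measure K a" by (rule prob_space_markov)
  let ?P = "markov_measure K a"
  define C where "C = {\<omega>. \<forall>i\<le>n. \<omega> i = w i}"
  have Cm[measurable]: "C \<in> sets borel" by (simp add: C_def sets_cylinder)
  show ?thesis
  proof (cases "emeasure ?P C = 0")
    case True
    have "emeasure ?P {\<omega>. (\<forall>i\<le>n. \<omega> i = w i) \<and> (path_shift ^^ n) \<omega> \<in> A} \<le> emeasure ?P C"
      by (rule emeasure_mono) (auto simp: C_def sets_cylinder)
    with True show ?thesis by (simp flip: C_def)
  next
    case False
    have fin: "emeasure ?P C \<noteq> \<infinity>" by simp
    define Q where "Q = distr (uniform_measure ?P C) borel (path_shift ^^ n)"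
    have um: "path_shift ^^ n \<in> uniform_measure ?P C \<rightarrow>\<^sub>M borel" by measurable
    have Q: "emeasure Q B = emeasure ?P (C \<inter> (path_shift ^^ n) -` B) / emeasure ?P C" if B: "B \<in> sets borel" for B
    proof -
      have "(path_shift ^^ n) -` B \<inter> space borel \<in> sets borel"
        by (rule measurable_sets[OF measurable_funpow_path_shift B])
      then have "(path_shift ^^ n) -` B \<in> sets ?P" by simp
      then show ?thesis
        unfolding Q_def by (subst emeasure_distr[OF um B]) simp
    qed
    have "is_markov_measure K (w n) Q"
      unfolding is_markov_measure_def
    proof (intro conjI allI)
      have "prob_space (uniform_measure ?P C)"
        by (rule prob_space_uniform_measure[OF False fin])
      then show "prob_space Q"
        unfolding Q_def by (rule prob_space.prob_space_distr[OF _ um])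
      show "sets Q = sets borel" by (simp add: Q_def)
      fix m v
      show "emeasure Q {\<omega>. \<forall>i\<le>m. \<omega> i = v i} =
        (if v 0 = w n then \<Prod>i<m. ennreal (pmf (K (v i)) (v (Suc i))) else 0)"
      proof (cases "v 0 = w n")
        case True
        define u where "u i = (if i < n then w i else v (i - n))" for i
        have uw: "u i = w i" if "i \<le> n" for i using that True by (auto simp: u_def)
        have uv: "u (n + i) = v i" for i by (simp add: u_def)
        have C': "C = {\<omega>. \<forall>i\<le>n. \<omega> i = u i}" by (auto simp: C_def uw)
        have "C \<inter> (path_shift ^^ n) -` {\<omega>. \<forall>i\<le>m. \<omega> i = v i} = {\<omega>. \<forall>i\<le>n + m. \<omega> i = u i}"
        proof (intro set_eqI iffI)
          fix \<omega> assume \<omega>: "\<omega> \<in> C \<inter> (path_shift ^^ n) -` {\<omega>. \<forall>i\<le>m. \<omega> i = v i}"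
          have "\<omega> i = u i" if "i \<le> n + m" for i
          proof (cases "i \<le> n")
            case False
            have "\<forall>j\<le>m. \<omega> (n + j) = v j" using \<omega> by (simp add: funpow_path_shift)
            from this[rule_format, of "i - n"] show ?thesis using False that by (simp add: u_def)
          qed (use \<omega> in \<open>auto simp: C'\<close>)
          then show "\<omega> \<in> {\<omega>. \<forall>i\<le>n + m. \<omega> i = u i}" by simp
        qed (auto simp: C' funpow_path_shift uv)
        moreover have "(\<Prod>i<n + m. ennreal (pmf (K (u i)) (u (Suc i)))) =
            (\<Prod>i<n. ennreal (pmf (K (u i)) (u (Suc i)))) * (\<Prod>i<m. ennreal (pmf (K (v i)) (v (Suc i))))"
        proof (induction m)
          case (Suc m)
          then show ?case using uv[of m] uv[of "Suc m"] by (simp add: mult.assoc)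
        qed simp
        ultimately have "emeasure ?P (C \<inter> (path_shift ^^ n) -` {\<omega>. \<forall>i\<le>m. \<omega> i = v i}) =
            (\<Prod>i<m. ennreal (pmf (K (v i)) (v (Suc i)))) * emeasure ?P C"
          by (simp add: C' emeasure_markov_cylinder mult.commute)
        then show ?thesis
          using False fin True by (simp add: Q sets_cylinder ennreal_mult_divide_eq)
      next
        case False
        then have "C \<inter> (path_shift ^^ n) -` {\<omega>. \<forall>i\<le>m. \<omega> i = v i} = {}"
          by (auto simp: C_def funpow_path_shift)
        then show ?thesis using False by (simp add: Q sets_cylinder)
      qed
    qed
    then have "Q = markov_measure K (w n)"
      using is_markov_measure_markov_measure is_markov_measure_unique by blast
    then have "emeasure ?P (C \<inter> (path_shift ^^ n) -` A) / emeasure ?P C = emeasure (markov_measure K (w n)) A"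
      using Q[OF assms] by simp
    moreover have "X / emeasure ?P C * emeasure ?P C = X" for X
      using False fin by (simp add: ennreal_divide_times ennreal_divide_self less_top[symmetric])
    ultimately have "emeasure ?P (C \<inter> (path_shift ^^ n) -` A) = emeasure (markov_measure K (w n)) A * emeasure ?P C"
      by metis
    also have "\<dots> = emeasure ?P C * emeasure (markov_measure K (w n)) A"
      by (rule mult.commute)
    also have "C \<inter> (path_shift ^^ n) -` A = {\<omega>. (\<forall>i\<le>n. \<omega> i = w i) \<and> (path_shift ^^ n) \<omega> \<in> A}"
      by (auto simp: C_def)
    finally show ?thesis by (simp add: C_def)
  qed
qed

lemma nn_integral_markov_property:
  fixes F :: "'e list \<Rightarrow> ennreal"
  assumes [measurable]: "A \<in> sets borel"
  shows "(\<integral>\<^sup>+\<omega>. F (restr \<omega> (Suc n)) * indicator A ((path_shift ^^ n) \<omega>) \<partial>markov_measure K a) =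
    (\<integral>\<^sup>+\<omega>. F (restr \<omega> (Suc n)) * emeasure (markov_measure K (\<omega> n)) A \<partial>markov_measure K a)"
proof -
  have "(\<integral>\<^sup>+\<omega>. F (restr \<omega> (Suc n)) * indicator A ((path_shift ^^ n) \<omega>) * indicator {v} (restr \<omega> (Suc n)) \<partial>markov_measure K a) =
    (\<integral>\<^sup>+\<omega>. F (restr \<omega> (Suc n)) * emeasure (markov_measure K (\<omega> n)) A * indicator {v} (restr \<omega> (Suc n)) \<partial>markov_measure K a)"
    for v
  proof (cases "length v = Suc n")
    case True
    have iff: "restr \<omega> (Suc n) = v \<longleftrightarrow> (\<forall>i\<le>n. \<omega> i = v ! i)" for \<omega>
      using True by (auto simp: restr_eq_iff less_Suc_eq_le)
    let ?C = "{\<omega>. \<forall>i\<le>n. \<omega> i = v ! i}" and ?D = "{\<omega>. (\<forall>i\<le>n. \<omega> i = v ! i) \<and> (path_shift ^^ n) \<omega> \<in> A}"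
    have restr_v: "restr \<omega> (Suc n) = v" if "\<forall>i\<le>n. \<omega> i = v ! i" for \<omega> using that by (simp add: iff)
    have C[measurable]: "?C \<in> sets borel" by (rule sets_cylinder)
    have "?D = ?C \<inter> ((path_shift ^^ n) -` A \<inter> space borel)" by auto
    also have "\<dots> \<in> sets borel" by (intro sets.Int C measurable_sets[OF measurable_funpow_path_shift assms])
    finally have D[measurable]: "?D \<in> sets borel" .
    have "(\<integral>\<^sup>+\<omega>. F (restr \<omega> (Suc n)) * indicator A ((path_shift ^^ n) \<omega>) * indicator {v} (restr \<omega> (Suc n)) \<partial>markov_measure K a)
      = (\<integral>\<^sup>+\<omega>. F v * indicator ?D \<omega> \<partial>markov_measure K a)"
      by (intro nn_integral_cong) (auto simp: indicator_def iff restr_v)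
    also have "\<dots> = F v * emeasure (markov_measure K (v ! n)) A * emeasure (markov_measure K a) ?C"
      by (simp add: nn_integral_cmult_indicator emeasure_markov_cylinder_shift mult_ac)
    also have "\<dots> = (\<integral>\<^sup>+\<omega>. F v * emeasure (markov_measure K (v ! n)) A * indicator ?C \<omega> \<partial>markov_measure K a)"
      by (simp add: nn_integral_cmult_indicator)
    also have "\<dots> = (\<integral>\<^sup>+\<omega>. F (restr \<omega> (Suc n)) * emeasure (markov_measure K (\<omega> n)) A * indicator {v} (restr \<omega> (Suc n)) \<partial>markov_measure K a)"
      by (intro nn_integral_cong) (auto simp: indicator_def iff restr_v)
    finally show ?thesis .
  next
    case False
    then have "indicator {v} (restr \<omega> (Suc n)) = (0 :: ennreal)" for \<omega>
      by (auto simp: indicator_def)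
    then show ?thesis by simp
  qed
  then show ?thesis
    by (subst (1 2) nn_integral_countable_partition[where g = "\<lambda>\<omega>. restr \<omega> (Suc n)"])
      (auto intro!: borel_measurable_times_ennreal measurable_coordinate_compose)
qed

lemma emeasure_markov_path_shift:
  assumes [measurable]: "A \<in> sets borel"
  shows "emeasure (markov_measure K a) {\<omega>. path_shift \<omega> \<in> A} = (\<integral>\<^sup>+b. emeasure (markov_measure K b) A \<partial>K a)"
proof -
  have "(\<integral>\<^sup>+\<omega>. emeasure (markov_measure K (\<omega> 1)) A \<partial>markov_measure K a) =
      (\<integral>\<^sup>+b. (\<integral>\<^sup>+\<omega>. emeasure (markov_measure K (\<omega> 1)) A * indicator {b} (\<omega> 1) \<partial>markov_measure K a) \<partial>count_space UNIV)"
    by (rule nn_integral_countable_partition) (auto intro!: measurable_coordinate_compose measurable_coordinate)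
  also have "\<dots> = (\<integral>\<^sup>+b. (\<integral>\<^sup>+\<omega>. emeasure (markov_measure K b) A * indicator {\<omega>. \<omega> 1 = b} \<omega> \<partial>markov_measure K a) \<partial>count_space UNIV)"
    by (intro nn_integral_cong) (auto simp: indicator_def)
  also have "\<dots> = (\<integral>\<^sup>+b. ennreal (pmf (K a) b) * emeasure (markov_measure K b) A \<partial>count_space UNIV)"
  proof (intro nn_integral_cong)
    fix b
    have "{\<omega> \<in> space (markov_measure K a). \<omega> 1 = b} \<in> sets (markov_measure K a)" by measurable
    then show "(\<integral>\<^sup>+\<omega>. emeasure (markov_measure K b) A * indicator {\<omega>. \<omega> 1 = b} \<omega> \<partial>markov_measure K a)
      = ennreal (pmf (K a) b) * emeasure (markov_measure K b) A"
      by (subst nn_integral_cmult_indicator) (simp_all add: emeasure_markov_next[simplified] mult.commute)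
  qed
  also have "\<dots> = (\<integral>\<^sup>+b. emeasure (markov_measure K b) A \<partial>K a)"
    by (simp add: nn_integral_measure_pmf)
  finally have eq: "(\<integral>\<^sup>+\<omega>. emeasure (markov_measure K (\<omega> 1)) A \<partial>markov_measure K a) = (\<integral>\<^sup>+b. emeasure (markov_measure K b) A \<partial>K a)" .
  have "path_shift -` A \<inter> space borel \<in> sets borel"
    by (rule measurable_sets[OF measurable_path_shift assms])
  then have m: "{\<omega>. path_shift \<omega> \<in> A} \<in> sets borel" by (simp add: vimage_def)
  have "emeasure (markov_measure K a) {\<omega>. path_shift \<omega> \<in> A} = (\<integral>\<^sup>+\<omega>. indicator A (path_shift \<omega>) \<partial>markov_measure K a)"
    using m by (simp add: indicator_def of_bool_def flip: nn_integral_indicator)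
  also have "\<dots> = (\<integral>\<^sup>+\<omega>. emeasure (markov_measure K (\<omega> 1)) A \<partial>markov_measure K a)"
    using nn_integral_markov_property[OF assms, where F = "\<lambda>_. 1" and n = 1] by simp
  finally show ?thesis using eq by simp
qed

lemma integral_markov_property_eq_0:
  fixes f :: "'e list \<Rightarrow> real"
  assumes [measurable]: "A \<in> sets borel" and f: "\<And>v. \<bar>f v\<bar> \<le> 1"
  shows "(\<integral>\<omega>. f (restr \<omega> (Suc n)) * (indicator A ((path_shift ^^ n) \<omega>) - measure (markov_measure K (\<omega> n)) A)
    \<partial>markov_measure K a) = 0"
proof -
  interpret prob_space "markov_measure K a" by (rule prob_space_markov)
  have P1: "measure (markov_measure K b) A \<le> 1" for b
    using prob_space.prob_le_1[OF prob_space_markov] by blast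
  have em: "emeasure (markov_measure K b) A = ennreal (measure (markov_measure K b) A)" for b
    using prob_space.finite_measure[OF prob_space_markov] by (simp add: finite_measure.emeasure_eq_measure)
  have m1[measurable]: "(\<lambda>\<omega>. F (restr \<omega> (Suc n)) * indicator A ((path_shift ^^ n) \<omega>)) \<in> borel_measurable (markov_measure K a)"
    for F :: "'e list \<Rightarrow> real"
    by measurable
  have m2[measurable]: "(\<lambda>\<omega>. F (restr \<omega> (Suc n)) * measure (markov_measure K (\<omega> n)) A) \<in> borel_measurable (markov_measure K a)"
    for F :: "'e list \<Rightarrow> real"
    by (rule borel_measurable_times[OF _ measurable_coordinate_compose]) measurable
  have int: "integrable (markov_measure K a) (\<lambda>\<omega>. F (restr \<omega> (Suc n)) * indicator A ((path_shift ^^ n) \<omega>))"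
    "integrable (markov_measure K a) (\<lambda>\<omega>. F (restr \<omega> (Suc n)) * measure (markov_measure K (\<omega> n)) A)"
    if "\<And>v. \<bar>F v\<bar> \<le> 2" for F :: "'e list \<Rightarrow> real"
  proof -
    show "integrable (markov_measure K a) (\<lambda>\<omega>. F (restr \<omega> (Suc n)) * indicator A ((path_shift ^^ n) \<omega>))"
      by (rule integrable_const_bound[of _ 2]) (use that in \<open>auto simp: indicator_def\<close>)
    have "\<bar>F v * measure (markov_measure K b) A\<bar> \<le> 2 * 1" for v b
      unfolding abs_mult using that[of v] P1[of b] by (intro mult_mono) auto
    then show "integrable (markov_measure K a) (\<lambda>\<omega>. F (restr \<omega> (Suc n)) * measure (markov_measure K (\<omega> n)) A)"
      by (intro integrable_const_bound[of _ 2]) auto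
  qed
  have eq: "(\<integral>\<omega>. F (restr \<omega> (Suc n)) * indicator A ((path_shift ^^ n) \<omega>) \<partial>markov_measure K a) =
    (\<integral>\<omega>. F (restr \<omega> (Suc n)) * measure (markov_measure K (\<omega> n)) A \<partial>markov_measure K a)"
    if F: "\<And>v. \<bar>F v\<bar> \<le> 2" "\<And>v. 0 \<le> F v" for F :: "'e list \<Rightarrow> real"
  proof -
    have "(\<integral>\<^sup>+\<omega>. ennreal (F (restr \<omega> (Suc n)) * indicator A ((path_shift ^^ n) \<omega>)) \<partial>markov_measure K a) =
        (\<integral>\<^sup>+\<omega>. ennreal (F (restr \<omega> (Suc n))) * indicator A ((path_shift ^^ n) \<omega>) \<partial>markov_measure K a)"
      by (intro nn_integral_cong) (simp add: indicator_def)
    also have "\<dots> = (\<integral>\<^sup>+\<omega>. ennreal (F (restr \<omega> (Suc n))) * emeasure (markov_measure K (\<omega> n)) A \<partial>markov_measure K a)"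
      by (rule nn_integral_markov_property[OF assms(1)])
    also have "\<dots> = (\<integral>\<^sup>+\<omega>. ennreal (F (restr \<omega> (Suc n)) * measure (markov_measure K (\<omega> n)) A) \<partial>markov_measure K a)"
      using F by (simp add: em ennreal_mult)
    finally show ?thesis
      using F by (subst (1 2) integral_eq_nn_integral) auto
  qed
  define f1 where "f1 v = f v + 1" for v
  have f1: "\<bar>f1 v\<bar> \<le> 2" "0 \<le> f1 v" for v
    using f[of v] by (auto simp: f1_def abs_le_iff)
  let ?c = "\<lambda>v::'e list. 1::real"
  have "(\<integral>\<omega>. f (restr \<omega> (Suc n)) * (indicator A ((path_shift ^^ n) \<omega>) - measure (markov_measure K (\<omega> n)) A) \<partial>markov_measure K a) =
    (\<integral>\<omega>. (f1 (restr \<omega> (Suc n)) * indicator A ((path_shift ^^ n) \<omega>) - f1 (restr \<omega> (Suc n)) * measure (markov_measure K (\<omega> n)) A)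
     - (?c (restr \<omega> (Suc n)) * indicator A ((path_shift ^^ n) \<omega>) - ?c (restr \<omega> (Suc n)) * measure (markov_measure K (\<omega> n)) A) \<partial>markov_measure K a)"
    by (intro Bochner_Integration.integral_cong) (auto simp: f1_def algebra_simps)
  also have "\<dots> = 0"
    using int[of f1] int[of ?c] f1 eq[of f1] eq[of ?c] by (simp add: Bochner_Integration.integral_diff)
  finally show ?thesis .
qed

end

section \<open>Regeneration at the visits to a state\<close>

lemma (in prob_space) distr_iterates_PiM:
  assumes S[measurable]: "S \<in> M \<rightarrow>\<^sub>M M" and b[measurable]: "b \<in> M \<rightarrow>\<^sub>M N"
    and indep: "\<And>A B. A \<in> sets N \<Longrightarrow> B \<in> sets M \<Longrightarrow>
      emeasure M {x \<in> space M. b x \<in> A \<and> S x \<in> B} = emeasure M {x \<in> space M. b x \<in> A} * emeasure M B"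
  shows "distr M (\<Pi>\<^sub>M k\<in>(UNIV::nat set). N) (\<lambda>x k. b ((S ^^ k) x)) = (\<Pi>\<^sub>M k\<in>(UNIV::nat set). distr M N b)"
proof -
  have space_1: "emeasure M (space M) = 1" by (rule emeasure_space_1)
  interpret R: prob_space "distr M N b" by (rule prob_space_distr) measurable
  interpret PP: product_prob_space "\<lambda>_. distr M N b" "UNIV :: nat set" by unfold_locales
  have Sn[measurable]: "S ^^ n \<in> M \<rightarrow>\<^sub>M M" for n
    by (rule measurable_compose_n) measurable
  have block: "emeasure M {x \<in> space M. \<forall>k<n. b ((S ^^ k) x) \<in> A k} = (\<Prod>k<n. emeasure (distr M N b) (A k))"
    if "\<And>k. A k \<in> sets N" for n A
    using that
  proof (induction n arbitrary: A)
    case 0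
    then show ?case by (simp add: space_1)
  next
    case (Suc n)
    note A[measurable] = Suc.prems
    have "{x \<in> space M. \<forall>k\<in>{..<n}. b ((S ^^ k) x) \<in> A (Suc k)} \<in> sets M"
      by measurable
    then have m: "{x \<in> space M. \<forall>k<n. b ((S ^^ k) x) \<in> A (Suc k)} \<in> sets M"
      by (simp add: lessThan_def)
    have "{x \<in> space M. \<forall>k<Suc n. b ((S ^^ k) x) \<in> A k} =
        {x \<in> space M. b x \<in> A 0 \<and> S x \<in> {x \<in> space M. \<forall>k<n. b ((S ^^ k) x) \<in> A (Suc k)}}"
      using measurable_space[OF S] by (auto simp: All_less_Suc2 funpow_swap1)
    also have "emeasure M \<dots> = emeasure M {x \<in> space M. b x \<in> A 0} * (\<Prod>k<n. emeasure (distr M N b) (A (Suc k)))"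
      by (subst indep[OF A m]) (simp add: Suc.IH[OF A])
    also have "emeasure M {x \<in> space M. b x \<in> A 0} = emeasure (distr M N b) (A 0)"
      by (subst emeasure_distr) (auto intro!: arg_cong[where f = "emeasure M"])
    also have "\<dots> * (\<Prod>k<n. emeasure (distr M N b) (A (Suc k))) = (\<Prod>k<Suc n. emeasure (distr M N b) (A k))"
      by (simp only: prod.lessThan_Suc_shift)
    finally show ?case .
  qed
  have meas: "(\<lambda>x k. b ((S ^^ k) x)) \<in> M \<rightarrow>\<^sub>M (\<Pi>\<^sub>M k\<in>UNIV. N)"
    by (intro measurable_PiM_single') (auto simp: PiE_UNIV_domain intro!: measurable_space[OF b] measurable_space[OF Sn])
  show ?thesis
  proof (rule PP.PiM_eq)
    show "sets (distr M (\<Pi>\<^sub>M k\<in>UNIV. N) (\<lambda>x k. b ((S ^^ k) x))) = sets (\<Pi>\<^sub>M k\<in>UNIV. distr M N b)"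
      by (simp cong: sets_PiM_cong)
    fix J :: "nat set" and F assume J: "finite J" "J \<subseteq> UNIV" and F: "\<And>j. j \<in> J \<Longrightarrow> F j \<in> sets (distr M N b)"
    define A where "A k = (if k \<in> J then F k else space N)" for k
    have A: "A k \<in> sets N" for k using F by (simp add: A_def)
    define n where "n = Suc (Max (insert 0 J))"
    have n: "k < n" if "k \<in> J" for k using J(1) that by (simp add: n_def less_Suc_eq_le)
    let ?E = "prod_emb UNIV (\<lambda>_. distr M N b) J (Pi\<^sub>E J F)"
    have Esets: "?E \<in> sets (\<Pi>\<^sub>M k\<in>UNIV. N)"
    proof -
      have "?E \<in> sets (\<Pi>\<^sub>M k\<in>UNIV. distr M N b)" using J F by (intro sets_PiM_I) auto
      also have "\<dots> = sets (\<Pi>\<^sub>M k\<in>UNIV. N)" by (intro sets_PiM_cong) auto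
      finally show ?thesis .
    qed
    have "(\<lambda>x k. b ((S ^^ k) x)) -` ?E \<inter> space M = {x \<in> space M. \<forall>k<n. b ((S ^^ k) x) \<in> A k}"
      using n measurable_space[OF measurable_compose[OF Sn b]]
      by (auto simp: prod_emb_def A_def PiE_iff PiE_UNIV_domain split: if_splits)
    then have "emeasure (distr M (\<Pi>\<^sub>M k\<in>UNIV. N) (\<lambda>x k. b ((S ^^ k) x))) ?E = (\<Prod>k<n. emeasure (distr M N b) (A k))"
      by (simp add: emeasure_distr[OF meas Esets] block[OF A])
    also have "\<dots> = (\<Prod>k\<in>J. emeasure (distr M N b) (A k))"
      using n R.emeasure_space_1 by (intro prod.mono_neutral_right) (auto simp: A_def)
    also have "\<dots> = (\<Prod>k\<in>J. emeasure (distr M N b) (F k))"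
      by (intro prod.cong) (auto simp: A_def)
    finally show "emeasure (distr M (\<Pi>\<^sub>M k\<in>UNIV. N) (\<lambda>x k. b ((S ^^ k) x))) ?E = (\<Prod>k\<in>J. emeasure (distr M N b) (F k))" .
  qed
qed

lemma return_time_eq:
  "return_time e \<omega> = (if \<exists>n\<ge>1. \<omega> n = e then enat (LEAST n. 1 \<le> n \<and> \<omega> n = e) else \<infinity>)"
proof (cases "\<exists>n\<ge>1. \<omega> n = e")
  case True
  then obtain n0 where n0: "1 \<le> n0 \<and> \<omega> n0 = e" by blast
  let ?n = "LEAST n. 1 \<le> n \<and> \<omega> n = e"
  have n: "1 \<le> ?n \<and> \<omega> ?n = e" by (rule LeastI[of "\<lambda>n. 1 \<le> n \<and> \<omega> n = e", OF n0])
  have "return_time e \<omega> = enat ?n"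
    unfolding return_time_def
  proof (rule antisym)
    show "(INF n\<in>{n. 1 \<le> n \<and> \<omega> n = e}. enat n) \<le> enat ?n"
      by (rule INF_lower) (use n in simp)
    show "enat ?n \<le> (INF n\<in>{n. 1 \<le> n \<and> \<omega> n = e}. enat n)"
      by (rule INF_greatest) (auto intro: Least_le)
  qed
  with True show ?thesis by simp
next
  case False
  then have "{n. 1 \<le> n \<and> \<omega> n = e} = {}" by auto
  then have "return_time e \<omega> = Inf {}" unfolding return_time_def by (simp only: image_empty)
  with False show ?thesis by (simp add: top_enat_def)
qed

lemma return_time_eq_enat_iff:
  "return_time e \<omega> = enat n \<longleftrightarrow> 1 \<le> n \<and> \<omega> n = e \<and> (\<forall>i. 1 \<le> i \<and> i < n \<longrightarrow> \<omega> i \<noteq> e)"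
proof
  assume "return_time e \<omega> = enat n"
  then have ex: "\<exists>n\<ge>1. \<omega> n = e" and n: "n = (LEAST n. 1 \<le> n \<and> \<omega> n = e)"
    by (auto simp: return_time_eq split: if_splits)
  have "1 \<le> n \<and> \<omega> n = e"
    using LeastI_ex[of "\<lambda>n. 1 \<le> n \<and> \<omega> n = e"] ex by (simp only: n)
  moreover have "\<omega> i \<noteq> e" if "1 \<le> i" "i < n" for i
    using not_less_Least[of i "\<lambda>n. 1 \<le> n \<and> \<omega> n = e"] that by (simp only: n[symmetric]) blast
  ultimately show "1 \<le> n \<and> \<omega> n = e \<and> (\<forall>i. 1 \<le> i \<and> i < n \<longrightarrow> \<omega> i \<noteq> e)" by blast
next
  assume n: "1 \<le> n \<and> \<omega> n = e \<and> (\<forall>i. 1 \<le> i \<and> i < n \<longrightarrow> \<omega> i \<noteq> e)"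
  then have "(LEAST n. 1 \<le> n \<and> \<omega> n = e) = n"
    by (intro Least_equality) (auto simp: not_less[symmetric])
  with n show "return_time e \<omega> = enat n" by (auto simp: return_time_eq)
qed

lemma return_time_eq_infinity_iff: "return_time e \<omega> = \<infinity> \<longleftrightarrow> (\<forall>n\<ge>1. \<omega> n \<noteq> e)"
  by (auto simp: return_time_eq)

lemma measurable_return_time[measurable]:
  fixes e :: "'e::{countable, discrete_topology, second_countable_topology}"
  shows "return_time e \<in> borel \<rightarrow>\<^sub>M count_space UNIV"
proof (subst measurable_count_space_eq2_countable)
  have fin: "{\<omega>. return_time e \<omega> = enat n} \<in> sets borel" for n
    by (rule finitely_determined_in_sets[of "Suc n"]) (auto simp: return_time_eq_enat_iff)
  have "return_time e \<omega> = \<infinity> \<longleftrightarrow> (\<forall>n. return_time e \<omega> \<noteq> enat n)" for \<omega>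
    by (cases "return_time e \<omega>") auto
  then have "{\<omega>. return_time e \<omega> = \<infinity>} = UNIV - (\<Union>n. {\<omega>. return_time e \<omega> = enat n})"
    by auto
  also have "\<dots> \<in> sets borel"
    using fin sets.compl_sets[of "\<Union>n. {\<omega>. return_time e \<omega> = enat n}" borel] by auto
  finally have "{\<omega>. return_time e \<omega> = t} \<in> sets borel" for t
    using fin by (cases t) auto
  then show "return_time e \<in> space borel \<rightarrow> UNIV \<and> (\<forall>t\<in>UNIV. return_time e -` {t} \<inter> space borel \<in> sets borel)"
    by (simp add: vimage_def)
qed

text \<open>On paths that do not return, \<open>excursion_length\<close> has the junk value \<^term>\<open>the_enat \<infinity>\<close>.\<close>

definition excursion_length :: "'e \<Rightarrow> (nat \<Rightarrow> 'e) \<Rightarrow> nat" where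
  "excursion_length e \<omega> = the_enat (return_time e \<omega>)"

definition renewal_shift :: "'e \<Rightarrow> (nat \<Rightarrow> 'e) \<Rightarrow> nat \<Rightarrow> 'e" where
  "renewal_shift e \<omega> = (path_shift ^^ excursion_length e \<omega>) \<omega>"

lemma measurable_excursion_length[measurable]:
  fixes e :: "'e::{countable, discrete_topology, second_countable_topology}"
  shows "excursion_length e \<in> borel \<rightarrow>\<^sub>M count_space UNIV"
  unfolding excursion_length_def by measurable

lemma measurable_renewal_shift[measurable]:
  fixes e :: "'e::{countable, discrete_topology, second_countable_topology}"
  shows "renewal_shift e \<in> borel \<rightarrow>\<^sub>M borel"
  unfolding renewal_shift_def
  by (rule measurable_compose_countable[OF measurable_funpow_path_shift measurable_excursion_length])

lemma measurable_restr_excursion[measurable]: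
  fixes e :: "'e::{countable, discrete_topology, second_countable_topology}"
  shows "(\<lambda>\<omega>. restr \<omega> (excursion_length e \<omega>)) \<in> borel \<rightarrow>\<^sub>M count_space UNIV"
    "(\<lambda>\<omega>. restr \<omega> (Suc (excursion_length e \<omega>))) \<in> borel \<rightarrow>\<^sub>M count_space UNIV"
  by (rule measurable_compose_countable[OF measurable_restr measurable_excursion_length])+

context
  fixes K :: "'e::{countable, discrete_topology, second_countable_topology} \<Rightarrow> 'e pmf" and e :: 'e
  assumes finite_return: "AE \<omega> in markov_measure K e. return_time e \<omega> \<noteq> \<infinity>"
begin

lemma nn_integral_regeneration:
  fixes F :: "'e list \<Rightarrow> ennreal"
  assumes A[measurable]: "A \<in> sets borel"
  shows "(\<integral>\<^sup>+\<omega>. F (restr \<omega> (excursion_length e \<omega>)) * indicator A (renewal_shift e \<omega>) \<partial>markov_measure K e) =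
    (\<integral>\<^sup>+\<omega>. F (restr \<omega> (excursion_length e \<omega>)) \<partial>markov_measure K e) * emeasure (markov_measure K e) A"
proof -
  interpret prob_space "markov_measure K e" by (rule prob_space_markov)
  define good where "good u \<longleftrightarrow> (\<exists>n\<ge>1. length u = Suc n \<and> u ! n = e \<and> (\<forall>i. 1 \<le> i \<and> i < n \<longrightarrow> u ! i \<noteq> e))" for u
  define c where "c u = (if good u then F (butlast u) * emeasure (markov_measure K e) {\<omega>. \<forall>i\<le>length u - 1. \<omega> i = u ! i} else 0)"
    for u
  have part: "(\<integral>\<^sup>+\<omega>. F (restr \<omega> (excursion_length e \<omega>)) * indicator A (renewal_shift e \<omega>)
      * indicator {u} (restr \<omega> (Suc (excursion_length e \<omega>))) \<partial>markov_measure K e) = c u * emeasure (markov_measure K e) A"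
    if [measurable]: "A \<in> sets borel" for A u
  proof (cases "good u")
    case True
    then obtain n where n: "1 \<le> n" "length u = Suc n" "u ! n = e" "\<And>i. 1 \<le> i \<Longrightarrow> i < n \<Longrightarrow> u ! i \<noteq> e"
      by (auto simp: good_def)
    let ?D = "{\<omega>. (\<forall>i\<le>n. \<omega> i = u ! i) \<and> (path_shift ^^ n) \<omega> \<in> A}"
    have "?D = {\<omega>. \<forall>i\<le>n. \<omega> i = u ! i} \<inter> ((path_shift ^^ n) -` A \<inter> space borel)" by auto
    also have "\<dots> \<in> sets borel" by (intro sets.Int sets_cylinder measurable_sets[OF measurable_funpow_path_shift that])
    finally have D[measurable]: "?D \<in> sets borel" .
    have "(\<integral>\<^sup>+\<omega>. F (restr \<omega> (excursion_length e \<omega>)) * indicator A (renewal_shift e \<omega>)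
      * indicator {u} (restr \<omega> (Suc (excursion_length e \<omega>))) \<partial>markov_measure K e) =
      (\<integral>\<^sup>+\<omega>. F (butlast u) * indicator ?D \<omega> \<partial>markov_measure K e)"
    proof (rule nn_integral_cong_AE)
      show "AE \<omega> in markov_measure K e. F (restr \<omega> (excursion_length e \<omega>)) * indicator A (renewal_shift e \<omega>)
        * indicator {u} (restr \<omega> (Suc (excursion_length e \<omega>))) = F (butlast u) * indicator ?D \<omega>"
        using finite_return
      proof eventually_elim
        case (elim \<omega>)
        then obtain t where t: "return_time e \<omega> = enat t" by auto
        then have el: "excursion_length e \<omega> = t" by (simp add: excursion_length_def)
        show ?case
        proof (cases "\<forall>i\<le>n. \<omega> i = u ! i")
          case True
          then have "return_time e \<omega> = enat n"
            using n by (auto simp: return_time_eq_enat_iff)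
          then have "t = n" using t by simp
          moreover have "restr \<omega> (Suc n) = u"
            using True n(2) by (auto simp: restr_eq_iff less_Suc_eq_le)
          moreover have "restr \<omega> n = butlast u"
            using True n(2) by (auto simp: restr_eq_iff nth_butlast)
          ultimately show ?thesis
            using True by (simp add: el renewal_shift_def indicator_def)
        next
          case False
          have "restr \<omega> (Suc t) \<noteq> u"
          proof
            assume "restr \<omega> (Suc t) = u"
            then have "length u = Suc t" "\<forall>i<Suc t. \<omega> i = u ! i" by (auto simp: restr_eq_iff)
            with False n(2) show False by auto
          qed
          with False show ?thesis by (simp add: el)
        qed
      qed
    qed
    also have "\<dots> = c u * emeasure (markov_measure K e) A"
      using True n by (simp add: nn_integral_cmult_indicator emeasure_markov_cylinder_shift c_def mult_ac)
    finally show ?thesis .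
  next
    case False
    have "(\<integral>\<^sup>+\<omega>. F (restr \<omega> (excursion_length e \<omega>)) * indicator A (renewal_shift e \<omega>)
      * indicator {u} (restr \<omega> (Suc (excursion_length e \<omega>))) \<partial>markov_measure K e) =
      (\<integral>\<^sup>+\<omega>. 0 \<partial>markov_measure K e)"
    proof (rule nn_integral_cong_AE)
      show "AE \<omega> in markov_measure K e. F (restr \<omega> (excursion_length e \<omega>)) * indicator A (renewal_shift e \<omega>)
        * indicator {u} (restr \<omega> (Suc (excursion_length e \<omega>))) = 0"
        using finite_return
      proof eventually_elim
        case (elim \<omega>)
        then obtain t where t: "return_time e \<omega> = enat t" by auto
        then have el: "excursion_length e \<omega> = t" by (simp add: excursion_length_def)
        have "restr \<omega> (Suc t) \<noteq> u"
        proof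
          assume u: "restr \<omega> (Suc t) = u"
          then have "length u = Suc t" "\<forall>i<Suc t. \<omega> i = u ! i" by (auto simp: restr_eq_iff)
          then have "good u" using t by (auto simp: good_def return_time_eq_enat_iff intro!: exI[of _ t])
          with False show False ..
        qed
        then show ?case by (simp add: el)
      qed
    qed
    then show ?thesis using False by (simp add: c_def)
  qed
  have all: "(\<integral>\<^sup>+\<omega>. F (restr \<omega> (excursion_length e \<omega>)) * indicator A (renewal_shift e \<omega>) \<partial>markov_measure K e) =
      (\<integral>\<^sup>+u. c u \<partial>count_space UNIV) * emeasure (markov_measure K e) A" if [measurable]: "A \<in> sets borel" for A
  proof -
    have "(\<integral>\<^sup>+\<omega>. F (restr \<omega> (excursion_length e \<omega>)) * indicator A (renewal_shift e \<omega>) \<partial>markov_measure K e) =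
      (\<integral>\<^sup>+u. (\<integral>\<^sup>+\<omega>. F (restr \<omega> (excursion_length e \<omega>)) * indicator A (renewal_shift e \<omega>)
      * indicator {u} (restr \<omega> (Suc (excursion_length e \<omega>))) \<partial>markov_measure K e) \<partial>count_space UNIV)"
      by (rule nn_integral_countable_partition) measurable
    then show ?thesis
      by (simp add: part[OF that] nn_integral_multc)
  qed
  show ?thesis
    using all[OF A] all[of UNIV] emeasure_space_1 by simp
qed

lemma emeasure_regeneration:
  assumes A[measurable]: "A \<in> sets borel"
  shows "emeasure (markov_measure K e) {\<omega>. restr \<omega> (excursion_length e \<omega>) \<in> V \<and> renewal_shift e \<omega> \<in> A} =
    emeasure (markov_measure K e) {\<omega>. restr \<omega> (excursion_length e \<omega>) \<in> V} * emeasure (markov_measure K e) A"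
proof -
  have "{\<omega> \<in> space (borel :: (nat \<Rightarrow> 'e) measure). restr \<omega> (excursion_length e \<omega>) \<in> V \<and> renewal_shift e \<omega> \<in> A} \<in> sets borel"
    "{\<omega> \<in> space (borel :: (nat \<Rightarrow> 'e) measure). restr \<omega> (excursion_length e \<omega>) \<in> V} \<in> sets borel"
    by measurable
  then have m: "{\<omega>. restr \<omega> (excursion_length e \<omega>) \<in> V \<and> renewal_shift e \<omega> \<in> A} \<in> sets borel"
    "{\<omega>. restr \<omega> (excursion_length e \<omega>) \<in> V} \<in> sets borel" by simp_all
  have "(\<integral>\<^sup>+\<omega>. indicator V (restr \<omega> (excursion_length e \<omega>)) * indicator A (renewal_shift e \<omega>) \<partial>markov_measure K e) =
    (\<integral>\<^sup>+\<omega>. indicator {\<omega>. restr \<omega> (excursion_length e \<omega>) \<in> V \<and> renewal_shift e \<omega> \<in> A} \<omega> \<partial>markov_measure K e)"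
    by (intro nn_integral_cong) (auto simp: indicator_def)
  moreover have "(\<integral>\<^sup>+\<omega>. indicator V (restr \<omega> (excursion_length e \<omega>)) \<partial>markov_measure K e) =
    (\<integral>\<^sup>+\<omega>. indicator {\<omega>. restr \<omega> (excursion_length e \<omega>) \<in> V} \<omega> \<partial>markov_measure K e)"
    by (intro nn_integral_cong) (auto simp: indicator_def)
  ultimately show ?thesis
    using nn_integral_regeneration[OF A, of "indicator V"] m by simp
qed

lemma distr_renewal_shift: "distr (markov_measure K e) (markov_measure K e) (renewal_shift e) = markov_measure K e"
proof (rule measure_eqI)
  interpret prob_space "markov_measure K e" by (rule prob_space_markov)
  fix A assume "A \<in> sets (distr (markov_measure K e) (markov_measure K e) (renewal_shift e))"
  then have A: "A \<in> sets borel" by simp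
  have "renewal_shift e \<in> markov_measure K e \<rightarrow>\<^sub>M markov_measure K e" by measurable
  then show "emeasure (distr (markov_measure K e) (markov_measure K e) (renewal_shift e)) A = emeasure (markov_measure K e) A"
    using A emeasure_regeneration[OF A, of UNIV] emeasure_space_1 by (subst emeasure_distr) (auto simp: vimage_def)
qed simp

lemma AE_iterates_return:
  "AE \<omega> in markov_measure K e. \<forall>k. return_time e ((renewal_shift e ^^ k) \<omega>) \<noteq> \<infinity>"
proof (subst AE_all_countable, rule allI)
  fix k
  have pres: "distr (markov_measure K e) (markov_measure K e) (renewal_shift e ^^ k) = markov_measure K e"
  proof (induction k)
    case (Suc k)
    have m: "renewal_shift e \<in> markov_measure K e \<rightarrow>\<^sub>M markov_measure K e" by measurable
    then have mk: "renewal_shift e ^^ k \<in> markov_measure K e \<rightarrow>\<^sub>M markov_measure K e" by (rule measurable_compose_n)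
    have "distr (markov_measure K e) (markov_measure K e) (renewal_shift e ^^ Suc k) =
      distr (distr (markov_measure K e) (markov_measure K e) (renewal_shift e ^^ k)) (markov_measure K e) (renewal_shift e)"
      by (subst distr_distr[OF m mk]) simp
    then show ?case unfolding Suc.IH distr_renewal_shift .
  qed (simp add: distr_id2)
  have m: "renewal_shift e \<in> markov_measure K e \<rightarrow>\<^sub>M markov_measure K e" by measurable
  show "AE \<omega> in markov_measure K e. return_time e ((renewal_shift e ^^ k) \<omega>) \<noteq> \<infinity>"
    by (rule AE_distrD[OF measurable_compose_n[OF m]]) (unfold pres, rule finite_return)
qed

lemma distr_renewal_increments:
  fixes h :: "'e list \<Rightarrow> 'b" and N :: "'b measure"
  assumes h: "\<And>v. h v \<in> space N"
  defines "b \<equiv> \<lambda>\<omega>. h (restr \<omega> (excursion_length e \<omega>))"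
  shows "distr (markov_measure K e) (\<Pi>\<^sub>M k\<in>(UNIV::nat set). N) (\<lambda>\<omega> k. b ((renewal_shift e ^^ k) \<omega>)) =
    (\<Pi>\<^sub>M k\<in>(UNIV::nat set). distr (markov_measure K e) N b)"
proof -
  interpret prob_space "markov_measure K e" by (rule prob_space_markov)
  show ?thesis
  proof (rule distr_iterates_PiM)
    show "renewal_shift e \<in> markov_measure K e \<rightarrow>\<^sub>M markov_measure K e" by measurable
    have "h \<in> count_space UNIV \<rightarrow>\<^sub>M N" using h by auto
    then show "b \<in> markov_measure K e \<rightarrow>\<^sub>M N"
      unfolding b_def by measurable
    fix A B assume "B \<in> sets (markov_measure K e)"
    then show "emeasure (markov_measure K e) {\<omega> \<in> space (markov_measure K e). b \<omega> \<in> A \<and> renewal_shift e \<omega> \<in> B} =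
      emeasure (markov_measure K e) {\<omega> \<in> space (markov_measure K e). b \<omega> \<in> A} * emeasure (markov_measure K e) B"
      using emeasure_regeneration[of B "h -` A"] by (simp add: b_def)
  qed
qed

lemma AE_sum_excursion_length_le:
  assumes fin: "(\<integral>\<^sup>+\<omega>. ennreal_of_enat (return_time e \<omega>) \<partial>markov_measure K e) < \<infinity>"
    and c: "(\<integral>\<^sup>+\<omega>. ennreal_of_enat (return_time e \<omega>) \<partial>markov_measure K e) < ennreal c"
  shows "AE \<omega> in markov_measure K e. \<forall>\<^sub>F n in sequentially.
    (\<Sum>k<n. real (excursion_length e ((renewal_shift e ^^ k) \<omega>))) \<le> c * real n"
proof -
  interpret prob_space "markov_measure K e" by (rule prob_space_markov)
  define X where "X \<omega> = real (excursion_length e \<omega>)" for \<omega>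
  have Xm[measurable]: "X \<in> borel_measurable (markov_measure K e)"
    unfolding X_def by measurable
  have eq: "(\<integral>\<^sup>+\<omega>. ennreal (X \<omega>) \<partial>markov_measure K e) = (\<integral>\<^sup>+\<omega>. ennreal_of_enat (return_time e \<omega>) \<partial>markov_measure K e)"
  proof (rule nn_integral_cong_AE)
    show "AE \<omega> in markov_measure K e. ennreal (X \<omega>) = ennreal_of_enat (return_time e \<omega>)"
      using finite_return
    proof eventually_elim
      case (elim \<omega>)
      then obtain t where "return_time e \<omega> = enat t" by auto
      then show ?case by (simp add: X_def excursion_length_def ennreal_of_nat_eq_real_of_nat)
    qed
  qed
  have Xi: "integrable (markov_measure K e) X"
    by (rule integrableI_nonneg) (use eq fin in \<open>auto simp: X_def\<close>)
  have EX: "ennreal (expectation X) = (\<integral>\<^sup>+\<omega>. ennreal (X \<omega>) \<partial>markov_measure K e)"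
    by (rule nn_integral_eq_integral[symmetric, OF Xi]) (simp add: X_def)
  have "ennreal (expectation X) < ennreal c" using c EX eq by simp
  moreover have "0 \<le> expectation X" by (rule integral_nonneg_AE) (simp add: X_def)
  ultimately have "expectation X < c" by (simp add: ennreal_less_iff)
  then have "AE \<omega> in markov_measure K e. \<forall>\<^sub>F n in sequentially. (\<Sum>k<n. X ((renewal_shift e ^^ k) \<omega>)) \<le> c * real n"
  proof (intro eventually_sums_le_if_indep Xi distr_renewal_shift)
    show "renewal_shift e \<in> markov_measure K e \<rightarrow>\<^sub>M markov_measure K e" by measurable
    fix A assume "A \<in> sets (markov_measure K e)"
    then have A[measurable]: "A \<in> sets borel" by simp
    have i: "integrable (markov_measure K e) (\<lambda>\<omega>. X \<omega> * indicator A (renewal_shift e \<omega>))"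
      by (rule Bochner_Integration.integrable_bound[OF Xi]) (auto simp: indicator_def)
    have "ennreal (expectation (\<lambda>\<omega>. X \<omega> * indicator A (renewal_shift e \<omega>))) =
        (\<integral>\<^sup>+\<omega>. ennreal (X \<omega> * indicator A (renewal_shift e \<omega>)) \<partial>markov_measure K e)"
      by (rule nn_integral_eq_integral[symmetric, OF i]) (simp add: X_def)
    also have "\<dots> = (\<integral>\<^sup>+\<omega>. ennreal (real (length (restr \<omega> (excursion_length e \<omega>)))) * indicator A (renewal_shift e \<omega>) \<partial>markov_measure K e)"
      by (intro nn_integral_cong) (simp add: X_def indicator_def)
    also have "\<dots> = (\<integral>\<^sup>+\<omega>. ennreal (real (length (restr \<omega> (excursion_length e \<omega>)))) \<partial>markov_measure K e) * emeasure (markov_measure K e) A"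
      by (rule nn_integral_regeneration[OF A])
    also have "\<dots> = ennreal (expectation X) * ennreal (prob A)"
      unfolding EX by (simp add: X_def emeasure_eq_measure)
    also have "\<dots> = ennreal (expectation X * prob A)"
      using \<open>0 \<le> expectation X\<close> by (simp add: ennreal_mult)
    finally show "expectation (\<lambda>\<omega>. X \<omega> * indicator A (renewal_shift e \<omega>)) = expectation X * prob A"
      using \<open>0 \<le> expectation X\<close> by (subst (asm) ennreal_inj) (auto simp: X_def intro!: integral_nonneg_AE)
  qed
  then show ?thesis by (simp add: X_def)
qed

end

lemma lower_mean_shift:
  assumes "lower_mean a L" "\<And>k. a k \<le> 1"
  shows "lower_mean (\<lambda>k. if k < s then 0 else a (k - s)) L"
  unfolding lower_mean_def
proof (intro allI impI)
  fix c assume "c < L"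
  then obtain d where d: "c < d" "d < L" using dense by blast
  have "(\<lambda>n. real s / real n) \<longlonglongrightarrow> 0" by (rule lim_const_over_n)
  then have "\<forall>\<^sub>F n in sequentially. real s / real n < d - c"
    using d by (intro order_tendstoD) auto
  moreover have "\<forall>\<^sub>F n in sequentially. d < (\<Sum>k<n. a k) / real n"
    using assms(1) d by (simp add: lower_mean_def)
  ultimately show "\<forall>\<^sub>F n in sequentially. c < (\<Sum>k<n. if k < s then 0 else a (k - s)) / real n"
    using eventually_ge_at_top[of s]
  proof eventually_elim
    case (elim n)
    have "(\<Sum>k<n. if k < s then 0 else a (k - s)) = (\<Sum>k\<in>{s..<n}. a (k - s))"
      by (rule sum.mono_neutral_cong_right) auto
    also have "\<dots> = (\<Sum>k<n - s. a k)"
      using elim(3) by (intro sum.reindex_bij_witness[of _ "\<lambda>k. k + s" "\<lambda>k. k - s"]) auto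
    finally have eq: "(\<Sum>k<n. if k < s then 0 else a (k - s)) = (\<Sum>k<n - s. a k)" .
    have "(\<Sum>k<n. a k) = (\<Sum>k<n - s. a k) + (\<Sum>k\<in>{n - s..<n}. a k)"
      by (metis atLeast0LessThan diff_le_self le0 sum.atLeastLessThan_concat)
    also have "(\<Sum>k\<in>{n - s..<n}. a k) \<le> (\<Sum>k\<in>{n - s..<n}. 1)"
      using assms(2) by (intro sum_mono)
    also have "\<dots> = real s" using elim(3) by simp
    finally have "(\<Sum>k<n. a k) / real n \<le> ((\<Sum>k<n - s. a k) + real s) / real n"
      by (intro divide_right_mono) auto
    then show ?case using elim(1,2) unfolding eq by (simp add: add_divide_distrib)
  qed
qed

lemma lower_mean_subsequence:
  assumes t: "strict_mono t" and a: "\<And>k. 0 \<le> a k" and c: "0 < c"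
    and lim: "(\<lambda>n. (\<Sum>i<n. a (t i)) / real n) \<longlonglongrightarrow> L"
    and le: "\<forall>\<^sub>F n in sequentially. real (t n) \<le> c * real n"
  shows "lower_mean a (L / c)"
  unfolding lower_mean_def
proof (intro allI impI)
  fix c' assume c': "c' < L / c"
  define J where "J n = nat \<lfloor>real n / c\<rfloor>" for n
  have J_le: "real (J n) \<le> real n / c" for n
    using c by (simp add: J_def)
  have J_ge: "real n / c - 1 \<le> real (J n)" for n
    using c unfolding J_def by (smt (verit) divide_nonneg_pos floor_le_iff of_nat_0_le_iff of_nat_nat real_of_int_floor_add_one_gt zero_le_floor)
  have "filterlim (\<lambda>n. real n / c - 1) at_top sequentially"
    using c by real_asymp
  then have "filterlim (\<lambda>n. real (J n)) at_top sequentially"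
    by (rule filterlim_at_top_mono) (simp add: J_ge)
  then have J_top: "filterlim J sequentially sequentially"
    by (simp add: filterlim_sequentially_iff_filterlim_real)
  have "(\<lambda>n. real (J n) / real n) \<longlonglongrightarrow> 1 / c"
  proof (rule tendsto_sandwich)
    show "\<forall>\<^sub>F n in sequentially. 1 / c - 1 / real n \<le> real (J n) / real n"
      using eventually_gt_at_top[of 0]
    proof eventually_elim
      case (elim n)
      have "(real n / c - 1) / real n \<le> real (J n) / real n"
        by (intro divide_right_mono J_ge) simp
      then show ?case using elim by (simp add: diff_divide_distrib)
    qed
    show "\<forall>\<^sub>F n in sequentially. real (J n) / real n \<le> 1 / c"
      using eventually_gt_at_top[of 0]
    proof eventually_elim
      case (elim n)
      have "real (J n) / real n \<le> (real n / c) / real n"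
        by (intro divide_right_mono J_le) simp
      then show ?case using elim by simp
    qed
    have "(\<lambda>n. 1 / c - 1 / real n) \<longlonglongrightarrow> 1 / c - 0"
      by (intro tendsto_diff tendsto_const lim_1_over_n)
    then show "(\<lambda>n. 1 / c - 1 / real n) \<longlonglongrightarrow> 1 / c" by simp
  qed simp
  with filterlim_compose[OF lim J_top]
  have "(\<lambda>n. (\<Sum>i<J n. a (t i)) / real (J n) * (real (J n) / real n)) \<longlonglongrightarrow> L * (1 / c)"
    by (rule tendsto_mult)
  then have "\<forall>\<^sub>F n in sequentially. c' < (\<Sum>i<J n. a (t i)) / real (J n) * (real (J n) / real n)"
    using c' by (intro order_tendstoD) auto
  moreover have "\<forall>\<^sub>F n in sequentially. real (t (J n)) \<le> c * real (J n)"
    using J_top le by (rule eventually_compose_filterlim[rotated])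
  ultimately show "\<forall>\<^sub>F n in sequentially. c' < (\<Sum>k<n. a k) / real n"
  proof eventually_elim
    case (elim n)
    have "c * real (J n) \<le> real n" using J_le[of n] c by (simp add: field_simps)
    with elim(2) have "t (J n) \<le> n" by linarith
    then have sub: "t ` {..<J n} \<subseteq> {..<n}"
      using t by (auto simp: strict_mono_less intro: less_le_trans[of _ "t (J n)"])
    have "(\<Sum>i<J n. a (t i)) = (\<Sum>k\<in>t ` {..<J n}. a k)"
      using t by (subst sum.reindex) (auto intro: inj_on_subset[OF strict_mono_imp_inj_on])
    also have "\<dots> \<le> (\<Sum>k<n. a k)"
      using sub a by (intro sum_mono2) auto
    finally have le: "(\<Sum>i<J n. a (t i)) / real n \<le> (\<Sum>k<n. a k) / real n"
      by (intro divide_right_mono) auto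
    have eq: "(\<Sum>i<J n. a (t i)) / real (J n) * (real (J n) / real n) = (\<Sum>i<J n. a (t i)) / real n"
      by (cases "J n = 0") auto
    show ?case using elim(1)[unfolded eq] le by (rule less_le_trans)
  qed
qed

lemma restr_add: "restr \<omega> (m + n) = restr \<omega> m @ restr ((path_shift ^^ m) \<omega>) n"
  by (auto simp: restr_eq_iff nth_append funpow_path_shift)

definition visit_time :: "'e \<Rightarrow> (nat \<Rightarrow> 'e) \<Rightarrow> nat \<Rightarrow> nat" where
  "visit_time e \<omega> n = (\<Sum>k<n. excursion_length e ((renewal_shift e ^^ k) \<omega>))"

lemma funpow_renewal_shift: "(renewal_shift e ^^ n) \<omega> = (path_shift ^^ visit_time e \<omega> n) \<omega>"
proof (induction n)
  case (Suc n)
  have "(renewal_shift e ^^ Suc n) \<omega> =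
      (path_shift ^^ excursion_length e ((renewal_shift e ^^ n) \<omega>)) ((renewal_shift e ^^ n) \<omega>)"
    by (simp add: renewal_shift_def)
  also have "\<dots> = (path_shift ^^ visit_time e \<omega> (Suc n)) \<omega>"
    unfolding visit_time_def sum.lessThan_Suc add.commute[of "sum _ _"] funpow_add comp_apply
    unfolding Suc.IH[unfolded visit_time_def] ..
  finally show ?case .
qed (simp add: visit_time_def)

lemma visit_time:
  assumes ret: "\<forall>k. return_time e ((renewal_shift e ^^ k) \<omega>) \<noteq> \<infinity>" and start: "\<omega> 0 = e"
  shows "strict_mono (visit_time e \<omega>)" "\<omega> (visit_time e \<omega> n) = e"
proof -
  have el: "1 \<le> excursion_length e ((renewal_shift e ^^ k) \<omega>) \<and>
    ((renewal_shift e ^^ k) \<omega>) (excursion_length e ((renewal_shift e ^^ k) \<omega>)) = e" for k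
  proof -
    obtain t where t: "return_time e ((renewal_shift e ^^ k) \<omega>) = enat t" using ret by blast
    then have "excursion_length e ((renewal_shift e ^^ k) \<omega>) = t" by (simp add: excursion_length_def)
    with t show ?thesis by (simp add: return_time_eq_enat_iff)
  qed
  show "strict_mono (visit_time e \<omega>)"
    unfolding strict_mono_Suc_iff
  proof
    fix k show "visit_time e \<omega> k < visit_time e \<omega> (Suc k)"
      using el[of k] by (simp add: visit_time_def)
  qed
  show "\<omega> (visit_time e \<omega> n) = e"
  proof (cases n)
    case 0
    then show ?thesis using start by (simp add: visit_time_def)
  next
    case (Suc k)
    have "visit_time e \<omega> (Suc k) = visit_time e \<omega> k + excursion_length e ((renewal_shift e ^^ k) \<omega>)"
      by (simp add: visit_time_def)
    then show ?thesis
      using el[of k] unfolding Suc by (simp add: funpow_renewal_shift funpow_path_shift)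
  qed
qed

context
  fixes K :: "'e::{countable, discrete_topology, second_countable_topology} \<Rightarrow> 'e pmf"
begin

lemma AE_markov_mean_zero:
  fixes \<xi> :: "nat \<Rightarrow> (nat \<Rightarrow> 'e) \<Rightarrow> real"
  assumes adapted: "\<And>k \<omega> \<omega>'. (\<forall>i\<le>k. \<omega> i = \<omega>' i) \<Longrightarrow> \<xi> k \<omega> = \<xi> k \<omega>'"
    and bound: "\<And>k \<omega>. \<bar>\<xi> k \<omega>\<bar> \<le> 1"
    and B: "\<And>\<omega> \<omega>'. (\<forall>i<L. \<omega> i = \<omega>' i) \<Longrightarrow> \<omega> \<in> B \<longleftrightarrow> \<omega>' \<in> B"
  shows "AE \<omega> in markov_measure K a.
    (\<lambda>n. (\<Sum>k<n. \<xi> k \<omega> * (indicator B ((path_shift ^^ k) \<omega>) - measure (markov_measure K (\<omega> k)) B)) / real n) \<longlonglongrightarrow> 0"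
proof -
  interpret prob_space "markov_measure K a" by (rule prob_space_markov)
  have Bm: "B \<in> sets borel" using B by (rule finitely_determined_in_sets)
  define Z where "Z k \<omega> = \<xi> k \<omega> * (indicator B ((path_shift ^^ k) \<omega>) - measure (markov_measure K (\<omega> k)) B)" for k \<omega>
  have Z_det: "Z k \<omega> = Z k \<omega>'" if "\<forall>i<k + Suc L. \<omega> i = \<omega>' i" for k \<omega> \<omega>'
  proof -
    have "\<xi> k \<omega> = \<xi> k \<omega>'" using that by (intro adapted) auto
    moreover have "(path_shift ^^ k) \<omega> \<in> B \<longleftrightarrow> (path_shift ^^ k) \<omega>' \<in> B"
      using that by (intro B) (auto simp: funpow_path_shift)
    moreover have "\<omega> k = \<omega>' k" using that by auto
    ultimately show ?thesis by (simp add: Z_def indicator_def)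
  qed
  have Z_le: "\<bar>Z k \<omega>\<bar> \<le> 1" for k \<omega>
  proof -
    have "0 \<le> measure (markov_measure K (\<omega> k)) B" "measure (markov_measure K (\<omega> k)) B \<le> 1"
      using prob_space.prob_le_1[OF prob_space_markov] by auto
    then have "\<bar>indicator B ((path_shift ^^ k) \<omega>) - measure (markov_measure K (\<omega> k)) B\<bar> \<le> 1"
      by (auto simp: indicator_def)
    then show ?thesis
      unfolding Z_def abs_mult using bound[of k \<omega>] by (intro mult_le_one) auto
  qed
  have "AE \<omega> in markov_measure K a. (\<lambda>n. (\<Sum>k<n. Z k \<omega>) / real n) \<longlonglongrightarrow> 0"
  proof (rule finite_range_strong_law[where l = L])
    have "Z k \<in> borel_measurable borel" for k
      by (rule borel_measurable_if_finitely_determined[of "k + Suc L"]) (use Z_det in auto)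
    then show "Z k \<in> borel_measurable (markov_measure K a)" for k
      by simp
    show "\<bar>Z k \<omega>\<bar> \<le> 1" for k \<omega> by (rule Z_le)
    fix i k assume ik: "i + L < k"
    define f where "f v = Z i (nth v) * \<xi> k (nth v)" for v
    have f: "f (restr \<omega> (Suc k)) = Z i \<omega> * \<xi> k \<omega>" for \<omega>
      unfolding f_def using ik by (intro arg_cong2[where f = "(*)"] Z_det adapted) auto
    have fb: "\<bar>f v\<bar> \<le> 1" for v
      unfolding f_def abs_mult using Z_le bound by (intro mult_le_one) auto
    have "expectation (\<lambda>\<omega>. Z i \<omega> * Z k \<omega>) = expectation (\<lambda>\<omega>. f (restr \<omega> (Suc k)) *
        (indicator B ((path_shift ^^ k) \<omega>) - measure (markov_measure K (\<omega> k)) B))"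
      unfolding f by (simp add: Z_def mult.assoc)
    also have "\<dots> = 0"
      by (rule integral_markov_property_eq_0[OF Bm fb])
    finally show "expectation (\<lambda>\<omega>. Z i \<omega> * Z k \<omega>) = 0" .
  qed
  then show ?thesis by (simp add: Z_def)
qed

lemma sets_markov_init[measurable_cong, simp]: "sets (markov_measure_init K \<pi>) = sets borel"
proof -
  have "markov_measure K a \<in> space (subprob_algebra borel)" for a
    using prob_space_markov[of K a] by (auto simp: space_subprob_algebra intro: prob_space_imp_subprob_space)
  then show ?thesis
    unfolding markov_measure_init_def by (intro sets_bind) auto
qed

lemma space_markov_init[simp]: "space (markov_measure_init K \<pi>) = UNIV"
  using sets_eq_imp_space_eq[OF sets_markov_init] by simp

lemma emeasure_markov_init:
  "A \<in> sets borel \<Longrightarrow> emeasure (markov_measure_init K \<pi>) A = (\<integral>\<^sup>+a. emeasure (markov_measure K a) A \<partial>\<pi>)"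
  by (simp add: emeasure_markov_measure_init nn_integral_measure_pmf)

lemma prob_space_markov_init: "prob_space (markov_measure_init K \<pi>)"
proof
  have "emeasure (markov_measure K a) UNIV = 1" for a
    using prob_space.emeasure_space_1[OF prob_space_markov[of K a]] by simp
  then show "emeasure (markov_measure_init K \<pi>) (space (markov_measure_init K \<pi>)) = 1"
    by (simp add: emeasure_markov_init measure_pmf.emeasure_space_1[simplified])
qed

lemma emeasure_markov_init_start:
  assumes A: "A \<in> sets borel" and start: "\<And>\<omega>. \<omega> \<in> A \<Longrightarrow> \<omega> 0 = e"
  shows "emeasure (markov_measure_init K \<pi>) A = ennreal (pmf \<pi> e) * emeasure (markov_measure K e) A"
proof -
  have "emeasure (markov_measure K a) A = 0" if "a \<noteq> e" for a
  proof -
    have "AE \<omega> in markov_measure K a. \<not> \<omega> \<in> A"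
      using AE_markov_start by eventually_elim (use that start in auto)
    from emeasure_eq_0_AE[OF this] show ?thesis by simp
  qed
  then have "emeasure (markov_measure_init K \<pi>) A = (\<integral>\<^sup>+a. emeasure (markov_measure K e) A * indicator {e} a \<partial>\<pi>)"
    unfolding emeasure_markov_init[OF A] by (intro nn_integral_cong) (auto simp: indicator_def)
  also have "\<dots> = emeasure (markov_measure K e) A * emeasure \<pi> {e}"
    by (rule nn_integral_cmult_indicator) simp
  finally show ?thesis by (simp add: emeasure_pmf_single mult.commute)
qed

end

context
  fixes K :: "'e::{countable, discrete_topology, second_countable_topology} \<Rightarrow> 'e pmf" and e :: 'e
  assumes finite_return: "AE \<omega> in markov_measure K e. return_time e \<omega> \<noteq> \<infinity>"
    and irred: "irreducible_chain K"
begin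

lemma emeasure_markov_avoid:
  "emeasure (markov_measure K a) {\<omega>. \<forall>i. \<omega> i \<noteq> e} = 0"
proof (rule ccontr)
  let ?H = "{\<omega> :: nat \<Rightarrow> 'e. \<forall>i. \<omega> i \<noteq> e}"
  assume H0: "emeasure (markov_measure K a) ?H \<noteq> 0"
  have "{\<omega> \<in> space (borel :: (nat \<Rightarrow> 'e) measure). \<forall>i. \<omega> i \<noteq> e} \<in> sets borel" by measurable
  then have H[measurable]: "?H \<in> sets borel" by simp
  have io: "AE \<omega> in markov_measure K e. \<forall>j. (path_shift ^^ j) \<omega> \<notin> ?H"
    using AE_iterates_return[OF finite_return] AE_markov_start
  proof eventually_elim
    case (elim \<omega>)
    note v = visit_time[OF elim]
    show ?case
    proof
      fix j
      have "j \<le> visit_time e \<omega> j" using v(1) by (rule strict_mono_imp_increasing)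
      then have "\<omega> (j + (visit_time e \<omega> j - j)) = e" using v(2) by simp
      then show "(path_shift ^^ j) \<omega> \<notin> ?H" unfolding funpow_path_shift by blast
    qed
  qed
  have "AE \<omega> in markov_measure K e. \<omega> j \<noteq> a" for j
  proof -
    let ?F = "\<lambda>v :: 'e list. indicator {a} (v ! j) :: ennreal"
    have m: "{\<omega>. \<omega> j = a} \<in> sets borel"
      by (rule finitely_determined_in_sets[of "Suc j"]) auto
    have "(\<integral>\<^sup>+\<omega>. indicator {\<omega>. \<omega> j = a} \<omega> * emeasure (markov_measure K a) ?H \<partial>markov_measure K e) =
      (\<integral>\<^sup>+\<omega>. ?F (restr \<omega> (Suc j)) * emeasure (markov_measure K (\<omega> j)) ?H \<partial>markov_measure K e)"
      by (intro nn_integral_cong) (auto simp: indicator_def)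
    also have "\<dots> = (\<integral>\<^sup>+\<omega>. ?F (restr \<omega> (Suc j)) * indicator ?H ((path_shift ^^ j) \<omega>) \<partial>markov_measure K e)"
      by (rule nn_integral_markov_property[OF H, symmetric])
    also have "\<dots> = (\<integral>\<^sup>+\<omega>. 0 \<partial>markov_measure K e)"
      using io by (intro nn_integral_cong_AE) (auto simp: indicator_def)
    finally have "emeasure (markov_measure K e) {\<omega>. \<omega> j = a} * emeasure (markov_measure K a) ?H = 0"
      using m by (simp add: nn_integral_multc)
    then have "emeasure (markov_measure K e) {\<omega>. \<omega> j = a} = 0"
      using H0 by simp
    then show ?thesis
      using m by (intro AE_I'[of "{\<omega>. \<omega> j = a}"]) (auto simp: null_sets_def)
  qed
  then have "AE \<omega> in markov_measure K e. \<forall>j. \<omega> j \<noteq> a"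
    by (simp add: AE_all_countable)
  then have "AE \<omega> in markov_measure K e. \<not> return_time a \<omega> < \<infinity>"
    by eventually_elim (simp add: return_time_eq_infinity_iff)
  from emeasure_eq_0_AE[OF this]
  have "measure (markov_measure K e) {\<omega>. return_time a \<omega> < \<infinity>} = 0"
    by (simp add: measure_def)
  moreover have "0 < measure (markov_measure K e) {\<omega>. return_time a \<omega> < \<infinity>}"
    using irred unfolding irreducible_chain_def by blast
  ultimately show False by simp
qed

context
  fixes \<pi> :: "'e pmf"
  assumes stat: "stationary K \<pi>"
begin

lemma emeasure_markov_init_path_shift:
  assumes A: "A \<in> sets borel"
  shows "emeasure (markov_measure_init K \<pi>) {\<omega>. path_shift \<omega> \<in> A} = emeasure (markov_measure_init K \<pi>) A"
proof -
  have "path_shift -` A \<inter> space borel \<in> sets borel"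
    by (rule measurable_sets[OF measurable_path_shift A])
  then have m: "{\<omega>. path_shift \<omega> \<in> A} \<in> sets borel" by (simp add: vimage_def)
  have "emeasure (markov_measure_init K \<pi>) {\<omega>. path_shift \<omega> \<in> A} =
      (\<integral>\<^sup>+a. \<integral>\<^sup>+b. emeasure (markov_measure K b) A \<partial>K a \<partial>\<pi>)"
    by (simp add: emeasure_markov_init[OF m] emeasure_markov_path_shift[OF A])
  also have "\<dots> = (\<integral>\<^sup>+b. emeasure (markov_measure K b) A \<partial>bind_pmf \<pi> K)"
    by simp
  also have "\<dots> = emeasure (markov_measure_init K \<pi>) A"
    using stat by (simp add: stationary_def emeasure_markov_init[OF A])
  finally show ?thesis .
qed

lemma kac:
  assumes A[measurable]: "A \<in> sets borel"
  shows "(\<Sum>j. ennreal (pmf \<pi> e) * emeasure (markov_measure K e)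
      {\<omega>. \<omega> 0 = e \<and> (\<forall>i. 1 \<le> i \<and> i \<le> j \<longrightarrow> \<omega> i \<noteq> e) \<and> (path_shift ^^ j) \<omega> \<in> A}) =
    emeasure (markov_measure_init K \<pi>) A"
proof -
  let ?I = "markov_measure_init K \<pi>"
  interpret prob_space ?I by (rule prob_space_markov_init)
  define B where "B j = {\<omega>. \<omega> 0 = e \<and> (\<forall>i. 1 \<le> i \<and> i \<le> j \<longrightarrow> \<omega> i \<noteq> e) \<and> (path_shift ^^ j) \<omega> \<in> A}" for j
  define Q where "Q n = {\<omega>. (\<forall>i\<le>n. \<omega> i \<noteq> e) \<and> (path_shift ^^ n) \<omega> \<in> A}" for n
  have T: "{\<omega>. (path_shift ^^ j) \<omega> \<in> A} \<in> sets borel" for j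
    using measurable_sets[OF measurable_funpow_path_shift A, of j] by (simp add: vimage_def)
  have B: "B j \<in> sets borel" for j
  proof -
    have "{\<omega>. \<omega> 0 = e \<and> (\<forall>i. 1 \<le> i \<and> i \<le> j \<longrightarrow> \<omega> i \<noteq> e)} \<in> sets borel"
      by (rule finitely_determined_in_sets[of "Suc j"]) (auto simp: less_Suc_eq_le)
    with T[of j] have "{\<omega>. \<omega> 0 = e \<and> (\<forall>i. 1 \<le> i \<and> i \<le> j \<longrightarrow> \<omega> i \<noteq> e)} \<inter> {\<omega>. (path_shift ^^ j) \<omega> \<in> A} \<in> sets borel"
      by (rule sets.Int[rotated])
    then show ?thesis by (simp add: B_def Int_def)
  qed
  have avoid: "{\<omega> :: nat \<Rightarrow> 'e. \<forall>i\<le>n. \<omega> i \<noteq> e} \<in> sets borel" for n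
    by (rule finitely_determined_in_sets[of "Suc n"]) (auto simp: less_Suc_eq_le)
  have Q: "Q n \<in> sets borel" for n
    using sets.Int[OF avoid[of n] T[of n]] by (simp add: Q_def Int_def)
  have split0: "emeasure ?I A = ennreal (pmf \<pi> e) * emeasure (markov_measure K e) (B 0) + emeasure ?I (Q 0)"
  proof -
    have "A = B 0 \<union> Q 0" "B 0 \<inter> Q 0 = {}" by (auto simp: B_def Q_def)
    then have "emeasure ?I A = emeasure ?I (B 0) + emeasure ?I (Q 0)"
      using B[of 0] Q[of 0] by (metis plus_emeasure sets_markov_init)
    then show ?thesis
      using emeasure_markov_init_start[OF B[of 0]] by (simp add: B_def)
  qed
  have split: "emeasure ?I (Q n) = ennreal (pmf \<pi> e) * emeasure (markov_measure K e) (B (Suc n)) + emeasure ?I (Q (Suc n))" for n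
  proof -
    have "{\<omega>. path_shift \<omega> \<in> Q n} = B (Suc n) \<union> Q (Suc n)" "B (Suc n) \<inter> Q (Suc n) = {}"
    proof -
      have all: "(\<forall>i\<le>Suc n. \<omega> i \<noteq> e) \<longleftrightarrow> \<omega> 0 \<noteq> e \<and> (\<forall>i\<le>n. \<omega> (Suc i) \<noteq> e)" for \<omega> :: "nat \<Rightarrow> 'e"
        by (metis le0 not0_implies_Suc Suc_le_mono)
      have all1: "(\<forall>i. 1 \<le> i \<and> i \<le> Suc n \<longrightarrow> \<omega> i \<noteq> e) \<longleftrightarrow> (\<forall>i\<le>n. \<omega> (Suc i) \<noteq> e)" for \<omega> :: "nat \<Rightarrow> 'e"
        by (metis One_nat_def Suc_le_D Suc_le_mono le0)
      have sh: "(path_shift ^^ n) (path_shift \<omega>) = (path_shift ^^ Suc n) \<omega>" for \<omega> :: "nat \<Rightarrow> 'e"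
        by (simp add: funpow_swap1)
      have ps: "path_shift \<omega> i = \<omega> (Suc i)" for \<omega> :: "nat \<Rightarrow> 'e" and i by (simp add: path_shift_def)
      show "{\<omega>. path_shift \<omega> \<in> Q n} = B (Suc n) \<union> Q (Suc n)"
        unfolding Q_def B_def mem_Collect_eq sh all all1 ps by auto
      show "B (Suc n) \<inter> Q (Suc n) = {}"
        by (auto simp: Q_def B_def)
    qed
    then have "emeasure ?I (Q n) = emeasure ?I (B (Suc n)) + emeasure ?I (Q (Suc n))"
      using B[of "Suc n"] Q[of "Suc n"] emeasure_markov_init_path_shift[OF Q[of n]]
      by (metis plus_emeasure sets_markov_init)
    then show ?thesis
      using emeasure_markov_init_start[OF B[of "Suc n"]] by (simp add: B_def)
  qed
  have partial: "(\<Sum>j<Suc n. ennreal (pmf \<pi> e) * emeasure (markov_measure K e) (B j)) + emeasure ?I (Q n) = emeasure ?I A" for n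
  proof (induction n)
    case (Suc n)
    then show ?case unfolding split[of n] by (simp add: add.assoc)
  qed (simp add: split0)
  have "(\<lambda>n. emeasure ?I (Q n)) \<longlonglongrightarrow> 0"
  proof (rule tendsto_sandwich[of "\<lambda>_. 0"])
    have "(\<lambda>n. emeasure ?I {\<omega>. \<forall>i\<le>n. \<omega> i \<noteq> e}) \<longlonglongrightarrow> emeasure ?I (\<Inter>n. {\<omega>. \<forall>i\<le>n. \<omega> i \<noteq> e})"
    proof (rule Lim_emeasure_decseq)
      show "decseq (\<lambda>n. {\<omega> :: nat \<Rightarrow> 'e. \<forall>i\<le>n. \<omega> i \<noteq> e})"
        by (intro decseq_SucI Collect_mono) (simp add: le_SucI)
    qed (use avoid in auto)
    also have "(\<Inter>n. {\<omega> :: nat \<Rightarrow> 'e. \<forall>i\<le>n. \<omega> i \<noteq> e}) = {\<omega>. \<forall>i. \<omega> i \<noteq> e}" by auto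
    also have "emeasure ?I {\<omega>. \<forall>i. \<omega> i \<noteq> e} = 0"
    proof -
      have "{\<omega> \<in> space (borel :: (nat \<Rightarrow> 'e) measure). \<forall>i. \<omega> i \<noteq> e} \<in> sets borel" by measurable
      then show ?thesis by (simp add: emeasure_markov_init emeasure_markov_avoid)
    qed
    finally show "(\<lambda>n. emeasure ?I {\<omega>. \<forall>i\<le>n. \<omega> i \<noteq> e}) \<longlonglongrightarrow> 0" .
    show "\<forall>\<^sub>F n in sequentially. emeasure ?I (Q n) \<le> emeasure ?I {\<omega>. \<forall>i\<le>n. \<omega> i \<noteq> e}"
      using avoid by (intro always_eventually allI emeasure_mono) (auto simp: Q_def)
  qed auto
  moreover have "(\<lambda>n. \<Sum>j<Suc n. ennreal (pmf \<pi> e) * emeasure (markov_measure K e) (B j))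
      \<longlonglongrightarrow> (\<Sum>j. ennreal (pmf \<pi> e) * emeasure (markov_measure K e) (B j))"
    by (intro LIMSEQ_Suc summable_LIMSEQ) auto
  ultimately have "(\<lambda>n. (\<Sum>j<Suc n. ennreal (pmf \<pi> e) * emeasure (markov_measure K e) (B j)) + emeasure ?I (Q n))
      \<longlonglongrightarrow> (\<Sum>j. ennreal (pmf \<pi> e) * emeasure (markov_measure K e) (B j)) + 0"
    by (intro tendsto_add)
  then have "(\<lambda>n::nat. emeasure ?I A) \<longlonglongrightarrow> (\<Sum>j. ennreal (pmf \<pi> e) * emeasure (markov_measure K e) (B j))"
    unfolding partial by simp
  then show ?thesis
    unfolding B_def[symmetric] using LIMSEQ_unique tendsto_const by blast
qed

lemma kac_return_time:
  "ennreal (pmf \<pi> e) * (\<integral>\<^sup>+\<omega>. ennreal_of_enat (return_time e \<omega>) \<partial>markov_measure K e) = 1"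
proof -
  interpret prob_space "markov_measure_init K \<pi>" by (rule prob_space_markov_init)
  have "(\<integral>\<^sup>+\<omega>. ennreal_of_enat (return_time e \<omega>) \<partial>markov_measure K e) =
      (\<integral>\<^sup>+\<omega>. of_nat (excursion_length e \<omega>) \<partial>markov_measure K e)"
  proof (rule nn_integral_cong_AE)
    show "AE \<omega> in markov_measure K e. ennreal_of_enat (return_time e \<omega>) = of_nat (excursion_length e \<omega>)"
      using finite_return
    proof eventually_elim
      case (elim \<omega>)
      then obtain t where "return_time e \<omega> = enat t" by auto
      then show ?case by (simp add: excursion_length_def)
    qed
  qed
  also have "\<dots> = (\<Sum>j. emeasure (markov_measure K e) {\<omega>. j < excursion_length e \<omega>})"
    by (subst nn_integral_nat_function) auto
  also have "(\<lambda>j. emeasure (markov_measure K e) {\<omega>. j < excursion_length e \<omega>}) =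
    (\<lambda>j. emeasure (markov_measure K e) {\<omega>. \<omega> 0 = e \<and> (\<forall>i. 1 \<le> i \<and> i \<le> j \<longrightarrow> \<omega> i \<noteq> e) \<and> (path_shift ^^ j) \<omega> \<in> UNIV})"
  proof (intro ext emeasure_eq_AE)
    fix j
    show "AE \<omega> in markov_measure K e. \<omega> \<in> {\<omega>. j < excursion_length e \<omega>} \<longleftrightarrow>
      \<omega> \<in> {\<omega>. \<omega> 0 = e \<and> (\<forall>i. 1 \<le> i \<and> i \<le> j \<longrightarrow> \<omega> i \<noteq> e) \<and> (path_shift ^^ j) \<omega> \<in> UNIV}"
      using finite_return AE_markov_start
    proof eventually_elim
      case (elim \<omega>)
      then obtain t where t: "return_time e \<omega> = enat t" by auto
      then have "excursion_length e \<omega> = t" by (simp add: excursion_length_def)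
      moreover have "j < t \<longleftrightarrow> (\<forall>i. 1 \<le> i \<and> i \<le> j \<longrightarrow> \<omega> i \<noteq> e)"
      proof -
        have *: "1 \<le> t" "\<omega> t = e" "\<And>i. 1 \<le> i \<Longrightarrow> i < t \<Longrightarrow> \<omega> i \<noteq> e"
          using t unfolding return_time_eq_enat_iff by auto
        show ?thesis
          using *(1,2) *(3)[OF _ le_less_trans[of _ j]] by (metis linorder_not_less)
      qed
      ultimately show ?case using elim(2) by simp
    qed
    have "{\<omega> \<in> space (borel :: (nat \<Rightarrow> 'e) measure). j < excursion_length e \<omega>} \<in> sets borel" by measurable
    then show "{\<omega>. j < excursion_length e \<omega>} \<in> sets (markov_measure K e)" by simp
    show "{\<omega>. \<omega> 0 = e \<and> (\<forall>i. 1 \<le> i \<and> i \<le> j \<longrightarrow> \<omega> i \<noteq> e) \<and> (path_shift ^^ j) \<omega> \<in> UNIV} \<in> sets (markov_measure K e)"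
      unfolding sets_markov by (rule finitely_determined_in_sets[of "Suc j"]) (auto simp: less_Suc_eq_le)
  qed
  finally have "ennreal (pmf \<pi> e) * (\<integral>\<^sup>+\<omega>. ennreal_of_enat (return_time e \<omega>) \<partial>markov_measure K e) =
      emeasure (markov_measure_init K \<pi>) UNIV"
    using kac[of UNIV] by simp
  then show ?thesis using emeasure_space_1 by simp
qed

end

end

section \<open>Decomposition at the last visit\<close>

definition excursion_prefix :: "'e \<Rightarrow> 'e list \<Rightarrow> bool" where
  "excursion_prefix e u \<longleftrightarrow> u \<noteq> [] \<and> u ! 0 = e \<and> (\<forall>i. 1 \<le> i \<and> i < length u \<longrightarrow> u ! i \<noteq> e)"

definition after_word :: "'e list \<Rightarrow> (nat \<Rightarrow> 'e) set \<Rightarrow> (nat \<Rightarrow> 'e) set" where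
  "after_word u A = {\<omega>. restr \<omega> (length u) = u \<and> (path_shift ^^ (length u - 1)) \<omega> \<in> A}"

lemma after_word_determined:
  assumes A: "\<And>\<omega> \<omega>'. (\<forall>i<L. \<omega> i = \<omega>' i) \<Longrightarrow> \<omega> \<in> A \<longleftrightarrow> \<omega>' \<in> A"
    and eq: "\<forall>i<length u + L. \<omega> i = \<omega>' i"
  shows "\<omega> \<in> after_word u A \<longleftrightarrow> \<omega>' \<in> after_word u A"
proof -
  have "(path_shift ^^ (length u - 1)) \<omega> \<in> A \<longleftrightarrow> (path_shift ^^ (length u - 1)) \<omega>' \<in> A"
    using eq by (intro A) (auto simp: funpow_path_shift)
  moreover have "restr \<omega> (length u) = u \<longleftrightarrow> restr \<omega>' (length u) = u"
    using eq by (auto simp: restr_eq_iff)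
  ultimately show ?thesis by (simp add: after_word_def)
qed

lemma sets_after_word[measurable]:
  fixes A :: "(nat \<Rightarrow> 'e::{countable, discrete_topology, second_countable_topology}) set"
  assumes A: "A \<in> sets borel"
  shows "after_word u A \<in> sets borel"
proof -
  have "{\<omega>. restr \<omega> (length u) = u} \<in> sets borel"
    by (rule finitely_determined_in_sets[of "length u"]) (auto simp: restr_eq_iff)
  moreover have "(path_shift ^^ (length u - 1)) -` A \<inter> space borel \<in> sets borel"
    by (rule measurable_sets[OF measurable_funpow_path_shift A])
  ultimately have "{\<omega>. restr \<omega> (length u) = u} \<inter> ((path_shift ^^ (length u - 1)) -` A \<inter> space borel) \<in> sets borel"
    by (rule sets.Int)
  then show ?thesis by (simp add: after_word_def Int_def vimage_def)
qed

text \<open>If a prefix \<open>u\<close> ends at time \<open>k\<close>, then it starts at the last visit to \<open>e\<close>.\<close>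

lemma excursion_prefix_unique:
  assumes u: "excursion_prefix e u" "length u - 1 \<le> k" "restr ((path_shift ^^ (k - (length u - 1))) \<omega>) (length u) = u"
    and v: "excursion_prefix e v" "length v - 1 \<le> k" "restr ((path_shift ^^ (k - (length v - 1))) \<omega>) (length v) = v"
  shows "u = v"
proof -
  have *: "\<not> length u < length v"
    if u: "excursion_prefix e u" "length u - 1 \<le> k" "restr ((path_shift ^^ (k - (length u - 1))) \<omega>) (length u) = u"
      and v: "excursion_prefix e v" "length v - 1 \<le> k" "restr ((path_shift ^^ (k - (length v - 1))) \<omega>) (length v) = v"
    for u v
  proof
    assume less: "length u < length v"
    have pos: "0 < length u" "u ! 0 = e" using u(1) by (auto simp: excursion_prefix_def)
    have uu: "\<forall>i<length u. \<omega> (k - (length u - 1) + i) = u ! i"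
      and vv: "\<forall>i<length v. \<omega> (k - (length v - 1) + i) = v ! i"
      using u(3) v(3) unfolding restr_eq_iff funpow_path_shift by blast+
    have "\<omega> (k - (length u - 1)) = u ! 0"
      using uu[rule_format, OF pos(1)] by simp
    moreover have "\<omega> (k - (length v - 1) + (length v - length u)) = v ! (length v - length u)"
      using less pos(1) by (intro vv[rule_format]) linarith
    moreover have "k - (length v - 1) + (length v - length u) = k - (length u - 1)"
      using less pos(1) v(2) by linarith
    ultimately have "v ! (length v - length u) = e" using pos(2) by simp
    moreover have "1 \<le> length v - length u" "length v - length u < length v"
      using less pos(1) by linarith+
    ultimately show False
      using v(1) unfolding excursion_prefix_def by blast
  qed
  have "length u = length v" using *[OF u v] *[OF v u] by simp
  then show ?thesis using u(3) v(3) by simp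
qed

context
  fixes K :: "'e::{countable, discrete_topology, second_countable_topology} \<Rightarrow> 'e pmf" and e :: 'e
    and \<pi> :: "'e pmf"
  assumes finite_return: "AE \<omega> in markov_measure K e. return_time e \<omega> \<noteq> \<infinity>"
    and irred: "irreducible_chain K" and stat: "stationary K \<pi>"
begin

lemma kac_words:
  assumes A[measurable]: "A \<in> sets borel"
  shows "(\<integral>\<^sup>+u. (if excursion_prefix e u
      then ennreal (pmf \<pi> e) * emeasure (markov_measure K e) (after_word u A) else 0) \<partial>count_space UNIV) =
    emeasure (markov_measure_init K \<pi>) A"
proof -
  define f where "f u = ennreal (pmf \<pi> e) * emeasure (markov_measure K e) (after_word u A)" for u
  define B where "B j = {\<omega>. \<omega> 0 = e \<and> (\<forall>i. 1 \<le> i \<and> i \<le> j \<longrightarrow> \<omega> i \<noteq> e) \<and> (path_shift ^^ j) \<omega> \<in> A}" for j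
  have B: "B j \<in> sets borel" for j
  proof -
    have "{\<omega>. \<omega> 0 = e \<and> (\<forall>i. 1 \<le> i \<and> i \<le> j \<longrightarrow> \<omega> i \<noteq> e)} \<in> sets borel"
      by (rule finitely_determined_in_sets[of "Suc j"]) (auto simp: less_Suc_eq_le)
    moreover have "(path_shift ^^ j) -` A \<inter> space borel \<in> sets borel"
      by (rule measurable_sets[OF measurable_funpow_path_shift A])
    ultimately have "{\<omega>. \<omega> 0 = e \<and> (\<forall>i. 1 \<le> i \<and> i \<le> j \<longrightarrow> \<omega> i \<noteq> e)} \<inter> ((path_shift ^^ j) -` A \<inter> space borel) \<in> sets borel"
      by (rule sets.Int)
    then show ?thesis by (simp add: B_def Int_def vimage_def)
  qed
  have pB: "ennreal (pmf \<pi> e) * emeasure (markov_measure K e) (B j) =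
      (\<integral>\<^sup>+u. (if j = length u - 1 then if excursion_prefix e u then f u else 0 else 0) \<partial>count_space UNIV)" for j
  proof -
    have piece: "(\<integral>\<^sup>+\<omega>. indicator (B j) \<omega> * indicator {u} (restr \<omega> (Suc j)) \<partial>markov_measure K e) =
      (if j = length u - 1 then if excursion_prefix e u then emeasure (markov_measure K e) (after_word u A) else 0 else 0)" for u
    proof (cases "excursion_prefix e u \<and> j = length u - 1")
      case True
      then have len: "length u = Suc j" by (cases u) (auto simp: excursion_prefix_def)
      have "indicator (B j) \<omega> * indicator {u} (restr \<omega> (Suc j)) = (indicator (after_word u A) \<omega> :: ennreal)" for \<omega>
      proof -
        have "\<omega> \<in> B j" if r: "restr \<omega> (Suc j) = u" and a: "(path_shift ^^ j) \<omega> \<in> A"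
        proof -
          have "\<forall>i<Suc j. \<omega> i = u ! i" using r by (auto simp: restr_eq_iff)
          moreover have "u ! 0 = e" "\<And>i. 1 \<le> i \<Longrightarrow> i < Suc j \<Longrightarrow> u ! i \<noteq> e"
            using conjunct1[OF True] by (simp_all add: excursion_prefix_def len)
          ultimately show ?thesis using a unfolding B_def by force
        qed
        moreover have "\<omega> \<in> B j \<Longrightarrow> (path_shift ^^ j) \<omega> \<in> A" by (simp add: B_def)
        ultimately show ?thesis by (auto simp: indicator_def after_word_def len)
      qed
      then show ?thesis using True A by simp
    next
      case False
      have "\<not> (\<omega> \<in> B j \<and> restr \<omega> (Suc j) = u)" for \<omega>
      proof
        assume *: "\<omega> \<in> B j \<and> restr \<omega> (Suc j) = u"
        then have h: "length u = Suc j" "\<And>i. i < Suc j \<Longrightarrow> u ! i = \<omega> i" by (auto simp: restr_eq_iff)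
        have "u ! i \<noteq> e" if "1 \<le> i" "i < length u" for i
          using that * by (simp add: h B_def)
        moreover have "u ! 0 = e" using * by (simp add: h(2) B_def)
        ultimately have "excursion_prefix e u \<and> j = length u - 1"
          using h(1) by (auto simp: excursion_prefix_def)
        with False show False ..
      qed
      then have "indicator (B j) \<omega> * indicator {u} (restr \<omega> (Suc j)) = (0 :: ennreal)" for \<omega>
        by (auto simp: indicator_def)
      then have "(\<integral>\<^sup>+\<omega>. indicator (B j) \<omega> * indicator {u} (restr \<omega> (Suc j)) \<partial>markov_measure K e) =
          (\<integral>\<^sup>+\<omega>. 0 \<partial>markov_measure K e)"
        by (intro nn_integral_cong)
      also have "\<dots> = (if j = length u - 1 then if excursion_prefix e u
          then emeasure (markov_measure K e) (after_word u A) else 0 else 0)"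
        using False by auto
      finally show ?thesis .
    qed
    have "emeasure (markov_measure K e) (B j) = (\<integral>\<^sup>+\<omega>. indicator (B j) \<omega> \<partial>markov_measure K e)"
      using B by simp
    also have "\<dots> = (\<integral>\<^sup>+u. (\<integral>\<^sup>+\<omega>. indicator (B j) \<omega> * indicator {u} (restr \<omega> (Suc j)) \<partial>markov_measure K e) \<partial>count_space UNIV)"
      using B by (intro nn_integral_countable_partition) auto
    finally have "ennreal (pmf \<pi> e) * emeasure (markov_measure K e) (B j) = (\<integral>\<^sup>+u. ennreal (pmf \<pi> e) *
      (if j = length u - 1 then if excursion_prefix e u then emeasure (markov_measure K e) (after_word u A) else 0 else 0) \<partial>count_space UNIV)"
      unfolding piece by (simp add: nn_integral_cmult)
    also have "\<dots> = (\<integral>\<^sup>+u. (if j = length u - 1 then if excursion_prefix e u then f u else 0 else 0) \<partial>count_space UNIV)"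
      by (intro nn_integral_cong) (simp add: f_def)
    finally show ?thesis .
  qed
  have "emeasure (markov_measure_init K \<pi>) A = (\<Sum>j. ennreal (pmf \<pi> e) * emeasure (markov_measure K e) (B j))"
    unfolding B_def by (rule kac[OF finite_return irred stat A, symmetric])
  also have "\<dots> = (\<integral>\<^sup>+u. (\<Sum>j. (if j = length u - 1 then if excursion_prefix e u then f u else 0 else 0)) \<partial>count_space UNIV)"
    unfolding pB by (rule nn_integral_suminf[symmetric]) simp
  also have "\<dots> = (\<integral>\<^sup>+u. (if excursion_prefix e u then f u else 0) \<partial>count_space UNIV)"
    by (rule nn_integral_cong, rule sums_unique[OF sums_single, symmetric])
  finally show ?thesis unfolding f_def by (rule sym)
qed

lemma kac_real:
  "0 < pmf \<pi> e" "(\<integral>\<^sup>+\<omega>. ennreal_of_enat (return_time e \<omega>) \<partial>markov_measure K e) = ennreal (1 / pmf \<pi> e)"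
proof -
  let ?T = "\<integral>\<^sup>+\<omega>. ennreal_of_enat (return_time e \<omega>) \<partial>markov_measure K e"
  have kac1: "ennreal (pmf \<pi> e) * ?T = 1" by (rule kac_return_time[OF finite_return irred stat])
  have "pmf \<pi> e \<noteq> 0"
  proof
    assume "pmf \<pi> e = 0"
    with kac1 show False by simp
  qed
  then show p: "0 < pmf \<pi> e" by (simp add: pmf_pos)
  have "?T \<noteq> top"
  proof
    assume "?T = top"
    with kac1 p show False by (simp add: ennreal_mult_top)
  qed
  then obtain r where r: "0 \<le> r" "?T = ennreal r" by (cases ?T) auto
  with kac1 have "ennreal (pmf \<pi> e * r) = ennreal 1" by (simp add: ennreal_mult)
  then have "pmf \<pi> e * r = 1" using p r(1) by (subst (asm) ennreal_inj) auto
  then have "r = 1 / pmf \<pi> e" using p by (simp add: field_simps)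
  then show "?T = ennreal (1 / pmf \<pi> e)" using r(2) by simp
qed

context
  fixes \<theta> :: "'e list \<Rightarrow> 'x::topological_space \<Rightarrow> 'x" and x\<^sub>0 :: 'x and m :: "'x measure"
  assumes \<theta>_Nil: "\<And>x. \<theta> [] x = x" and \<theta>_append: "\<And>u v x. \<theta> (u @ v) x = \<theta> v (\<theta> u x)"
    and \<theta>_cont: "\<And>u. continuous_on UNIV (\<theta> u)"
    and m: "prob_space m" "sets m = sets borel"
    and inv: "\<And>w. admissible K w \<Longrightarrow> hd w = e \<Longrightarrow> distr m m (\<theta> w) = m"
    and equi: "AE \<omega> in markov_measure K e. equidistributes (\<lambda>n. \<theta> (restr \<omega> (visit_time e \<omega> n)) x\<^sub>0) m"
begin

lemma lower_mean_visits:
  "AE \<omega> in markov_measure K e. \<forall>\<phi>. continuous_on UNIV \<phi> \<longrightarrow> (\<forall>x. 0 \<le> \<phi> x) \<longrightarrow> (\<forall>x. \<phi> x \<le> 1) \<longrightarrow>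
    lower_mean (\<lambda>k. \<phi> (\<theta> (restr \<omega> k) x\<^sub>0) * indicator {e} (\<omega> k)) (pmf \<pi> e * (\<integral>x. \<phi> x \<partial>m))"
proof -
  let ?p = "pmf \<pi> e"
  have p: "0 < ?p" by (rule kac_real)
  have "AE \<omega> in markov_measure K e. \<forall>j. \<forall>\<^sub>F n in sequentially.
    (\<Sum>k<n. real (excursion_length e ((renewal_shift e ^^ k) \<omega>))) \<le> (1 / ?p + 1 / real (Suc j)) * real n"
  proof (subst AE_all_countable, rule allI)
    fix j
    show "AE \<omega> in markov_measure K e. \<forall>\<^sub>F n in sequentially.
      (\<Sum>k<n. real (excursion_length e ((renewal_shift e ^^ k) \<omega>))) \<le> (1 / ?p + 1 / real (Suc j)) * real n"
    proof (rule AE_sum_excursion_length_le[OF finite_return])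
      show "(\<integral>\<^sup>+\<omega>. ennreal_of_enat (return_time e \<omega>) \<partial>markov_measure K e) < \<infinity>"
        unfolding kac_real(2) by simp
      have "0 < 1 / real (Suc j)" by simp
      then show "(\<integral>\<^sup>+\<omega>. ennreal_of_enat (return_time e \<omega>) \<partial>markov_measure K e) < ennreal (1 / ?p + 1 / real (Suc j))"
        unfolding kac_real(2) using p by (intro ennreal_lessI) (auto intro!: add_pos_pos)
    qed
  qed
  then show ?thesis
    using equi AE_iterates_return[OF finite_return] AE_markov_start
  proof eventually_elim
    case (elim \<omega>)
    note v = visit_time[OF elim(3,4)]
    show ?case
    proof (intro allI impI)
      fix \<phi> :: "'x \<Rightarrow> real" assume \<phi>: "continuous_on UNIV \<phi>" "\<forall>x. 0 \<le> \<phi> x" "\<forall>x. \<phi> x \<le> 1"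
      let ?a = "\<lambda>k. \<phi> (\<theta> (restr \<omega> k) x\<^sub>0) * indicator {e} (\<omega> k)"
      have "\<phi> \<in> bcontfun"
        using \<phi> by (auto simp: bcontfun_def bounded_iff intro!: exI[of _ 1])
      then have "(\<lambda>n. (\<Sum>k<n. \<phi> (\<theta> (restr \<omega> (visit_time e \<omega> k)) x\<^sub>0)) / real n) \<longlonglongrightarrow> (\<integral>x. \<phi> x \<partial>m)"
        using elim(2) by (auto simp: equidistributes_def)
      then have lim: "(\<lambda>n. (\<Sum>k<n. ?a (visit_time e \<omega> k)) / real n) \<longlonglongrightarrow> (\<integral>x. \<phi> x \<partial>m)"
        by (simp add: v(2))
      have "lower_mean ?a ((\<integral>x. \<phi> x \<partial>m) / (1 / ?p + 1 / real (Suc j)))" for j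
      proof (rule lower_mean_subsequence[OF v(1) _ _ lim])
        show "0 \<le> ?a k" for k using \<phi>(2) by simp
        show "0 < 1 / ?p + 1 / real (Suc j)" using p by (auto intro!: add_pos_pos)
        show "\<forall>\<^sub>F n in sequentially. real (visit_time e \<omega> n) \<le> (1 / ?p + 1 / real (Suc j)) * real n"
          using elim(1)[rule_format, of j] by (simp add: visit_time_def)
      qed
      moreover have "(\<lambda>j. (\<integral>x. \<phi> x \<partial>m) / (1 / ?p + 1 / real (Suc j))) \<longlonglongrightarrow> (\<integral>x. \<phi> x \<partial>m) / (1 / ?p + 0)"
        using p by (intro tendsto_divide tendsto_add tendsto_const LIMSEQ_Suc lim_1_over_n) auto
      ultimately have "lower_mean ?a ((\<integral>x. \<phi> x \<partial>m) / (1 / ?p + 0))"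
        by (rule lower_mean_closed[rotated])
      then show "lower_mean ?a (?p * (\<integral>x. \<phi> x \<partial>m))"
        by (simp add: mult.commute)
    qed
  qed
qed

lemma lower_mean_after_word:
  fixes \<phi> :: "'x \<Rightarrow> real"
  assumes \<phi>: "continuous_on UNIV \<phi>" "\<And>x. 0 \<le> \<phi> x" "\<And>x. \<phi> x \<le> 1"
    and A: "\<And>\<omega> \<omega>'. (\<forall>i<L. \<omega> i = \<omega>' i) \<Longrightarrow> \<omega> \<in> A \<longleftrightarrow> \<omega>' \<in> A"
    and u: "excursion_prefix e u"
  shows "AE \<omega> in markov_measure K e.
    lower_mean (\<lambda>k. \<phi> (\<theta> (butlast u) (\<theta> (restr \<omega> k) x\<^sub>0)) * indicator (after_word u A) ((path_shift ^^ k) \<omega>))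
      ((\<integral>x. \<phi> x \<partial>m) * (pmf \<pi> e * measure (markov_measure K e) (after_word u A)))"
proof (cases "measure (markov_measure K e) (after_word u A) = 0")
  case True
  show ?thesis
    unfolding True using \<phi>(2) by (intro AE_I2 lower_mean_mono[OF lower_mean_zero]) auto
next
  case False
  interpret P: prob_space "markov_measure K e" by (rule prob_space_markov)
  let ?B = "after_word u A" and ?w = "butlast u"
  have Am: "A \<in> sets borel" using A by (rule finitely_determined_in_sets)
  have Bm: "?B \<in> sets borel" using Am by (rule sets_after_word)
  have fin_det: "\<omega> \<in> ?B \<longleftrightarrow> \<omega>' \<in> ?B" if "\<forall>i<length u + L. \<omega> i = \<omega>' i" for \<omega> \<omega>'
    using after_word_determined[OF A that] .
  have len: "0 < length u" using u by (auto simp: excursion_prefix_def)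
  have inv_w: "distr m m (\<theta> ?w) = m"
  proof (cases "?w = []")
    case True
    have "distr m m (\<theta> []) = distr m m (\<lambda>x. x)" by (intro distr_cong) (auto simp: \<theta>_Nil)
    then show ?thesis using True by (simp add: distr_id2)
  next
    case w: False
    have "measure (markov_measure K e) ?B \<le> measure (markov_measure K e) {\<omega>. \<forall>i\<le>length u - 1. \<omega> i = u ! i}"
    proof (rule P.finite_measure_mono)
      show "?B \<subseteq> {\<omega>. \<forall>i\<le>length u - 1. \<omega> i = u ! i}"
      proof safe
        fix \<omega> i assume "\<omega> \<in> ?B" "i \<le> length u - 1"
        moreover from this len have "i < length u" by linarith
        ultimately show "\<omega> i = u ! i" by (simp add: after_word_def restr_eq_iff)
      qed
    qed (simp add: sets_cylinder)
    moreover have "0 < measure (markov_measure K e) ?B"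
      using False by (simp add: zero_less_measure_iff)
    ultimately have "0 < measure (markov_measure K e) {\<omega>. \<forall>i\<le>length u - 1. \<omega> i = u ! i}"
      by linarith
    then have "emeasure (markov_measure K e) {\<omega>. \<forall>i\<le>length u - 1. \<omega> i = u ! i} \<noteq> 0"
      unfolding measure_def by auto
    then have "(\<Prod>i<length u - 1. ennreal (pmf (K (u ! i)) (u ! Suc i))) \<noteq> 0"
      by (auto simp: emeasure_markov_cylinder split: if_splits)
    then have pos: "0 < pmf (K (u ! i)) (u ! Suc i)" if "i < length u - 1" for i
      using that by (auto simp: pmf_pos)
    have "admissible K ?w"
      unfolding admissible_def
    proof (intro conjI allI impI w)
      fix k assume k: "1 \<le> k \<and> k < length ?w"
      then show "0 < pmf (K (?w ! (k - 1))) (?w ! k)"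
      proof -
        have "k - 1 < length u - 1" using k by simp linarith
        then show ?thesis
          using k pos[of "k - 1"] nth_butlast[of "k - 1" u] nth_butlast[of k u] by simp
      qed
    qed
    moreover have "hd ?w = e"
      using u w nth_butlast[of 0 u] by (simp add: excursion_prefix_def hd_conv_nth del: length_butlast)
    ultimately show ?thesis by (rule inv)
  qed
  define \<phi>' where "\<phi>' x = \<phi> (\<theta> ?w x)" for x
  have \<phi>': "continuous_on UNIV \<phi>'" "\<And>x. 0 \<le> \<phi>' x" "\<And>x. \<phi>' x \<le> 1"
    using \<phi>(2,3) continuous_on_compose2[OF \<phi>(1) \<theta>_cont] by (auto simp: \<phi>'_def)
  have "\<theta> ?w \<in> m \<rightarrow>\<^sub>M m" "\<phi> \<in> borel_measurable m"
    using borel_measurable_continuous_onI[OF \<theta>_cont] borel_measurable_continuous_onI[OF \<phi>(1)]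
      measurable_cong_sets[OF m(2) m(2)] measurable_cong_sets[OF m(2) refl]
      measurable_cong_sets[OF refl m(2)] by blast+
  then have int_eq: "(\<integral>x. \<phi>' x \<partial>m) = (\<integral>x. \<phi> x \<partial>m)"
    using integral_distr[of "\<theta> ?w" m m \<phi>] by (simp add: inv_w \<phi>'_def)
  have meas: "measure (markov_measure K a) ?B = indicator {e} a * measure (markov_measure K e) ?B" for a
  proof (cases "a = e")
    case False
    have "AE \<omega> in markov_measure K a. \<not> \<omega> \<in> ?B"
      using AE_markov_start
    proof eventually_elim
      case (elim \<omega>)
      show ?case
      proof
        assume "\<omega> \<in> ?B"
        then have "\<omega> 0 = u ! 0" using len by (auto simp: after_word_def restr_eq_iff)
        then show False using elim False u by (simp add: excursion_prefix_def)
      qed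
    qed
    from emeasure_eq_0_AE[OF this] show ?thesis using False by (simp add: measure_def)
  qed simp
  have "AE \<omega> in markov_measure K e. (\<lambda>n. (\<Sum>k<n. \<phi>' (\<theta> (restr \<omega> k) x\<^sub>0) *
    (indicator ?B ((path_shift ^^ k) \<omega>) - measure (markov_measure K (\<omega> k)) ?B)) / real n) \<longlonglongrightarrow> 0"
  proof (rule AE_markov_mean_zero[where L = "length u + L"])
    fix k and \<omega> \<omega>' :: "nat \<Rightarrow> 'e" assume "\<forall>i\<le>k. \<omega> i = \<omega>' i"
    then have "restr \<omega> k = restr \<omega>' k" by (auto simp: restr_eq_iff)
    then show "\<phi>' (\<theta> (restr \<omega> k) x\<^sub>0) = \<phi>' (\<theta> (restr \<omega>' k) x\<^sub>0)" by simp
  qed (use \<phi>' fin_det in auto)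
  then show ?thesis
    using lower_mean_visits
  proof eventually_elim
    case (elim \<omega>)
    have "lower_mean (\<lambda>k. \<phi>' (\<theta> (restr \<omega> k) x\<^sub>0) * indicator {e} (\<omega> k)) (pmf \<pi> e * (\<integral>x. \<phi>' x \<partial>m))"
      using elim(2) \<phi>' by blast
    then have "lower_mean (\<lambda>k. measure (markov_measure K e) ?B * (\<phi>' (\<theta> (restr \<omega> k) x\<^sub>0) * indicator {e} (\<omega> k)))
      (measure (markov_measure K e) ?B * (pmf \<pi> e * (\<integral>x. \<phi>' x \<partial>m)))"
      by (rule lower_mean_cmult) simp
    note low = lower_mean_add[OF lower_meanI_tendsto[OF elim(1)] this]
    have eq: "\<phi>' (\<theta> (restr \<omega> k) x\<^sub>0) * (indicator ?B ((path_shift ^^ k) \<omega>) - measure (markov_measure K (\<omega> k)) ?B) +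
      measure (markov_measure K e) ?B * (\<phi>' (\<theta> (restr \<omega> k) x\<^sub>0) * indicator {e} (\<omega> k)) =
      \<phi>' (\<theta> (restr \<omega> k) x\<^sub>0) * indicator ?B ((path_shift ^^ k) \<omega>)" for k
      by (simp add: meas[of "\<omega> k"] algebra_simps)
    have lim: "0 + measure (markov_measure K e) ?B * (pmf \<pi> e * (\<integral>x. \<phi> x \<partial>m)) =
        (\<integral>x. \<phi> x \<partial>m) * (pmf \<pi> e * measure (markov_measure K e) ?B)"
      by simp
    show ?case
      using low unfolding eq int_eq lim unfolding \<phi>'_def .
  qed
qed

lemma lower_mean_product:
  fixes \<phi> :: "'x \<Rightarrow> real"
  assumes \<phi>: "continuous_on UNIV \<phi>" "\<And>x. 0 \<le> \<phi> x" "\<And>x. \<phi> x \<le> 1"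
    and A: "\<And>\<omega> \<omega>'. (\<forall>i<L. \<omega> i = \<omega>' i) \<Longrightarrow> \<omega> \<in> A \<longleftrightarrow> \<omega>' \<in> A"
  shows "AE \<omega> in markov_measure K e.
    lower_mean (\<lambda>k. \<phi> (\<theta> (restr \<omega> k) x\<^sub>0) * indicator A ((path_shift ^^ k) \<omega>))
      ((\<integral>x. \<phi> x \<partial>m) * measure (markov_measure_init K \<pi>) A)"
proof -
  let ?p = "pmf \<pi> e" and ?M = "\<lambda>u. measure (markov_measure K e) (after_word u A)"
  interpret P: prob_space "markov_measure K e" by (rule prob_space_markov)
  interpret I: prob_space "markov_measure_init K \<pi>" by (rule prob_space_markov_init)
  have Am: "A \<in> sets borel" using A by (rule finitely_determined_in_sets)
  have "AE \<omega> in markov_measure K e. \<forall>u. excursion_prefix e u \<longrightarrow>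
    lower_mean (\<lambda>k. \<phi> (\<theta> (butlast u) (\<theta> (restr \<omega> k) x\<^sub>0)) * indicator (after_word u A) ((path_shift ^^ k) \<omega>))
      ((\<integral>x. \<phi> x \<partial>m) * (?p * ?M u))"
    unfolding AE_all_countable
  proof
    fix u show "AE \<omega> in markov_measure K e. excursion_prefix e u \<longrightarrow>
      lower_mean (\<lambda>k. \<phi> (\<theta> (butlast u) (\<theta> (restr \<omega> k) x\<^sub>0)) * indicator (after_word u A) ((path_shift ^^ k) \<omega>))
        ((\<integral>x. \<phi> x \<partial>m) * (?p * ?M u))"
      using lower_mean_after_word[OF \<phi> A, of L u] by (cases "excursion_prefix e u") auto
  qed
  then show ?thesis
  proof eventually_elim
    case (elim \<omega>)
    let ?a = "\<lambda>k. \<phi> (\<theta> (restr \<omega> k) x\<^sub>0) * indicator A ((path_shift ^^ k) \<omega>)"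
    have a0: "0 \<le> ?a k" for k using \<phi>(2) by simp
    define b where "b u k = \<phi> (\<theta> (butlast u) (\<theta> (restr \<omega> k) x\<^sub>0)) * indicator (after_word u A) ((path_shift ^^ k) \<omega>)" for u k
    have b: "0 \<le> b u k" "b u k \<le> 1" for u k
      using \<phi>(2,3) by (auto simp: b_def indicator_def)
    define d where "d u k = (if k < length u - 1 then 0 else b u (k - (length u - 1)))" for u k
    have d0: "0 \<le> d u k" for u k using b(1) by (simp add: d_def)
    have d_eq: "length u - 1 \<le> k \<and> restr ((path_shift ^^ (k - (length u - 1))) \<omega>) (length u) = u \<and> d u k = ?a k"
      if nz: "d u k \<noteq> 0" and u: "excursion_prefix e u" for u k
    proof -
      let ?s = "length u - 1"
      have k: "?s \<le> k" and mem: "(path_shift ^^ (k - ?s)) \<omega> \<in> after_word u A"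
        using nz by (auto simp: d_def b_def indicator_def split: if_splits)
      have r: "restr ((path_shift ^^ (k - ?s)) \<omega>) (length u) = u"
        and Ain: "(path_shift ^^ ?s) ((path_shift ^^ (k - ?s)) \<omega>) \<in> A"
        using mem by (auto simp: after_word_def)
      have "(path_shift ^^ ?s) ((path_shift ^^ (k - ?s)) \<omega>) = (path_shift ^^ k) \<omega>"
        using k by (simp add: funpow_path_shift)
      with Ain have A1: "(path_shift ^^ k) \<omega> \<in> A" by simp
      have "restr ((path_shift ^^ (k - ?s)) \<omega>) ?s = butlast u"
        using r by (auto simp: restr_eq_iff nth_butlast)
      then have "restr \<omega> k = restr \<omega> (k - ?s) @ butlast u"
        using restr_add[of \<omega> "k - ?s" ?s] k by simp
      then have "d u k = ?a k"
        using k mem A1 by (simp add: d_def b_def \<theta>_append)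
      with k r show ?thesis by blast
    qed
    have sum_le: "(\<Sum>u\<in>F. d u k) \<le> ?a k" if F: "finite F" "\<And>u. u \<in> F \<Longrightarrow> excursion_prefix e u" for F k
    proof (cases "\<exists>u\<in>F. d u k \<noteq> 0")
      case True
      then obtain u where u: "u \<in> F" "d u k \<noteq> 0" by blast
      have "d v k = 0" if "v \<in> F - {u}" for v
      proof (rule ccontr)
        assume "d v k \<noteq> 0"
        then have "v = u"
          using d_eq[of v k] d_eq[OF u(2)] u(1) that F(2) by (intro excursion_prefix_unique[of e v k \<omega> u]) auto
        then show False using that by simp
      qed
      then have "(\<Sum>u\<in>F. d u k) = d u k"
        using F(1) u(1) by (simp add: sum.remove)
      then show ?thesis using d_eq[OF u(2)] F(2)[OF u(1)] by simp
    next
      case False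
      then have "(\<Sum>u\<in>F. d u k) = 0" by (intro sum.neutral) auto
      then show ?thesis using a0 by simp
    qed
    have m0: "0 \<le> (\<integral>x. \<phi> x \<partial>m)" using \<phi>(2) by (intro integral_nonneg_AE) auto
    show "lower_mean ?a ((\<integral>x. \<phi> x \<partial>m) * measure (markov_measure_init K \<pi>) A)"
    proof (cases "(\<integral>x. \<phi> x \<partial>m) = 0")
      case True
      show ?thesis
        unfolding True using a0 by (intro lower_mean_mono[OF lower_mean_zero]) auto
    next
      case False
      with m0 have mpos: "0 < (\<integral>x. \<phi> x \<partial>m)" by simp
      show ?thesis
      proof (rule lower_mean_dense)
        fix c assume c: "c < (\<integral>x. \<phi> x \<partial>m) * measure (markov_measure_init K \<pi>) A"
        show "lower_mean ?a c"
        proof (cases "c < 0")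
          case True
          then show ?thesis using a0 by (intro lower_mean_mono[OF lower_mean_zero]) auto
        next
          case c0: False
          let ?c = "c / (\<integral>x. \<phi> x \<partial>m)"
          have "?c < measure (markov_measure_init K \<pi>) A"
            using c mpos by (simp add: field_simps)
          then have "ennreal ?c < emeasure (markov_measure_init K \<pi>) A"
            using c0 mpos by (simp add: I.emeasure_eq_measure ennreal_lessI order_le_less_trans[of 0 ?c])
          then obtain F where F: "finite F" "ennreal ?c < (\<Sum>u\<in>F. if excursion_prefix e u
              then ennreal ?p * emeasure (markov_measure K e) (after_word u A) else 0)"
            using less_nn_integral_count_space_finite[of "ennreal ?c"] unfolding kac_words[OF Am, symmetric] by blast
          define G where "G = {u \<in> F. excursion_prefix e u}"
          have G: "finite G" "\<And>u. u \<in> G \<Longrightarrow> excursion_prefix e u" using F(1) by (auto simp: G_def)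
          have "(\<Sum>u\<in>F. if excursion_prefix e u then ennreal ?p * emeasure (markov_measure K e) (after_word u A) else 0) =
              (\<Sum>u\<in>G. ennreal ?p * emeasure (markov_measure K e) (after_word u A))"
            unfolding G_def using F(1) by (simp add: sum.inter_filter)
          also have "\<dots> = ennreal (\<Sum>u\<in>G. ?p * ?M u)"
            by (simp add: P.emeasure_eq_measure ennreal_mult[symmetric])
          finally have "ennreal ?c < ennreal (\<Sum>u\<in>G. ?p * ?M u)" using F(2) by simp
          then have "?c < (\<Sum>u\<in>G. ?p * ?M u)"
            using c0 mpos by (subst (asm) ennreal_less_iff) auto
          then have c_less: "c \<le> (\<Sum>u\<in>G. (\<integral>x. \<phi> x \<partial>m) * (?p * ?M u))"
            using mpos by (simp add: field_simps flip: sum_distrib_left)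
          have "lower_mean (\<lambda>k. \<Sum>u\<in>G. d u k) (\<Sum>u\<in>G. (\<integral>x. \<phi> x \<partial>m) * (?p * ?M u))"
          proof (rule lower_mean_sum[OF G(1)])
            fix u assume "u \<in> G"
            then have "lower_mean (b u) ((\<integral>x. \<phi> x \<partial>m) * (?p * ?M u))"
              using elim G(2) unfolding b_def by blast
            from lower_mean_shift[OF this, of "length u - 1"] b(2)
            show "lower_mean (d u) ((\<integral>x. \<phi> x \<partial>m) * (?p * ?M u))"
              unfolding d_def by simp
          qed
          then show ?thesis
            by (rule lower_mean_mono[OF _ sum_le[OF G] c_less])
        qed
      qed
    qed
  qed
qed

lemma tendsto_mean_product:
  fixes \<phi> :: "'x \<Rightarrow> real"
  assumes \<phi>: "continuous_on UNIV \<phi>" "\<And>x. 0 \<le> \<phi> x" "\<And>x. \<phi> x \<le> 1"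
    and A: "\<And>\<omega> \<omega>'. (\<forall>i<L. \<omega> i = \<omega>' i) \<Longrightarrow> \<omega> \<in> A \<longleftrightarrow> \<omega>' \<in> A"
  shows "AE \<omega> in markov_measure K e.
    (\<lambda>n. (\<Sum>k<n. \<phi> (\<theta> (restr \<omega> k) x\<^sub>0) * indicator A ((path_shift ^^ k) \<omega>)) / real n) \<longlonglongrightarrow>
      (\<integral>x. \<phi> x \<partial>m) * measure (markov_measure_init K \<pi>) A"
proof -
  interpret m: prob_space m by (rule m)
  interpret I: prob_space "markov_measure_init K \<pi>" by (rule prob_space_markov_init)
  have Am: "A \<in> sets borel" using A by (rule finitely_determined_in_sets)
  have fm: "\<phi> \<in> borel_measurable m"
    using borel_measurable_continuous_onI[OF \<phi>(1)] measurable_cong_sets[OF m(2) refl] by blast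
  have "integrable m \<phi>"
    by (rule m.integrable_const_bound[of _ 1]) (use \<phi> fm in auto)
  then have int: "(\<integral>x. 1 - \<phi> x \<partial>m) = 1 - (\<integral>x. \<phi> x \<partial>m)"
    by (simp add: m.prob_space)
  have compl: "measure (markov_measure_init K \<pi>) (- A) = 1 - measure (markov_measure_init K \<pi>) A"
    using I.prob_compl[of A] Am by (simp add: Compl_eq_Diff_UNIV)
  have c1: "continuous_on UNIV (\<lambda>x. 1 - \<phi> x)" by (intro continuous_intros \<phi>(1))
  have "\<omega> \<in> - A \<longleftrightarrow> \<omega>' \<in> - A" if "\<forall>i<L. \<omega> i = \<omega>' i" for \<omega> \<omega>'
    using A[OF that] by simp
  with lower_mean_product[of "\<lambda>_. 1" L "- A"]
  have "AE \<omega> in markov_measure K e. lower_mean (\<lambda>k. 1 * indicator (- A) ((path_shift ^^ k) \<omega>))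
      ((\<integral>x. 1 \<partial>m) * measure (markov_measure_init K \<pi>) (- A))"
    by (simp add: continuous_on_const)
  moreover have "AE \<omega> in markov_measure K e.
    lower_mean (\<lambda>k. (1 - \<phi> (\<theta> (restr \<omega> k) x\<^sub>0)) * indicator A ((path_shift ^^ k) \<omega>))
      ((\<integral>x. 1 - \<phi> x \<partial>m) * measure (markov_measure_init K \<pi>) A)"
    by (rule lower_mean_product[OF c1 _ _ A]) (use \<phi> in auto)
  moreover have "AE \<omega> in markov_measure K e.
    lower_mean (\<lambda>k. \<phi> (\<theta> (restr \<omega> k) x\<^sub>0) * indicator A ((path_shift ^^ k) \<omega>))
      ((\<integral>x. \<phi> x \<partial>m) * measure (markov_measure_init K \<pi>) A)"
    by (rule lower_mean_product[OF \<phi> A])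
  ultimately show ?thesis
  proof eventually_elim
    case (elim \<omega>)
    show ?case
    proof (rule lower_mean_imp_tendsto[OF elim(3)])
      show "lower_mean (\<lambda>k. 1 - \<phi> (\<theta> (restr \<omega> k) x\<^sub>0) * indicator A ((path_shift ^^ k) \<omega>))
          (1 - (\<integral>x. \<phi> x \<partial>m) * measure (markov_measure_init K \<pi>) A)"
        by (rule lower_mean_mono[OF lower_mean_add[OF elim(1,2)]])
          (auto simp: int compl m.prob_space indicator_def algebra_simps)
    qed
  qed
qed

end

end

lemma open_path_contains_cylinder:
  fixes U :: "(nat \<Rightarrow> 'e::topological_space) set"
  assumes "open U" "\<omega> \<in> U"
  obtains n where "\<And>\<omega>'. restr \<omega>' n = restr \<omega> n \<Longrightarrow> \<omega>' \<in> U"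
proof -
  obtain X where X: "\<omega> \<in> Pi\<^sub>E UNIV X" "finite {i. X i \<noteq> UNIV}" "Pi\<^sub>E UNIV X \<subseteq> U"
    using product_topology_open_contains_basis[of "\<lambda>_. euclidean" UNIV U \<omega>] assms
    by (auto simp: open_fun_def euclidean_product_topology[symmetric])
  obtain n where n: "\<And>i. X i \<noteq> UNIV \<Longrightarrow> i < n"
    using X(2) finite_nat_set_iff_bounded by auto
  show ?thesis
  proof (rule that[of n])
    fix \<omega>' assume r: "restr \<omega>' n = restr \<omega> n"
    have "\<omega>' i \<in> X i" for i
    proof (cases "X i = UNIV")
      case False
      then have "\<omega>' i = \<omega> i" using n r by (metis nth_restr)
      then show ?thesis using X(1) by auto
    qed simp
    then show "\<omega>' \<in> U" using X(3) by auto
  qed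
qed

lemma act_rprod:
  assumes act: "continuous_action gmult gunit act"
  shows "act (rprod gmult gunit hs) x = fold act hs x"
proof -
  have "act (fold gmult hs h) x = fold act hs (act h x)" for h
    using act by (induction hs arbitrary: h) (auto simp: continuous_action_def)
  then show ?thesis
    using act by (simp add: rprod_def continuous_action_def)
qed

lemma AE_equidistributes_at_visits:
  fixes K :: "'e::{countable, discrete_topology, second_countable_topology} \<Rightarrow> 'e pmf"
    and act :: "'g::topological_space \<Rightarrow> 'x::topological_space \<Rightarrow> 'x"
  assumes action: "continuous_action gmult gunit act"
    and ret: "AE \<omega> in markov_measure K e. return_time e \<omega> \<noteq> \<infinity>"
    and equi: "AE b in (\<Pi>\<^sub>M i\<in>(UNIV :: nat set). renewal_measure gmult gunit g K e).
      equidistributes (\<lambda>n. act (rprod gmult gunit (restr b n)) x\<^sub>0) m"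
  shows "AE \<omega> in markov_measure K e.
    equidistributes (\<lambda>n. act (rprod gmult gunit (map g (restr \<omega> (visit_time e \<omega> n)))) x\<^sub>0) m"
proof -
  have fold_act: "act (rprod gmult gunit hs) x = fold act hs x" for hs x
    by (rule act_rprod[OF action])
  define h where "h v = rprod gmult gunit (map g v)" for v
  define b where "b \<omega> = h (restr \<omega> (excursion_length e \<omega>))" for \<omega>
  have R: "renewal_measure gmult gunit g K e = distr (markov_measure K e) borel b"
    by (simp add: renewal_measure_def b_def[abs_def] h_def excursion_length_def)
  have eq: "distr (markov_measure K e) (\<Pi>\<^sub>M k\<in>(UNIV::nat set). borel) (\<lambda>\<omega> k. b ((renewal_shift e ^^ k) \<omega>)) =
      (\<Pi>\<^sub>M i\<in>(UNIV :: nat set). renewal_measure gmult gunit g K e)"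
    unfolding R b_def by (rule distr_renewal_increments[OF ret]) simp
  have "AE c in distr (markov_measure K e) (\<Pi>\<^sub>M k\<in>(UNIV::nat set). borel) (\<lambda>\<omega> k. b ((renewal_shift e ^^ k) \<omega>)).
    equidistributes (\<lambda>n. act (rprod gmult gunit (restr c n)) x\<^sub>0) m"
    unfolding eq by (rule equi)
  moreover have "(\<lambda>\<omega> k. b ((renewal_shift e ^^ k) \<omega>)) \<in> markov_measure K e \<rightarrow>\<^sub>M (\<Pi>\<^sub>M k\<in>(UNIV::nat set). borel)"
  proof (rule measurable_PiM_single')
    have "h \<in> count_space UNIV \<rightarrow>\<^sub>M borel" by simp
    from measurable_compose[OF measurable_restr_excursion(1) this] have "b \<in> borel \<rightarrow>\<^sub>M borel"
      by (simp add: b_def[abs_def])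
    from measurable_compose[OF measurable_compose_n[OF measurable_renewal_shift] this]
    show "(\<lambda>\<omega>. b ((renewal_shift e ^^ k) \<omega>)) \<in> markov_measure K e \<rightarrow>\<^sub>M borel" for k
      by simp
  qed auto
  ultimately have "AE \<omega> in markov_measure K e.
    equidistributes (\<lambda>n. act (rprod gmult gunit (restr (\<lambda>k. b ((renewal_shift e ^^ k) \<omega>)) n)) x\<^sub>0) m"
    by (rule AE_distrD[rotated])
  moreover have "act (rprod gmult gunit (restr (\<lambda>k. b ((renewal_shift e ^^ k) \<omega>)) n)) x\<^sub>0 =
    act (rprod gmult gunit (map g (restr \<omega> (visit_time e \<omega> n)))) x\<^sub>0" for \<omega> n
  proof (induction n)
    case 0
    show ?case by (simp add: restr_def visit_time_def)
  next
    case (Suc n)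
    let ?c = "\<lambda>k. b ((renewal_shift e ^^ k) \<omega>)"
    have "visit_time e \<omega> (Suc n) = visit_time e \<omega> n + excursion_length e ((renewal_shift e ^^ n) \<omega>)"
      by (simp add: visit_time_def)
    then have split: "restr \<omega> (visit_time e \<omega> (Suc n)) = restr \<omega> (visit_time e \<omega> n) @
        restr ((renewal_shift e ^^ n) \<omega>) (excursion_length e ((renewal_shift e ^^ n) \<omega>))"
      by (simp only: restr_add funpow_renewal_shift)
    have "restr ?c (Suc n) = restr ?c n @ [?c n]" by (simp add: restr_def)
    moreover have "fold act (restr ?c n) x\<^sub>0 = fold act (map g (restr \<omega> (visit_time e \<omega> n))) x\<^sub>0"
      using Suc.IH by (simp only: fold_act)
    ultimately show ?case
      unfolding split by (simp add: fold_act b_def h_def)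
  qed
  ultimately show ?thesis by simp
qed

theorem proposition3p8:
  fixes gmult :: "'g::t2_space \<Rightarrow> 'g \<Rightarrow> 'g" and gunit :: 'g and ginv :: "'g \<Rightarrow> 'g"
    and charts :: "('g set \<times> ('g \<Rightarrow> 'v::real_normed_vector) \<times> ('v \<Rightarrow> 'g)) set"
    and act :: "'g \<Rightarrow> 'x::second_countable_topology \<Rightarrow> 'x"
    and g :: "'e::{countable, discrete_topology, second_countable_topology} \<Rightarrow> 'g"
    and K :: "'e \<Rightarrow> 'e pmf" and \<pi> :: "'e pmf"
    and x\<^sub>0 :: 'x and e :: 'e and m :: "'x measure"
  assumes "lie_group gmult gunit ginv charts"
    and "locally_compact_space (euclidean :: 'x topology)"
    and "metrizable_space (euclidean :: 'x topology)"
    and "continuous_action gmult gunit act"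
    and "irreducible_chain K" and "positive_recurrent K" and "stationary K \<pi>"
    and "prob_space m" and "sets m = sets borel"
    and "\<And>w. admissible K w \<Longrightarrow> hd w = e \<Longrightarrow> distr m m (act (rprod gmult gunit (map g w))) = m"
    and "AE b in (\<Pi>\<^sub>M i\<in>(UNIV :: nat set). renewal_measure gmult gunit g K e).
      equidistributes (\<lambda>n. act (rprod gmult gunit (restr b n)) x\<^sub>0) m"
  shows "AE \<omega> in markov_measure K e.
    equidistributes (\<lambda>n. (act (rprod gmult gunit (map g (restr \<omega> n))) x\<^sub>0, (path_shift ^^ n) \<omega>))
      (m \<Otimes>\<^sub>M markov_measure_init K \<pi>)"
proof -
  note metrizable = assms(3) and action = assms(4) and irred = assms(5) and stat = assms(7)
    and m = assms(8,9) and invariant = assms(10) and equi = assms(11)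
  let ?I = "markov_measure_init K \<pi>"
  interpret m: prob_space m by (rule m)
  interpret I: prob_space ?I by (rule prob_space_markov_init)
  interpret mI: pair_prob_space m ?I ..
  define \<theta> where "\<theta> w = act (rprod gmult gunit (map g w))" for w
  have fold_act: "act (rprod gmult gunit hs) x = fold act hs x" for hs x
    by (rule act_rprod[OF action])
  have \<theta>_Nil: "\<theta> [] x = x" and \<theta>_append: "\<theta> (u @ v) x = \<theta> v (\<theta> u x)" for u v x
    by (simp_all add: \<theta>_def fold_act)
  have \<theta>_cont: "continuous_on UNIV (\<theta> u)" for u
  proof -
    have "continuous_on UNIV (\<lambda>(h, x). act h x)" using action by (simp add: continuous_action_def)
    from continuous_on_compose2[OF this, of UNIV "\<lambda>x. (rprod gmult gunit (map g u), x)"]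
    show ?thesis by (simp add: \<theta>_def[abs_def] continuous_on_Pair continuous_on_const continuous_on_id)
  qed
  have \<theta>_inv: "distr m m (\<theta> w) = m" if "admissible K w" "hd w = e" for w
    unfolding \<theta>_def by (rule invariant[OF that])
  have pos: "(\<integral>\<^sup>+\<omega>. ennreal_of_enat (return_time e \<omega>) \<partial>markov_measure K e) < \<infinity>"
    using assms(6) by (simp add: positive_recurrent_def)
  have ret: "AE \<omega> in markov_measure K e. return_time e \<omega> \<noteq> \<infinity>"
  proof -
    have "(\<lambda>\<omega>. ennreal_of_enat (return_time e \<omega>)) \<in> borel_measurable (markov_measure K e)"
      by (rule measurable_compose[of _ _ "count_space UNIV"]) (use measurable_return_time in auto)
    then have "AE \<omega> in markov_measure K e. ennreal_of_enat (return_time e \<omega>) \<noteq> \<infinity>"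
      using pos by (intro nn_integral_PInf_AE) auto
    then show ?thesis
    proof eventually_elim
      case (elim \<omega>)
      then show ?case by (cases "return_time e \<omega>") auto
    qed
  qed
  have renewal: "AE \<omega> in markov_measure K e. equidistributes (\<lambda>n. \<theta> (restr \<omega> (visit_time e \<omega> n)) x\<^sub>0) m"
    unfolding \<theta>_def by (rule AE_equidistributes_at_visits[OF action ret equi])
  obtain \<phi> :: "nat \<Rightarrow> 'x \<Rightarrow> real"
    where \<phi>: "\<And>n. continuous_on UNIV (\<phi> n)" "\<And>n x. 0 \<le> \<phi> n x" "\<And>n x. \<phi> n x \<le> 1"
      and sep: "\<And>U x. open U \<Longrightarrow> x \<in> U \<Longrightarrow> \<exists>n. \<phi> n x = 1 \<and> (\<forall>z. z \<notin> U \<longrightarrow> \<phi> n z = 0)"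
    by (rule separating_continuous_functions[OF metrizable]) blast
  define C where "C w = {\<omega>. restr \<omega> (length w) = w}" for w :: "'e list"
  have C_det: "\<omega> \<in> C w \<longleftrightarrow> \<omega>' \<in> C w" if "\<forall>i<length w. \<omega> i = \<omega>' i" for \<omega> \<omega>' w
    using that by (auto simp: C_def restr_eq_iff)
  have Cm[measurable]: "C w \<in> sets borel" for w
    by (rule finitely_determined_in_sets[of "length w"]) (rule C_det)
  define h where "h = (\<lambda>(n, w) z. \<phi> n (fst z) * indicator (C w) (snd z))"
  have prod_h: "(\<Prod>i\<in>F. h i (x, \<omega>)) = (\<Prod>i\<in>F. \<phi> (fst i) x) * indicator (\<Inter>i\<in>F. C (snd i)) \<omega>"
    if "finite F" for F x \<omega>
    using that by (induction F rule: finite_induct) (auto simp: h_def indicator_def)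
  have conv: "AE \<omega> in markov_measure K e.
    (\<lambda>n. (\<Sum>k<n. \<Prod>i\<in>F. h i (\<theta> (restr \<omega> k) x\<^sub>0, (path_shift ^^ k) \<omega>)) / real n) \<longlonglongrightarrow>
      (\<integral>z. (\<Prod>i\<in>F. h i z) \<partial>(m \<Otimes>\<^sub>M ?I))" if F: "finite F" for F
  proof -
    define \<psi> where "\<psi> x = (\<Prod>i\<in>F. \<phi> (fst i) x)" for x
    define A where "A = (\<Inter>i\<in>F. C (snd i))"
    have \<psi>: "continuous_on UNIV \<psi>" "\<And>x. 0 \<le> \<psi> x" "\<And>x. \<psi> x \<le> 1"
      unfolding \<psi>_def using \<phi> by (auto intro!: continuous_on_prod prod_nonneg prod_le_1)
    define L where "L = (\<Sum>i\<in>F. length (snd i))"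
    have A_det: "\<omega> \<in> A \<longleftrightarrow> \<omega>' \<in> A" if "\<forall>i<L. \<omega> i = \<omega>' i" for \<omega> \<omega>'
    proof -
      have "length (snd i) \<le> L" if "i \<in> F" for i
        unfolding L_def using F that by (intro member_le_sum) auto
      then have "\<omega> \<in> C (snd i) \<longleftrightarrow> \<omega>' \<in> C (snd i)" if "i \<in> F" for i
        using that \<open>\<forall>i<L. \<omega> i = \<omega>' i\<close> by (intro C_det) (meson less_le_trans)
      then show ?thesis by (auto simp: A_def)
    qed
    have Am: "A \<in> sets ?I"
      unfolding sets_markov_init by (rule finitely_determined_in_sets[of L]) (rule A_det)
    have \<psi>m: "\<psi> \<in> borel_measurable m"
      using borel_measurable_continuous_onI[OF \<psi>(1)] measurable_cong_sets[OF m(2) refl] by blast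
    have "(\<integral>z. (\<Prod>i\<in>F. h i z) \<partial>(m \<Otimes>\<^sub>M ?I)) = (\<integral>z. (case z of (x, \<omega>) \<Rightarrow> \<psi> x * indicator A \<omega>) \<partial>(m \<Otimes>\<^sub>M ?I))"
      by (intro Bochner_Integration.integral_cong) (auto simp: prod_h[OF F] \<psi>_def A_def)
    also have "\<dots> = (\<integral>x. (\<integral>\<omega>. \<psi> x * indicator A \<omega> \<partial>?I) \<partial>m)"
    proof -
      have "integrable (m \<Otimes>\<^sub>M ?I) (\<lambda>(x, \<omega>). \<psi> x * indicator A \<omega>)"
      proof (rule mI.P.integrable_const_bound[of _ 1])
        show "AE z in m \<Otimes>\<^sub>M ?I. norm (case z of (x, \<omega>) \<Rightarrow> \<psi> x * indicator A \<omega>) \<le> 1"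
          using \<psi>(2,3) by (auto simp: indicator_def)
        show "(\<lambda>(x, \<omega>). \<psi> x * indicator A \<omega>) \<in> borel_measurable (m \<Otimes>\<^sub>M ?I)"
          using \<psi>m Am by measurable
      qed
      from mI.integral_fst'[OF this] show ?thesis by simp
    qed
    also have "\<dots> = (\<integral>x. \<psi> x \<partial>m) * measure ?I A"
      using Am by simp
    finally have int: "(\<integral>z. (\<Prod>i\<in>F. h i z) \<partial>(m \<Otimes>\<^sub>M ?I)) = (\<integral>x. \<psi> x \<partial>m) * measure ?I A" .
    show ?thesis
      unfolding int prod_h[OF F] \<psi>_def[symmetric] A_def[symmetric]
      by (rule tendsto_mean_product[OF ret irred stat \<theta>_Nil \<theta>_append \<theta>_cont m \<theta>_inv renewal \<psi> A_det])
  qed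
  have "AE \<omega> in markov_measure K e. \<forall>F\<in>Collect finite.
    (\<lambda>n. (\<Sum>k<n. \<Prod>i\<in>F. h i (\<theta> (restr \<omega> k) x\<^sub>0, (path_shift ^^ k) \<omega>)) / real n) \<longlonglongrightarrow>
      (\<integral>z. (\<Prod>i\<in>F. h i z) \<partial>(m \<Otimes>\<^sub>M ?I))"
    using countable_Collect_finite conv by (subst AE_ball_countable) auto
  then show ?thesis
  proof eventually_elim
    case (elim \<omega>)
    have "equidistributes (\<lambda>n. (\<theta> (restr \<omega> n) x\<^sub>0, (path_shift ^^ n) \<omega>)) (m \<Otimes>\<^sub>M ?I)"
    proof (rule equidistributesI_family[of _ h])
      show "prob_space (m \<Otimes>\<^sub>M ?I)" by (rule mI.P.prob_space_axioms)
      have "sets (m \<Otimes>\<^sub>M ?I) = sets (borel \<Otimes>\<^sub>M borel)"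
        by (intro sets_pair_measure_cong m(2) sets_markov_init)
      also have "borel \<Otimes>\<^sub>M borel = (borel :: ('x \<times> (nat \<Rightarrow> 'e)) measure)"
        by (rule borel_prod)
      finally show "sets (m \<Otimes>\<^sub>M ?I) = sets borel" .
      fix i :: "nat \<times> 'e list"
      show "h i \<in> borel_measurable borel"
      proof -
        have "(\<lambda>z. \<phi> (fst i) (fst z)) \<in> borel_measurable (borel :: ('x \<times> (nat \<Rightarrow> 'e)) measure)"
          by (intro borel_measurable_continuous_onI continuous_on_compose2[OF \<phi>(1)] continuous_intros) auto
        moreover have "(snd :: 'x \<times> (nat \<Rightarrow> 'e) \<Rightarrow> _) \<in> borel \<rightarrow>\<^sub>M borel"
          by (intro borel_measurable_continuous_onI continuous_intros)
        then have "(\<lambda>z. indicator (C (snd i)) (snd z) :: real) \<in> borel_measurable (borel :: ('x \<times> (nat \<Rightarrow> 'e)) measure)"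
          by (rule measurable_compose) (simp add: Cm)
        ultimately show ?thesis
          unfolding h_def case_prod_beta by (rule borel_measurable_times)
      qed
      show "0 \<le> h i z" "h i z \<le> 1" for z
        using \<phi>(2,3) by (auto simp: h_def case_prod_beta indicator_def)
    next
      fix F :: "(nat \<times> 'e list) set" assume "finite F"
      then show "(\<lambda>n. (\<Sum>k<n. \<Prod>i\<in>F. h i (\<theta> (restr \<omega> k) x\<^sub>0, (path_shift ^^ k) \<omega>)) / real n) \<longlonglongrightarrow>
          (\<integral>z. (\<Prod>i\<in>F. h i z) \<partial>(m \<Otimes>\<^sub>M ?I))"
        using elim by blast
    next
      fix U :: "('x \<times> (nat \<Rightarrow> 'e)) set" and z assume U: "open U" "z \<in> U"
      then obtain V W where VW: "open V" "open W" "z \<in> V \<times> W" "V \<times> W \<subseteq> U"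
        by (rule open_prod_elim)
      obtain n where n: "\<phi> n (fst z) = 1" "\<forall>x. x \<notin> V \<longrightarrow> \<phi> n x = 0"
        using sep[OF VW(1), of "fst z"] VW(3) by auto
      obtain l where l: "\<And>\<omega>'. restr \<omega>' l = restr (snd z) l \<Longrightarrow> \<omega>' \<in> W"
        by (rule open_path_contains_cylinder[OF VW(2), of "snd z"]) (use VW(3) in auto)
      show "\<exists>i. h i z = 1 \<and> (\<forall>z'. z' \<notin> U \<longrightarrow> h i z' = 0)"
      proof (intro exI[of _ "(n, restr (snd z) l)"] conjI allI impI)
        show "h (n, restr (snd z) l) z = 1" using n(1) by (simp add: h_def C_def)
        fix z' assume "z' \<notin> U"
        then have "fst z' \<notin> V \<or> snd z' \<notin> W" using VW(4) by (cases z') auto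
        then show "h (n, restr (snd z) l) z' = 0"
          using n(2) l by (auto simp: h_def C_def indicator_def)
      qed
    qed
    then show ?case by (simp add: \<theta>_def)
  qed
qed

end
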